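(* Let $\delta\in(0,1)$ and let $\Phi_\delta$ be the upper envelope $$\Phi_\delta(x)=\sup_{\alpha\in(\delta-1,0]}G_{\alpha,\delta}(x).$$ Let $x_0\in[-1,0]$. If for $x_0$ the supremum is attained for some internal point $\alpha\in(\delta-1,0]$, then $x_0=x_0(\alpha)$ is the unique solution (in the gap $(\alpha-\delta,\alpha+\delta)$) of the equation $$\partial_\alpha G_{\alpha,\delta}(x)=0 .$$ Otherwise, the supremum is attained as $\alpha\to\delta-1$, and $\Phi_\delta(x_0)=G_\delta(x_0)$.
   Context: For $\delta-1<\alpha\le 0$ let $E(\alpha,\delta)=[-1,1]\setminus(\alpha-\delta,\alpha+\delta)$, and let $G_{\alpha,\delta}(z)$ be the Green function of the domain $\overline{\mathbb{C}}\setminus E(\alpha,\delta)$ with respect to infinity, extended by $0$ to $E(\alpha,\delta)$. Let $G_\delta(z)$ be the Green function of $\overline{\mathbb{C}}\setminus[-1+2\delta,1]$ with respect to infinity, extended by $0$ to $[-1+2\delta,1]$. One has $\lim_{\alpha\to-1+\delta}G_{\alpha,\delta}(x)=G_\delta(x)$ for $x\in(-1,-1+2\delta)$.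
   Formalization: The point x_0 is taken in (-1,0] instead of [-1,0]: at x_0=-1 every G_{α,δ}(-1) is 0, so the supremum 0 is attained at every internal α, yet -1 lies in no gap (α-δ,α+δ), and the claim fails there. *)

theory Defs
  imports "HOL-Complex_Analysis.Complex_Analysis" "HOL-Library.Landau_Symbols"
begin

text \<open>
  A function is harmonic on an open set if it is twice continuously differentiable there, in the
  real sense, and its Laplacian vanishes. The witnesses \<open>ux\<close>, \<open>uy\<close> are the first and
  \<open>uxx\<close>, \<open>uxy\<close>, \<open>uyx\<close>, \<open>uyy\<close> the second partial derivatives.
\<close>

definition harmonic_on :: "(complex \<Rightarrow> real) \<Rightarrow> complex set \<Rightarrow> bool" where
  "harmonic_on u S \<longleftrightarrow> open S \<and>
    (\<exists>ux uy uxx uxy uyx uyy.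
      (\<forall>z\<in>S.
        (u has_derivative (\<lambda>h. ux z * Re h + uy z * Im h)) (at z) \<and>
        (ux has_derivative (\<lambda>h. uxx z * Re h + uxy z * Im h)) (at z) \<and>
        (uy has_derivative (\<lambda>h. uyx z * Re h + uyy z * Im h)) (at z) \<and>
        uxx z + uyy z = 0) \<and>
      continuous_on S uxx \<and> continuous_on S uxy \<and>
      continuous_on S uyx \<and> continuous_on S uyy)"

text \<open>
  The Green function, with respect to infinity, of the complement of a compact set \<open>K\<close> in the
  Riemann sphere, extended by \<open>0\<close> to \<open>K\<close>. The vanishing boundary values are required at every
  boundary point, not just quasi-everywhere: below, \<open>K\<close> is a finite union of nondegenerate
  segments, so the complement is regular for the Dirichlet problem.
\<close>

definition is_green_fun :: "complex set \<Rightarrow> (complex \<Rightarrow> real) \<Rightarrow> bool" where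
  "is_green_fun K g \<longleftrightarrow>
     harmonic_on g (- K) \<and>
     (\<lambda>z. g z - ln (norm z)) \<in> O[at_infinity](\<lambda>_. 1) \<and>
     (\<forall>\<zeta>\<in>frontier K. (g \<longlongrightarrow> 0) (at \<zeta> within - K)) \<and>
     (\<forall>z\<in>K. g z = 0)"

definition green_fun :: "complex set \<Rightarrow> complex \<Rightarrow> real" where
  "green_fun K = (THE g. is_green_fun K g)"

definition remez_set :: "real \<Rightarrow> real \<Rightarrow> real set" where
  "remez_set \<alpha> \<delta> = {-1..1} - {\<alpha> - \<delta><..<\<alpha> + \<delta>}"

definition green_gap :: "real \<Rightarrow> real \<Rightarrow> complex \<Rightarrow> real" where
  "green_gap \<alpha> \<delta> = green_fun (complex_of_real ` remez_set \<alpha> \<delta>)"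

definition green_end :: "real \<Rightarrow> complex \<Rightarrow> real" where
  "green_end \<delta> = green_fun (complex_of_real ` {-1 + 2 * \<delta>..1})"

definition upper_envelope :: "real \<Rightarrow> real \<Rightarrow> real" where
  "upper_envelope \<delta> x = (SUP \<alpha>\<in>{\<delta> - 1<..0}. green_gap \<alpha> \<delta> (complex_of_real x))"

text \<open>
  The solutions \<open>x\<close>, in the gap, of the equation \<open>\<partial>\<^sub>\<alpha> G\<^sub>\<alpha>\<^sub>,\<^sub>\<delta>(x) = 0\<close>. The derivative is relative to the
  parameter range, so it is two-sided for \<open>\<alpha> < 0\<close> and left-sided for \<open>\<alpha> = 0\<close>.
\<close>

definition critical_points :: "real \<Rightarrow> real \<Rightarrow> real set" where
  "critical_points \<alpha> \<delta> = {x \<in> {\<alpha> - \<delta><..<\<alpha> + \<delta>}.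
     ((\<lambda>a. green_gap a \<delta> (complex_of_real x)) has_real_derivative 0)
       (at \<alpha> within {\<delta> - 1<..0})}"

end

theory Submission
  imports Defs
begin

text \<open>
  With \<open>x = \<alpha> - \<delta> cos \<theta>\<close> the Green function on the gap is
  \<open>F \<alpha> \<theta> = \<delta> \<integral>\<^sub>0\<^sup>\<theta> (\<gamma> + cos \<phi>) w (\<alpha> - \<delta> cos \<phi>) d\<phi>\<close> with \<open>w t = 1 / \<surd>(1 - t\<^sup>2)\<close>, where
  \<open>\<gamma> = \<gamma> \<alpha>\<close> is fixed by \<open>F \<alpha> \<pi> = 0\<close>. This comes from integrating the real part of
  \<open>(z - c) dz / \<surd>((z\<^sup>2 - 1) (z - \<alpha> + \<delta>) (z - \<alpha> - \<delta>))\<close>, whose periods around the two intervals are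
  imaginary, and from uniqueness of the Green function by the maximum principle.

  Differentiating in \<open>\<alpha>\<close> at fixed \<open>x\<close> gives a function \<open>D\<close> of \<open>\<theta>\<close> with
  \<open>dD/d\<theta> = w (\<delta> \<gamma>' sin\<^sup>2 \<theta> + 1 + \<gamma> cos \<theta>) / sin\<^sup>2 \<theta>\<close>. Since \<open>w'/w\<close> is increasing, \<open>\<gamma>' \<ge> 0\<close>;
  hence \<open>D\<close> is strictly increasing across the gap and has at most one zero, which is \<open>x\<^sub>0\<close> when the
  supremum is attained at \<open>\<alpha>\<close>. At the end point \<open>\<alpha> = 0\<close>, where maximality only gives \<open>D \<ge> 0\<close>, the
  symmetry of the set provides \<open>D = 0\<close> at \<open>x = 0\<close> and so \<open>D \<le> 0\<close> for \<open>x\<^sub>0 \<le> 0\<close>. As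
  \<open>\<alpha> \<rightarrow> \<delta> - 1\<close>, the normalization \<open>\<integral> w\<close> diverges, which forces \<open>\<gamma> \<rightarrow> -1\<close>, and \<open>F\<close> tends to the Green
  function of the single interval.
\<close>

subsection \<open>Uniqueness of the Green function\<close>

text \<open>The density \<open>w\<close> is what the substitution x = \<alpha> - \<delta> cos
  \<theta> leaves of the Green differential: the Jacobian \<delta> sin \<theta> cancels the two
  square roots that vanish at the ends of the gap, and only the factor belonging to -1 and 1
  survives. A real primitive of the differential has a constant limit at each slit, but in general
  two different constants; \<open>F \<alpha> pi = 0\<close> is the condition that they agree. The
  delicate point is \<alpha> -> \<delta> - 1. The density then becomes singular at \<phi> = 0,
  exactly where the integrals defining F start. Since F also vanishes at pi, it is rewritten as
  minus the integral from \<theta> to pi, which for fixed x > -1 stays away from the singularity;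
  after that only the limit of \<gamma> is missing. A maximizing \<alpha> leads to a critical point
  because F is positive inside the gap and 0 at its ends: some gap contains the given point, so the
  supremum is positive, and a gap that attains it must contain the point as well.\<close>

lemma DERIV2_nonpos_at_local_max:
  fixes f f' :: "real \<Rightarrow> real"
  assumes e: "e > 0"
    and f': "\<And>t. \<bar>t\<bar> < e \<Longrightarrow> (f has_real_derivative f' t) (at t)"
    and f'': "(f' has_real_derivative d) (at 0)"
    and max: "\<And>t. \<bar>t\<bar> < e \<Longrightarrow> f t \<le> f 0"
  shows "d \<le> 0"
proof (rule ccontr)
  assume "\<not> d \<le> 0"
  then have d: "0 < d" by simp
  have f'0: "f' 0 = 0"
    using DERIV_local_max[OF f'[of 0], of e] e max by auto
  obtain s where s: "s > 0" "\<And>h. 0 < h \<Longrightarrow> h < s \<Longrightarrow> f' 0 < f' (0 + h)"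
    using DERIV_pos_inc_right[OF f'' d] by blast
  define t where "t = min s e / 2"
  have t: "0 < t" "t < s" "t < e" using s e by (auto simp: t_def min_def)
  \<comment> \<open>The derivative vanishes at 0 and is positive just to the right of it, so f
    climbs above its supposed maximum.\<close>
  have "f 0 < f t"
  proof (rule DERIV_pos_imp_increasing_open[OF t(1)])
    fix x assume x: "0 < x" "x < t"
    then have "f' x > 0" using s(2)[of x] t f'0 by auto
    then show "\<exists>y. (f has_real_derivative y) (at x) \<and> 0 < y"
      using f'[of x] x t by auto
  next
    show "continuous_on {0..t} f"
      using t by (intro DERIV_continuous_on[of _ f f'] DERIV_subset[OF f']) auto
  qed
  with max[of t] t show False by auto
qed

lemma harmonic_onE:
  assumes "harmonic_on u S"
  obtains ux uy uxx uxy uyx uyy where "open S"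
    "\<forall>z\<in>S.
        (u has_derivative (\<lambda>h. ux z * Re h + uy z * Im h)) (at z) \<and>
        (ux has_derivative (\<lambda>h. uxx z * Re h + uxy z * Im h)) (at z) \<and>
        (uy has_derivative (\<lambda>h. uyx z * Re h + uyy z * Im h)) (at z) \<and>
        uxx z + uyy z = 0"
    "continuous_on S uxx" "continuous_on S uxy" "continuous_on S uyx" "continuous_on S uyy"
proof -
  show ?thesis
    using assms unfolding harmonic_on_def
    apply (elim conjE exE)
    subgoal for ux uy uxx uxy uyx uyy
      by (rule that[of ux uy uxx uxy uyx uyy])
    done
qed

lemma harmonic_on_add_mult:
  assumes "harmonic_on u S" "harmonic_on v S"
  shows "harmonic_on (\<lambda>z. u z + c * v z) S"
proof -
  obtain ux uy uxx uxy uyx uyy where u: "open S" 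
    "\<forall>z\<in>S.
        (u has_derivative (\<lambda>h. ux z * Re h + uy z * Im h)) (at z) \<and>
        (ux has_derivative (\<lambda>h. uxx z * Re h + uxy z * Im h)) (at z) \<and>
        (uy has_derivative (\<lambda>h. uyx z * Re h + uyy z * Im h)) (at z) \<and>
        uxx z + uyy z = 0"
     "continuous_on S uxx" "continuous_on S uxy" "continuous_on S uyx" "continuous_on S uyy"
    by (rule harmonic_onE[OF assms(1)])
  obtain vx vy vxx vxy vyx vyy where v: "open S" 
    "\<forall>z\<in>S.
        (v has_derivative (\<lambda>h. vx z * Re h + vy z * Im h)) (at z) \<and>
        (vx has_derivative (\<lambda>h. vxx z * Re h + vxy z * Im h)) (at z) \<and>
        (vy has_derivative (\<lambda>h. vyx z * Re h + vyy z * Im h)) (at z) \<and>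
        vxx z + vyy z = 0"
     "continuous_on S vxx" "continuous_on S vxy" "continuous_on S vyx" "continuous_on S vyy"
    by (rule harmonic_onE[OF assms(2)])
  have D: "((\<lambda>z. p z + c * q z) has_derivative (\<lambda>h. (a + c * a') * Re h + (b + c * b') * Im h)) (at z)"
    if "(p has_derivative (\<lambda>h. a * Re h + b * Im h)) (at z)"
       "(q has_derivative (\<lambda>h. a' * Re h + b' * Im h)) (at z)" for p q a b a' b' z
    by (rule has_derivative_eq_rhs,
        rule has_derivative_add[OF that(1) has_derivative_mult_right[OF that(2), of c]])
      (auto simp: algebra_simps)
  show ?thesis
    unfolding harmonic_on_def
    apply (rule conjI[OF u(1)])
    apply (rule exI[of _ "\<lambda>z. ux z + c * vx z"], rule exI[of _ "\<lambda>z. uy z + c * vy z"],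
       rule exI[of _ "\<lambda>z. uxx z + c * vxx z"], rule exI[of _ "\<lambda>z. uxy z + c * vxy z"],
       rule exI[of _ "\<lambda>z. uyx z + c * vyx z"], rule exI[of _ "\<lambda>z. uyy z + c * vyy z"])
    apply (intro conjI ballI)
    subgoal for z using bspec[OF u(2), of z] bspec[OF v(2), of z] by (intro D) simp_all
    subgoal for z using bspec[OF u(2), of z] bspec[OF v(2), of z] by (intro D) simp_all
    subgoal for z using bspec[OF u(2), of z] bspec[OF v(2), of z] by (intro D) simp_all
    subgoal for z using bspec[OF u(2), of z] bspec[OF v(2), of z] by (simp add: add_eq_0_iff)
    by (intro continuous_on_add continuous_on_mult continuous_on_const u v)+
qed

lemma harmonic_on_imp_continuous_on: "harmonic_on u S \<Longrightarrow> continuous_on S u"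
  unfolding harmonic_on_def
  by (intro continuous_at_imp_continuous_on) (auto intro: has_derivative_continuous)

text \<open>At a local maximum the restrictions to the horizontal and the vertical line have
  nonpositive second derivatives, \<open>uxx z + 2 * k\<close> and \<open>uyy z + 2 * k\<close>.
  Their sum is 4k > 0, since the Laplacian of u vanishes.\<close>

lemma harmonic_no_strict_max:
  assumes u: "harmonic_on u S" and z: "z \<in> S" and k: "k > 0"
    and e: "e > 0" and max: "\<And>w. w \<in> ball z e \<Longrightarrow> u w + k * (norm w)\<^sup>2 \<le> u z + k * (norm z)\<^sup>2"
  shows False
proof -
  obtain ux uy uxx uxy uyx uyy where u: "open S" 
    "\<forall>z\<in>S.
        (u has_derivative (\<lambda>h. ux z * Re h + uy z * Im h)) (at z) \<and>
        (ux has_derivative (\<lambda>h. uxx z * Re h + uxy z * Im h)) (at z) \<and>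
        (uy has_derivative (\<lambda>h. uyx z * Re h + uyy z * Im h)) (at z) \<and>
        uxx z + uyy z = 0"
    by (rule harmonic_onE[OF u])
  obtain e' where e': "e' > 0" "ball z e' \<subseteq> S" using u(1) z open_contains_ball by blast
  define d where "d = min e e'"
  have d: "d > 0" using e e' by (auto simp: d_def)
  have mem: "z + of_real t * v \<in> ball z e" "z + of_real t * v \<in> S"
    if "\<bar>t\<bar> < d" "norm v = 1" for t v
    using that e' by (auto simp: dist_norm norm_mult d_def subset_iff)
  have L: "((\<lambda>t. z + of_real t * v) has_derivative (\<lambda>t. of_real t * v)) (at t)" for t v
    by (auto intro!: derivative_eq_intros)
  have comp: "((\<lambda>t. p (z + of_real t * v)) has_real_derivative (a * Re v + b * Im v)) (at t)"
    if "(p has_derivative (\<lambda>h. a * Re h + b * Im h)) (at (z + of_real t * v))" for p v a b t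
    unfolding has_field_derivative_def
    by (rule has_derivative_eq_rhs, rule has_derivative_compose[OF L that]) (auto simp: algebra_simps)
  have nrm: "(norm (z + of_real t * v))\<^sup>2 = (Re z + t * Re v)\<^sup>2 + (Im z + t * Im v)\<^sup>2" for t v
    by (simp add: cmod_power2)
  have "uxx z + 2 * k \<le> 0"
  proof (rule DERIV2_nonpos_at_local_max[OF d, where f = "\<lambda>t. u (z + of_real t * 1) + k * (norm (z + of_real t * 1))\<^sup>2"
        and f' = "\<lambda>t. ux (z + of_real t * 1) + k * (2 * (Re z + t))"])
    fix t assume t: "\<bar>t\<bar> < d"
    show "((\<lambda>t. u (z + of_real t * 1) + k * (norm (z + of_real t * 1))\<^sup>2) has_real_derivative 
      ux (z + of_real t * 1) + k * (2 * (Re z + t))) (at t)"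
      unfolding nrm using bspec[OF u(2), OF mem(2)[OF t, of 1]]
      by (auto intro!: derivative_eq_intros comp[of u "ux (z + of_real t * 1)" "uy (z + of_real t * 1)" t 1, simplified])
    show "u (z + of_real t * 1) + k * (norm (z + of_real t * 1))\<^sup>2 \<le> u (z + of_real 0 * 1) + k * (norm (z + of_real 0 * 1))\<^sup>2"
      using max[OF mem(1)[OF t, of 1]] by simp
  next
    show "((\<lambda>t. ux (z + of_real t * 1) + k * (2 * (Re z + t))) has_real_derivative uxx z + 2 * k) (at 0)"
      using bspec[OF u(2), OF mem(2)[of 0 1]] d
      by (auto intro!: derivative_eq_intros comp[of ux "uxx z" "uxy z" 0 1, simplified])
  qed
  moreover have "uyy z + 2 * k \<le> 0"
  proof (rule DERIV2_nonpos_at_local_max[OF d, where f = "\<lambda>t. u (z + of_real t * \<i>) + k * (norm (z + of_real t * \<i>))\<^sup>2"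
        and f' = "\<lambda>t. uy (z + of_real t * \<i>) + k * (2 * (Im z + t))"])
    fix t assume t: "\<bar>t\<bar> < d"
    show "((\<lambda>t. u (z + of_real t * \<i>) + k * (norm (z + of_real t * \<i>))\<^sup>2) has_real_derivative 
      uy (z + of_real t * \<i>) + k * (2 * (Im z + t))) (at t)"
      unfolding nrm using bspec[OF u(2), OF mem(2)[OF t, of \<i>]]
      by (auto intro!: derivative_eq_intros comp[of u "ux (z + of_real t * \<i>)" "uy (z + of_real t * \<i>)" t \<i>, simplified])
    show "u (z + of_real t * \<i>) + k * (norm (z + of_real t * \<i>))\<^sup>2 \<le> u (z + of_real 0 * \<i>) + k * (norm (z + of_real 0 * \<i>))\<^sup>2"
      using max[OF mem(1)[OF t, of \<i>]] by simp
  next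
    show "((\<lambda>t. uy (z + of_real t * \<i>) + k * (2 * (Im z + t))) has_real_derivative uyy z + 2 * k) (at 0)"
      using bspec[OF u(2), OF mem(2)[of 0 \<i>]] d
      by (auto intro!: derivative_eq_intros comp[of uy "uyx z" "uyy z" 0 \<i>, simplified])
  qed
  ultimately show False using bspec[OF u(2), OF z] k by linarith
qed

text \<open>The comparison function \<open>u + \<epsilon> |z|\<^sup>2\<close> is strictly subharmonic, so it has no interior maximum.\<close>

lemma harmonic_maximum_principle:
  assumes K: "closed K" and u: "harmonic_on u (- K)"
    and bd: "\<And>\<zeta> e. \<zeta> \<in> frontier K \<Longrightarrow> e > 0 \<Longrightarrow> eventually (\<lambda>z. u z < e) (at \<zeta> within - K)"
    and inf: "\<And>e. e > 0 \<Longrightarrow> eventually (\<lambda>z. u z < e) at_infinity"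
    and z: "z \<in> - K"
  shows "u z \<le> 0"
proof (rule ccontr)
  assume "\<not> u z \<le> 0"
  \<comment> \<open>Half of the supposed positive value: the level set of u at height e is kept away
    from the frontier and from infinity by \<open>bd\<close> and \<open>inf\<close>, hence compact,
    and there is room e left for the quadratic perturbation.\<close>
  define e where "e = u z / 2"
  have e: "e > 0" using \<open>\<not> u z \<le> 0\<close> by (simp add: e_def)
  define C where "C = {w \<in> - K. e \<le> u w}"
  have cont: "continuous_on (- K) u" using harmonic_on_imp_continuous_on[OF u] .
  have "bounded C"
  proof -
    obtain b where b: "\<And>x. b \<le> norm x \<Longrightarrow> u x < e" 
      using inf[OF e] by (auto simp: eventually_at_infinity)
    have "norm x \<le> b" if "x \<in> C" for x using that b[of x] by (cases "norm x \<le> b") (auto simp: C_def)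
    then show ?thesis by (auto simp: bounded_iff)
  qed
  moreover have "closed C"
    unfolding closed_sequential_limits
  proof (intro allI impI, elim conjE)
    fix x l assume x: "\<forall>n. x n \<in> C" and l: "x \<longlonglongrightarrow> l"
    have clo: "l \<in> closure (- K)"
      using x l unfolding closure_sequential by (metis (no_types, lifting) C_def mem_Collect_eq)
    have "l \<notin> K"
    proof
      assume "l \<in> K"
      then have "l \<in> frontier K" using clo K by (auto simp: frontier_closures)
      from bd[OF this e] obtain d where d: "d > 0" "\<And>w. w \<in> - K \<Longrightarrow> w \<noteq> l \<Longrightarrow> dist w l < d \<Longrightarrow> u w < e"
        by (auto simp: eventually_at)
      obtain n where "dist (x n) l < d" using l d(1) by (meson LIMSEQ_def order_refl)
      moreover have "x n \<in> C" using x by auto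
      ultimately show False using d(2)[of "x n"] \<open>l \<in> K\<close> by (force simp: C_def)
    qed
    then have lK: "l \<in> - K" by auto
    have "(\<lambda>n. u (x n)) \<longlonglongrightarrow> u l"
      using cont l lK x continuous_on_tendsto_compose[OF cont l lK] by (auto simp: C_def)
    then have "e \<le> u l" using x by (intro LIMSEQ_le_const) (auto simp: C_def)
    then show "l \<in> C" using lK by (auto simp: C_def)
  qed
  ultimately have C: "compact C" by (simp add: compact_eq_bounded_closed)
  obtain R where R: "R > 0" "\<And>w. w \<in> C \<Longrightarrow> norm w \<le> R"
    using \<open>bounded C\<close> bounded_pos by blast
  \<comment> \<open>With \<open>k * R^2 < e\<close> the perturbation cannot push the maximum point y
    down to the level e: u y > 2 e - e, so y has a whole ball inside the level set.\<close>
  define k where "k = e / (2 * R\<^sup>2)"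
  have k: "k > 0" "k * R\<^sup>2 < e" using e R by (auto simp: k_def)
  have zC: "z \<in> C" using z e by (auto simp: C_def e_def)
  have "continuous_on C (\<lambda>w. u w + k * (norm w)\<^sup>2)"
    by (intro continuous_intros continuous_on_subset[OF cont]) (auto simp: C_def)
  then obtain y where y: "y \<in> C" "\<And>w. w \<in> C \<Longrightarrow> u w + k * (norm w)\<^sup>2 \<le> u y + k * (norm y)\<^sup>2"
    using continuous_attains_sup[OF C] zC by blast
  have "u y + k * R\<^sup>2 \<ge> u y + k * (norm y)\<^sup>2"
    using R(2)[OF y(1)] k by (auto intro!: mult_left_mono power_mono)
  moreover have "u y + k * (norm y)\<^sup>2 \<ge> 2 * e"
    using y(2)[OF zC] mult_nonneg_nonneg[OF less_imp_le[OF k(1)] zero_le_power2[of "norm z"]] unfolding e_def by linarith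
  ultimately have uy: "u y > e" using k by linarith
  have yK: "y \<in> - K" using y by (auto simp: C_def)
  have "open (- K)" using K by auto
  then have "open {w \<in> - K. e < u w}"
    using continuous_open_preimage[OF cont _ open_greaterThan[of e]] 
    by (simp add: vimage_def Int_def)
  then obtain d where d: "d > 0" "ball y d \<subseteq> {w \<in> - K. e < u w}"
    using uy yK open_contains_ball[of "{w \<in> - K. e < u w}"] by auto
  show False
  proof (rule harmonic_no_strict_max[OF u yK k(1) d(1)])
    fix w assume "w \<in> ball y d"
    then show "u w + k * (norm w)\<^sup>2 \<le> u y + k * (norm y)\<^sup>2"
      using d y(2)[of w] by (force simp: C_def)
  qed
qed

lemma is_green_fun_at_infinity:
  assumes "is_green_fun K g"
  obtains b R where "R > 1" "\<And>z. norm z \<ge> R \<Longrightarrow> \<bar>g z - ln (norm z)\<bar> \<le> b"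
proof -
  from assms have "(\<lambda>z. g z - ln (norm z)) \<in> O[at_infinity](\<lambda>_. 1)" by (simp add: is_green_fun_def)
  then obtain c where "eventually (\<lambda>z. \<bar>g z - ln (norm z)\<bar> \<le> c) at_infinity"
    by (auto elim!: landau_o.bigE)
  then obtain R where "\<And>z. norm z \<ge> R \<Longrightarrow> \<bar>g z - ln (norm z)\<bar> \<le> c"
    by (auto simp: eventually_at_infinity)
  then show ?thesis by (intro that[of "max R 2" c]) auto
qed

lemma ln_norm_at_infinity: "filterlim (\<lambda>z::complex. ln (norm z)) at_top at_infinity"
  by (rule filterlim_compose[OF ln_at_top filterlim_norm_at_top])

text \<open>The maximum principle applied to -g; at infinity the logarithmic growth makes -g tend to
  minus infinity.\<close>

lemma is_green_fun_nonneg: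
  assumes K: "closed K" and g: "is_green_fun K g"
  shows "0 \<le> g z"
proof (cases "z \<in> K")
  case False
  have "- g z \<le> 0"
  proof (rule harmonic_maximum_principle[OF K, of "\<lambda>z. - g z"])
    \<comment> \<open>The negative is obtained as g + (-2) g.\<close>
    show "harmonic_on (\<lambda>z. - g z) (- K)"
      using g harmonic_on_add_mult[of g "- K" g "-2"] by (simp add: is_green_fun_def)
  next
    fix \<zeta> and e :: real assume "\<zeta> \<in> frontier K" "e > 0"
    then have "(g \<longlongrightarrow> 0) (at \<zeta> within - K)" using g by (auto simp: is_green_fun_def)
    from order_tendstoD(1)[OF this, of "- e"] \<open>e > 0\<close>
    show "eventually (\<lambda>z. - g z < e) (at \<zeta> within - K)" by (auto elim!: eventually_mono)
  next
    fix e :: real assume "e > 0"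
    obtain b R where R: "R > 1" "\<And>z. norm z \<ge> R \<Longrightarrow> \<bar>g z - ln (norm z)\<bar> \<le> b"
      using is_green_fun_at_infinity[OF g] by blast
    have "eventually (\<lambda>z::complex. ln (norm z) > b) at_infinity"
      using ln_norm_at_infinity unfolding filterlim_at_top_dense by blast
    moreover have "eventually (\<lambda>z::complex. norm z \<ge> R) at_infinity"
      by (auto simp: eventually_at_infinity)
    ultimately show "eventually (\<lambda>z. - g z < e) at_infinity"
      
    proof eventually_elim
      case (elim z)
      then show ?case using R(2)[of z] \<open>e > 0\<close> by linarith
    qed
  qed (use False in auto)
  then show ?thesis by simp
qed (use g in \<open>auto simp: is_green_fun_def\<close>)

text \<open>For the bounded difference \<open>d = g\<^sub>1 - g\<^sub>2\<close> the point at infinity is handled by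
  \<open>d - \<epsilon> g\<^sub>1\<close>, which tends to \<open>-\<infinity>\<close> there.\<close>

lemma is_green_fun_le:
  assumes K: "closed K" and g1: "is_green_fun K g1" and g2: "is_green_fun K g2"
  shows "g1 z \<le> g2 z"
proof (cases "z \<in> K")
  case False
  have *: "g1 z - g2 z \<le> e * g1 z" if e: "e > 0" for e
  proof -
    have h: "harmonic_on (\<lambda>z. (g1 z + (-1) * g2 z) + (- e) * g1 z) (- K)"
      using g1 g2 unfolding is_green_fun_def by (intro harmonic_on_add_mult) auto
    have "(g1 z + (-1) * g2 z) + (- e) * g1 z \<le> 0"
    proof (rule harmonic_maximum_principle[OF K h])
      fix \<zeta> and r :: real assume "\<zeta> \<in> frontier K" "r > 0"
      then have "(g1 \<longlongrightarrow> 0) (at \<zeta> within - K)" "(g2 \<longlongrightarrow> 0) (at \<zeta> within - K)"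
        using g1 g2 by (auto simp: is_green_fun_def)
      then have "((\<lambda>z. g1 z + (-1) * g2 z + (- e) * g1 z) \<longlongrightarrow> 0 + (-1) * 0 + (- e) * 0) (at \<zeta> within - K)"
        by (intro tendsto_intros)
      from order_tendstoD(2)[OF this, of r] \<open>r > 0\<close>
      show "eventually (\<lambda>z. g1 z + (-1) * g2 z + (- e) * g1 z < r) (at \<zeta> within - K)" by auto
    next
      fix r :: real assume "r > 0"
      obtain b R where R: "R > 1" "\<And>z. norm z \<ge> R \<Longrightarrow> \<bar>g1 z - ln (norm z)\<bar> \<le> b"
        using is_green_fun_at_infinity[OF g1] by blast
      obtain b2 R2 where R2: "R2 > 1" "\<And>z. norm z \<ge> R2 \<Longrightarrow> \<bar>g2 z - ln (norm z)\<bar> \<le> b2"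
        using is_green_fun_at_infinity[OF g2] by blast
      have "eventually (\<lambda>z::complex. ln (norm z) > b + (b + b2) / e) at_infinity"
        using ln_norm_at_infinity unfolding filterlim_at_top_dense by blast
      moreover have "eventually (\<lambda>z::complex. norm z \<ge> max R R2) at_infinity"
        by (subst eventually_at_infinity) blast
      ultimately show "eventually (\<lambda>z. g1 z + (-1) * g2 z + (- e) * g1 z < r) at_infinity"
      proof eventually_elim
        case (elim z)
        have "g1 z > (b + b2) / e" using elim R(2)[of z] by auto
        then have "e * g1 z > b + b2" using e by (simp add: field_simps)
        moreover have "g1 z - g2 z \<le> b + b2" using R(2)[of z] R2(2)[of z] elim by auto
        ultimately show ?case using \<open>r > 0\<close> by auto
      qed
    qed (use False in auto)
    then show ?thesis by auto
  qed
  show ?thesis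
  proof (rule ccontr)
    assume "\<not> g1 z \<le> g2 z"
    moreover have "g2 z \<ge> 0" using is_green_fun_nonneg[OF K g2] .
    ultimately have p: "g1 z > 0" "g1 z - g2 z > 0" by auto
    \<comment> \<open>This \<epsilon> makes the right-hand side half of the positive difference
      \<open>g1 z - g2 z\<close>.\<close>
    show False using *[of "(g1 z - g2 z) / (2 * g1 z)"] p by (auto simp: field_simps)
  qed
qed (use g1 g2 in \<open>auto simp: is_green_fun_def\<close>)

lemma green_fun_eqI:
  assumes "closed K" "is_green_fun K g"
  shows "green_fun K = g"
  unfolding green_fun_def
  by (rule the_equality, rule assms(2), rule ext)
     (meson is_green_fun_le[OF assms(1)] assms(2) antisym)

subsection \<open>Real parts of primitives\<close>

text \<open>The gradient of g is (Re f, -Im f), so the Cauchy-Riemann equations for f make the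
  Laplacian of g vanish; the second partials are continuous because the derivative of f is
  holomorphic.\<close>

lemma harmonic_on_real_primitive:
  assumes S: "open S" and f: "f holomorphic_on S"
    and g: "\<And>z. z \<in> S \<Longrightarrow> (g has_derivative (\<lambda>h. Re (f z * h))) (at z)"
  shows "harmonic_on g S"
proof -
  have df: "(f has_field_derivative deriv f z) (at z)" if "z \<in> S" for z
    using holomorphic_derivI[OF f S that] .
  \<comment> \<open>The factor c = 1 gives the derivative of Re f, and c = \<open>\<i>\<close> that
    of -Im f.\<close>
  have D: "((\<lambda>w. Re (c * f w)) has_derivative (\<lambda>h. Re (c * deriv f z * h))) (at z)"
    if "z \<in> S" for z c
    using bounded_linear.has_derivative[OF bounded_linear_Re
        has_derivative_mult_right[OF df[OF that, unfolded has_field_derivative_def], of c]]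
    by (simp add: mult.assoc)
  have cont: "continuous_on S (deriv f)"
    using holomorphic_deriv[OF f S] holomorphic_on_imp_continuous_on by blast
  show ?thesis
    unfolding harmonic_on_def
    apply (rule conjI[OF S])
    apply (rule exI[of _ "\<lambda>z. Re (f z)"], rule exI[of _ "\<lambda>z. - Im (f z)"],
       rule exI[of _ "\<lambda>z. Re (deriv f z)"], rule exI[of _ "\<lambda>z. - Im (deriv f z)"],
       rule exI[of _ "\<lambda>z. - Im (deriv f z)"], rule exI[of _ "\<lambda>z. - Re (deriv f z)"])
    apply (intro conjI ballI)
    subgoal for z using g[of z] by simp
    subgoal for z using D[of z 1] by simp
    subgoal for z using has_derivative_eq_rhs[OF D[of z \<i>]] by (force simp: fun_eq_iff)
    subgoal by simp
    by (intro continuous_intros cont)+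
qed

text \<open>The primitive on the upper half plane is reflected to the lower one; by the symmetry of
  \<open>f\<close> the real parts match across every real point outside \<open>K\<close>, although \<open>f\<close> itself may have
  imaginary periods.\<close>

lemma symmetric_real_primitive:
  assumes K: "closed K" "K \<subseteq> \<real>" and f: "f holomorphic_on - K"
    and sym: "\<And>z. z \<notin> K \<Longrightarrow> f (cnj z) = cnj (f z)"
  obtains g :: "complex \<Rightarrow> real"
    where "\<And>z. z \<notin> K \<Longrightarrow> (g has_derivative (\<lambda>h. Re (f z * h))) (at z)"
proof -
  define H where "H = {z. Im z > 0}"
  have H: "open H" "convex H" "H \<subseteq> - K"
    using K(2) by (auto simp: H_def open_halfspace_Im_gt convex_halfspace_Im_gt complex_is_Real_iff)
  obtain F where "\<And>z. z \<in> H \<Longrightarrow> (F has_field_derivative f z) (at z within H)"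
    using holomorphic_convex_primitive'[OF H(2,1) holomorphic_on_subset[OF f H(3)]] by blast
  then have F: "(F has_field_derivative f z) (at z)" if "z \<in> H" for z
    using that H(1) by (metis at_within_open)
  \<comment> \<open>On the real axis the value is the limit from above. At points of K this may be
    meaningless, which does no harm since nothing is claimed there.\<close>
  define g where "g z = (if Im z > 0 then Re (F z) else if Im z < 0 then Re (F (cnj z))
     else Lim (at_right 0) (\<lambda>t. Re (F (z + \<i> * of_real t))))" for z
  have oK: "open (- K)" using K by auto
  have "(g has_derivative (\<lambda>h. Re (f z * h))) (at z)" if z: "z \<notin> K" for z
  proof (cases "Im z = 0")
    case False
    then consider "Im z > 0" | "Im z < 0" by linarith
    then show ?thesis
    proof cases
      case 1
      have "((\<lambda>w. Re (F w)) has_derivative (\<lambda>h. Re (f z * h))) (at z)"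
        using bounded_linear.has_derivative[OF bounded_linear_Re
            F[of z, unfolded has_field_derivative_def]] 1 by (simp add: H_def)
      then show ?thesis
        by (rule has_derivative_transform_within_open[OF _ H(1)]) (use 1 in \<open>auto simp: H_def g_def\<close>)
    next
      case 2
      have "(F has_derivative (*) (f (cnj z))) (at (cnj z))"
        using F[of "cnj z", unfolded has_field_derivative_def] 2 by (auto simp: H_def)
      from bounded_linear.has_derivative[OF bounded_linear_Re
          has_derivative_compose[OF bounded_linear.has_derivative[OF bounded_linear_cnj has_derivative_ident] this]]
      have "((\<lambda>w. Re (F (cnj w))) has_derivative (\<lambda>h. Re (f (cnj z) * cnj h))) (at z)" .
      moreover have "Re (f (cnj z) * cnj h) = Re (f z * h)" for h
        using sym[OF z] by (simp flip: complex_cnj_mult)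
      ultimately have "((\<lambda>w. Re (F (cnj w))) has_derivative (\<lambda>h. Re (f z * h))) (at z)" by simp
      then show ?thesis
        by (rule has_derivative_transform_within_open[OF _ open_halfspace_Im_lt[of 0]])
          (use 2 in \<open>auto simp: g_def\<close>)
    qed
  next
    case True
    obtain e where e: "e > 0" "ball z e \<subseteq> - K" using oK z open_contains_ball by (metis ComplI)
    define B where "B = ball z e"
    have B: "open B" "convex B" "z \<in> B" "B \<subseteq> - K" using e by (auto simp: B_def)
    obtain P where "\<And>w. w \<in> B \<Longrightarrow> (P has_field_derivative f w) (at w within B)"
      using holomorphic_convex_primitive'[OF B(2,1) holomorphic_on_subset[OF f B(4)]] by blast
    then have P: "(P has_field_derivative f w) (at w)" if "w \<in> B" for w
      using that B(1) by (metis at_within_open)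
    have "convex (B \<inter> H)" "open (B \<inter> H)" using B H by (auto intro: convex_Int)
    then have "\<exists>c. \<forall>w\<in>B \<inter> H. F w - P w = c"
      by (intro has_field_derivative_zero_constant)
        (auto intro!: derivative_eq_intros DERIV_subset[OF F] DERIV_subset[OF P])
    then obtain c where c: "\<And>w. w \<in> B \<Longrightarrow> Im w > 0 \<Longrightarrow> F w = P w + c"
      by (auto simp: H_def algebra_simps)
    have cB: "cnj w \<in> B" if "w \<in> B" for w
    proof -
      have "z = cnj z" using True by (simp add: complex_eq_iff)
      then have "dist z (cnj w) = dist (cnj z) (cnj w)" by simp
      also have "\<dots> = dist z w" by (simp add: dist_norm flip: complex_cnj_diff)
      finally show ?thesis using that by (simp add: B_def)
    qed
    \<comment> \<open>The Schwarz reflection of the local primitive P has the same derivative f, so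
      it differs from P by a constant. At the real centre z that constant is purely imaginary; hence
      Re P is symmetric, and P plus one constant c describes g on both sides of the axis.\<close>
    have "\<exists>d. \<forall>w\<in>B. (cnj \<circ> P \<circ> cnj) w - P w = d"
    proof (intro has_field_derivative_zero_constant B(2))
      fix w assume w: "w \<in> B"
      then have "((cnj \<circ> P \<circ> cnj) has_field_derivative cnj (f (cnj w))) (at w)"
        by (intro has_field_derivative_cnj_cnj P cB)
      moreover have "cnj (f (cnj w)) = f w" using sym[of w] w B by auto
      ultimately have "((\<lambda>w. (cnj \<circ> P \<circ> cnj) w - P w) has_field_derivative f w - f w) (at w)"
        by (intro DERIV_diff P w) (simp only:)
      then show "((\<lambda>w. (cnj \<circ> P \<circ> cnj) w - P w) has_field_derivative 0) (at w within B)"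
        by (auto intro: DERIV_subset)
    qed
    then obtain d where d: "\<And>w. w \<in> B \<Longrightarrow> cnj (P (cnj w)) - P w = d" by auto
    have "Re d = 0" using d[OF B(3)] True by (auto simp: complex_eq_iff complex_cnj)
       (metis cnj.simps complex_surj d[OF B(3)] minus_complex.simps(1) diff_self True neg_0_equal_iff_equal complex.sel)
    then have Pc: "Re (P (cnj w)) = Re (P w)" if "w \<in> B" for w
      using d[OF that] by (auto simp: complex_eq_iff)
    have gB: "Re (P w) + Re c = g w" if w: "w \<in> B" for w
    proof (cases "Im w = 0")
      case False
      then show ?thesis using c[OF w] c[OF cB[OF w]] Pc[OF w] by (auto simp: g_def)
    next
      case Im: True
      have lim0: "((\<lambda>t. w + \<i> * of_real t) \<longlongrightarrow> w + \<i> * of_real 0) (at_right 0)"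
        by (intro tendsto_intros)
      then have lim: "((\<lambda>t. w + \<i> * of_real t) \<longlongrightarrow> w) (at_right 0)" by simp
      have "isCont P w" using P[OF w] by (rule DERIV_isCont)
      then have "((\<lambda>t. Re (P (w + \<i> * of_real t)) + Re c) \<longlongrightarrow> Re (P w) + Re c) (at_right 0)"
        by (intro tendsto_intros isCont_tendsto_compose[OF _ lim])
      moreover have "eventually (\<lambda>t. Re (P (w + \<i> * of_real t)) + Re c = Re (F (w + \<i> * of_real t))) (at_right (0::real))"
        using topological_tendstoD[OF lim B(1) w] eventually_at_right_less[of 0]
        by eventually_elim (auto simp: c Im)
      ultimately have "((\<lambda>t. Re (F (w + \<i> * of_real t))) \<longlongrightarrow> Re (P w) + Re c) (at_right 0)"
        by (rule Lim_transform_eventually)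
      then have "Lim (at_right 0) (\<lambda>t. Re (F (w + \<i> * of_real t))) = Re (P w) + Re c"
        by (intro tendsto_Lim) auto
      then show ?thesis using Im by (simp add: g_def)
    qed
    have "((\<lambda>w. Re (P w) + Re c) has_derivative (\<lambda>h. Re (f z * h))) (at z)"
      using has_derivative_add_const[OF bounded_linear.has_derivative[OF bounded_linear_Re
          P[OF B(3), unfolded has_field_derivative_def]]] .
    then show ?thesis
      by (rule has_derivative_transform_within_open[OF _ B(1) B(3)]) (rule gB)
  qed
  then show ?thesis by (rule that)
qed

text \<open>Along each ray the difference of g and the logarithm has a derivative bounded by C /
  t^2, which is integrable at infinity. In monotone form: subtracting C / t from the difference
  gives a nondecreasing function, adding it a nonincreasing one. The starting values on the circle
  of radius R are bounded by compactness.\<close>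

lemma real_primitive_log_growth:
  assumes R: "R > 0" and C: "C \<ge> 0"
    and g: "\<And>z. norm z \<ge> R \<Longrightarrow> (g has_derivative (\<lambda>h. Re (f z * h))) (at z)"
    and f: "\<And>z. norm z \<ge> R \<Longrightarrow> norm (f z - 1 / z) \<le> C / (norm z)\<^sup>2"
  shows "(\<lambda>z. g z - ln (norm z)) \<in> O[at_infinity](\<lambda>_. 1)"
proof -
  have "continuous_on (sphere 0 R) g"
    by (intro continuous_at_imp_continuous_on ballI has_derivative_continuous[OF g]) simp
  then have "compact (g ` sphere 0 R)" by (intro compact_continuous_image) auto
  then obtain b where b: "\<And>z. norm z = R \<Longrightarrow> \<bar>g z\<bar> \<le> b"
    using compact_imp_bounded bounded_iff by (metis dist_0_norm imageI mem_sphere real_norm_def)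
  have "\<bar>g z - ln (norm z)\<bar> \<le> b + \<bar>ln R\<bar> + C / R" if z: "norm z \<ge> R" for z
  proof -
    define u where "u = z / of_real (norm z)"
    have u: "norm u = 1" "z = of_real (norm z) * u" using z R by (auto simp: u_def norm_divide)
    define \<phi> where "\<phi> t = g (of_real t * u) - ln t" for t
    have d\<phi>: "(\<phi> has_real_derivative Re (f (of_real t * u) * u) - 1 / t) (at t)" if t: "t \<ge> R" for t
    proof -
      have L: "((\<lambda>t. of_real t * u) has_derivative (\<lambda>h. of_real h * u)) (at t)"
        by (auto intro!: derivative_eq_intros)
      have "norm (of_real t * u) \<ge> R" using t R u by (simp add: norm_mult)
      from has_derivative_compose[OF L g[OF this]]
      have "((\<lambda>t. g (of_real t * u)) has_real_derivative Re (f (of_real t * u) * u)) (at t)"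
        unfolding has_field_derivative_def
        by (rule has_derivative_eq_rhs) (auto simp: algebra_simps)
      moreover have "(ln has_real_derivative 1 / t) (at t)"
        using t R by (auto intro!: derivative_eq_intros simp: field_simps)
      ultimately show ?thesis unfolding \<phi>_def by (rule DERIV_diff)
    qed
    have bd: "\<bar>Re (f (of_real t * u) * u) - 1 / t\<bar> \<le> C / t\<^sup>2" if t: "t \<ge> R" for t
    proof -
      have "u \<noteq> 0" using u by auto
      then have "Re (f (of_real t * u) * u) - 1 / t = Re ((f (of_real t * u) - 1 / (of_real t * u)) * u)"
        using t R by (simp add: algebra_simps Re_divide_of_real)
      also have "\<bar>\<dots>\<bar> \<le> norm ((f (of_real t * u) - 1 / (of_real t * u)) * u)" by (rule abs_Re_le_cmod)
      also have "\<dots> \<le> C / (norm (of_real t * u))\<^sup>2"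
        using f[of "of_real t * u"] t R u by (simp add: norm_mult)
      finally show ?thesis using u by (simp add: norm_mult)
    qed
    have inv: "((\<lambda>t. C / t) has_real_derivative - C / t\<^sup>2) (at t)" if "t \<ge> R" for t
      using that R by (auto intro!: derivative_eq_intros simp: power2_eq_square)
    have "\<phi> R - C / R \<le> \<phi> (norm z) - C / norm z"
    proof (rule DERIV_nonneg_imp_nondecreasing[OF z])
      fix t assume "R \<le> t" "t \<le> norm z"
      then show "\<exists>y. ((\<lambda>t. \<phi> t - C / t) has_real_derivative y) (at t) \<and> 0 \<le> y"
        using DERIV_diff[OF d\<phi> inv, of t] bd[of t] by (intro exI conjI) auto
    qed
    moreover have "\<phi> R + C / R \<ge> \<phi> (norm z) + C / norm z"
    proof (rule DERIV_nonpos_imp_nonincreasing[OF z])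
      fix t assume "R \<le> t" "t \<le> norm z"
      then show "\<exists>y. ((\<lambda>t. \<phi> t + C / t) has_real_derivative y) (at t) \<and> y \<le> 0"
        using DERIV_add[OF d\<phi> inv, of t] bd[of t] by (intro exI conjI) auto
    qed
    moreover have "C / norm z \<ge> 0" using C by simp
    moreover have "\<phi> (norm z) = g z - ln (norm z)" unfolding \<phi>_def using u by simp
    moreover have "\<bar>\<phi> R\<bar> \<le> b + \<bar>ln R\<bar>" using b[of "of_real R * u"] u R
      by (auto simp: \<phi>_def norm_mult abs_le_iff)
    ultimately show ?thesis by linarith
  qed
  then show ?thesis
    by (intro bigoI[of _ "b + \<bar>ln R\<bar> + C / R"]) (auto simp: eventually_at_infinity)
qed

text \<open>In the coordinate w = 1 / z at infinity, f z - 1 / z is (P w - 1) / w times w^2, and the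
  difference quotient tends to D.\<close>

lemma eventually_norm_minus_inverse_le:
  fixes f P :: "complex \<Rightarrow> complex"
  assumes P: "(P has_field_derivative D) (at 0)" "P 0 = 1"
    and f: "eventually (\<lambda>z. f z = P (1 / z) / z) at_infinity"
  shows "eventually (\<lambda>z. norm (f z - 1 / z) \<le> (norm D + 1) / (norm z)\<^sup>2) at_infinity"
proof -
  have "((\<lambda>w. (P w - 1) / w) \<longlongrightarrow> D) (at 0)"
    using P by (simp add: has_field_derivative_iff)
  from tendsto_norm[OF this] have "eventually (\<lambda>w. norm ((P w - 1) / w) < norm D + 1) (at 0)"
    by (rule order_tendstoD) simp
  then have "eventually (\<lambda>z. norm ((P (inverse z) - 1) / inverse z) < norm D + 1) at_infinity"
    by (rule eventually_compose_filterlim) (simp add: filterlim_inverse_at_iff filterlim_ident)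
  moreover have "eventually (\<lambda>z::complex. norm z \<ge> 1) at_infinity"
    by (auto simp: eventually_at_infinity)
  ultimately show ?thesis
    using f
  proof eventually_elim
    case (elim z)
    then have z: "z \<noteq> 0" by auto
    have "f z - 1 / z = ((P (inverse z) - 1) / inverse z) / z\<^sup>2"
      using elim(3) z by (simp add: field_simps power2_eq_square inverse_eq_divide)
    also have "norm \<dots> \<le> (norm D + 1) / (norm z)\<^sup>2"
      using elim(1) unfolding norm_divide[of _ "z\<^sup>2"] norm_power by (intro divide_right_mono) auto
    finally show ?case .
  qed
qed

subsection \<open>The square root branch of a slit\<close>

text \<open>The branch of \<open>\<surd>((z - p) (z - q))\<close> on the complement of the segment that behaves like \<open>z\<close> at
  infinity; the division by \<open>0\<close> at the midpoint happens inside the segment.\<close>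

definition slit_sqrt :: "real \<Rightarrow> real \<Rightarrow> complex \<Rightarrow> complex" where
  "slit_sqrt p q z = (z - of_real ((p + q) / 2)) *
     csqrt (1 - (of_real ((q - p) / 2) / (z - of_real ((p + q) / 2)))\<^sup>2)"

text \<open>This keeps \<open>csqrt\<close> off its branch cut. If the argument were some real t <=
  0, then r / (z - m), with m the midpoint and r the half-length, would be plus or minus sqrt (1 -
  t), real of modulus at least 1, and z would be a point of the segment.\<close>

lemma slit_sqrt_arg_nonpos:
  fixes z :: complex
  assumes pq: "p \<le> q" and z: "z \<notin> of_real ` {p..q}"
  shows "1 - (of_real ((q - p) / 2) / (z - of_real ((p + q) / 2)))\<^sup>2 \<notin> \<real>\<^sub>\<le>\<^sub>0"
proof
  define m r where "m = (p + q) / 2" and "r = (q - p) / 2"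
  assume "1 - (of_real ((q - p) / 2) / (z - of_real ((p + q) / 2)))\<^sup>2 \<in> \<real>\<^sub>\<le>\<^sub>0"
  then obtain t where t: "t \<le> 0" "1 - (of_real r / (z - of_real m))\<^sup>2 = of_real t"
    unfolding m_def r_def by (auto elim!: nonpos_Reals_cases)
  then have sq: "(of_real r / (z - of_real m))\<^sup>2 = of_real (1 - t)"
    by (simp add: algebra_simps)
  moreover have "complex_of_real (1 - t) = (of_real (sqrt (1 - t)))\<^sup>2"
    using t(1) unfolding of_real_power[symmetric] by (subst real_sqrt_pow2) auto
  ultimately have "of_real r / (z - of_real m) = of_real (sqrt (1 - t)) \<or> of_real r / (z - of_real m) = - of_real (sqrt (1 - t))"
    by (simp only: power2_eq_iff)
  then obtain s where s: "of_real r / (z - of_real m) = of_real s" "\<bar>s\<bar> \<ge> 1"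
  proof
    assume "of_real r / (z - of_real m) = - complex_of_real (sqrt (1 - t))"
    then show ?thesis using t by (intro that[of "- sqrt (1 - t)"]) auto
  qed (use t that[of "sqrt (1 - t)"] in auto)
  then have "z - of_real m \<noteq> 0" by auto
  then have "z = of_real (m + r / s)" using s by (auto simp: field_simps)
  moreover have "\<bar>r / s\<bar> \<le> r"
  proof -
    have "r \<ge> 0" using pq by (simp add: r_def)
    then show ?thesis using s(2) mult_left_mono[of 1 "\<bar>s\<bar>" r] by (auto simp: abs_divide divide_le_eq)
  qed
  moreover have "p = m - r" "q = m + r" by (simp_all add: m_def r_def field_simps)
  ultimately have "m + r / s \<in> {p..q}" "z = of_real (m + r / s)"
    unfolding atLeastAtMost_iff by linarith+
  then show False using z by blast
qed

lemma midpoint_in_slit: "p \<le> q \<Longrightarrow> z \<notin> of_real ` {p..q} \<Longrightarrow> z \<noteq> of_real ((p + q) / 2)"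
  for p q :: real and z :: complex
proof -
  assume "p \<le> q" "z \<notin> of_real ` {p..q}"
  moreover from this have "(p + q) / 2 \<in> {p..q}" by auto
  ultimately show ?thesis by blast
qed

lemma holomorphic_slit_sqrt: "p \<le> q \<Longrightarrow> slit_sqrt p q holomorphic_on - of_real ` {p..q}"
  unfolding slit_sqrt_def
  by (intro holomorphic_intros) (use slit_sqrt_arg_nonpos midpoint_in_slit in force)+

lemma slit_sqrt_nonzero: "p \<le> q \<Longrightarrow> z \<notin> of_real ` {p..q} \<Longrightarrow> slit_sqrt p q z \<noteq> 0"
  using slit_sqrt_arg_nonpos[of p q z] midpoint_in_slit[of p q z] by (auto simp: slit_sqrt_def)

lemma slit_sqrt_cnj:
  assumes "p \<le> q" "z \<notin> of_real ` {p..q}"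
  shows "slit_sqrt p q (cnj z) = cnj (slit_sqrt p q z)"
  using cnj_csqrt[OF slit_sqrt_arg_nonpos[OF assms]] by (simp add: slit_sqrt_def)

lemma slit_sqrt_greater:
  assumes "p \<le> q" "q < x"
  shows "slit_sqrt p q (of_real x) = of_real (sqrt ((x - p) * (x - q)))"
proof -
  define m r where "m = (p + q) / 2" and "r = (q - p) / 2"
  have xm: "x - m > 0" "r \<ge> 0" "r < x - m" using assms by (auto simp: m_def r_def field_simps)
  then have "(r / (x - m))\<^sup>2 \<le> 1" by (intro power_le_one) auto
  have "slit_sqrt p q (of_real x) = of_real (x - m) * csqrt (of_real (1 - (r / (x - m))\<^sup>2))"
    by (simp add: slit_sqrt_def m_def r_def)
  also have "\<dots> = of_real ((x - m) * sqrt (1 - (r / (x - m))\<^sup>2))"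
    using \<open>(r / (x - m))\<^sup>2 \<le> 1\<close> by (subst csqrt_of_real) auto
  also have "(x - m) * sqrt (1 - (r / (x - m))\<^sup>2) = sqrt ((x - m)\<^sup>2 * (1 - (r / (x - m))\<^sup>2))"
    using xm by (simp add: real_sqrt_mult)
  also have "(x - m)\<^sup>2 * (1 - (r / (x - m))\<^sup>2) = (x - p) * (x - q)"
  proof -
    have "(x - m)\<^sup>2 * (1 - (r / (x - m))\<^sup>2) = (x - m)\<^sup>2 - r\<^sup>2"
      using xm by (simp add: power_divide right_diff_distrib)
    also have "\<dots> = (x - p) * (x - q)" by (simp add: m_def r_def power2_eq_square field_simps)
    finally show ?thesis .
  qed
  finally show ?thesis .
qed

text \<open>The branch is odd under reflection; this transfers the values to the right of the
  segment to those on its left, with the opposite sign.\<close>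

lemma slit_sqrt_uminus: "slit_sqrt p q z = - slit_sqrt (- q) (- p) (- z)"
proof -
  have 1: "- z - of_real ((- q + - p) / 2) = - (z - of_real ((p + q) / 2))"
    by (simp add: field_simps)
  have 2: "(- p - - q) / 2 = (q - p) / 2" by simp
  show ?thesis unfolding slit_sqrt_def 1 2 divide_minus_right power2_minus mult_minus_left minus_minus ..
qed

lemma slit_sqrt_less:
  assumes "p \<le> q" "x < p"
  shows "slit_sqrt p q (of_real x) = - of_real (sqrt ((p - x) * (q - x)))"
  using slit_sqrt_greater[of "- q" "- p" "- x"] assms
  by (subst slit_sqrt_uminus) (simp add: mult.commute)

lemma slit_sqrt_inverse:
  assumes "z \<noteq> 0"
  shows "slit_sqrt p q z = z * ((1 - of_real ((p + q) / 2) * (1 / z)) * csqrt (1 -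
     (of_real ((q - p) / 2) * (1 / z) / (1 - of_real ((p + q) / 2) * (1 / z)))\<^sup>2))"
proof -
  define m r where "m = complex_of_real ((p + q) / 2)" and "r = complex_of_real ((q - p) / 2)"
  define d where "d = 1 - m * (1 / z)"
  have 1: "z - m = z * d" using assms by (simp add: d_def field_simps)
  have "r * (1 / z) / d = r / (z * d)" by simp
  then show ?thesis
    unfolding slit_sqrt_def m_def[symmetric] r_def[symmetric] d_def[symmetric] 1
    by (simp only: mult.assoc)
qed

section \<open>The uniformizing coordinate z = m + r cos u and the boundary limits on a slit\<close>

lemma Im_sin_times_cnj_cos: "Im (sin u * cnj (cos u)) = (exp (2 * Im u) - exp (- 2 * Im u)) / 4"
proof -
  define E F where "E = exp (Im u)" and "F = exp (- Im u)"
  have "Im (sin u * cnj (cos u)) = (cos (Re u))\<^sup>2 * (E\<^sup>2 - F\<^sup>2) / 4 + (sin (Re u))\<^sup>2 * (E\<^sup>2 - F\<^sup>2) / 4"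
    by (simp add: Re_sin Im_sin Re_cos Im_cos E_def[symmetric] F_def[symmetric])
      (simp add: power2_eq_square field_simps)
  also have "\<dots> = (E\<^sup>2 - F\<^sup>2) / 4"
    unfolding sin_squared_eq by (simp add: field_simps)
  finally show ?thesis by (simp add: E_def F_def flip: exp_double)
qed

text \<open>The square of -\<open>\<i>\<close> tan u is 1 - 1 / (cos u)^2, and its real part Im (tan
  u) has the sign of \<open>Im (sin u * cnj (cos u))\<close>, positive for Im u > 0. So it is the
  principal root in \<open>slit_sqrt\<close>.\<close>

lemma slit_sqrt_cos:
  assumes pq: "p < q" and u: "Im u > 0"
  shows "slit_sqrt p q (of_real ((p + q) / 2) + of_real ((q - p) / 2) * cos u)
     = - \<i> * of_real ((q - p) / 2) * sin u"
proof -
  define r where "r = (q - p) / 2"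
  have r: "r > 0" using pq by (simp add: r_def)
  have pos: "Im (sin u * cnj (cos u)) > 0" unfolding Im_sin_times_cnj_cos using u by simp
  then have c: "cos u \<noteq> 0" by auto
  have "csqrt (1 - (of_real r / (of_real r * cos u))\<^sup>2) = - \<i> * (sin u / cos u)"
  proof (rule csqrt_unique)
    have "(sin u)\<^sup>2 = 1 - (cos u)\<^sup>2" using sin_cos_squared_add[of u] by (simp add: algebra_simps)
    then show "(- \<i> * (sin u / cos u))\<^sup>2 = 1 - (of_real r / (of_real r * cos u))\<^sup>2"
      using c r by (simp add: power_mult_distrib power_divide field_simps)
    have "Re (- \<i> * X) = Im X" for X by simp
    moreover have "Im (sin u / cos u) = Im (sin u * cnj (cos u)) / (norm (cos u))\<^sup>2"
      by (subst complex_div_cnj) (simp only: Im_divide_of_real flip: of_real_power)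
    ultimately have "Re (- \<i> * (sin u / cos u)) = Im (sin u * cnj (cos u)) / (norm (cos u))\<^sup>2"
      by (simp only:)
    then show "0 < Re (- \<i> * (sin u / cos u)) \<or> Re (- \<i> * (sin u / cos u)) = 0 \<and> 0 \<le> Im (- \<i> * (sin u / cos u))"
      using pos c by (simp only: zero_less_divide_iff zero_less_power zero_less_norm_iff simp_thms)
  qed
  then show ?thesis
    using c by (simp add: slit_sqrt_def r_def)
qed

text \<open>The right-hand side is cosh (Im u) - cos (Re u): the distance of cos u from the focus 1
  in the elliptic coordinates given by u.\<close>

lemma norm_cos_minus_one: "norm (cos u - 1) = (exp (Im u) + exp (- Im u)) / 2 - cos (Re u)"
proof -
  define C where "C = (exp (Im u) + exp (- Im u)) / 2"
  have C: "C \<ge> 1" using cosh_real_ge_1[of "Im u"] by (simp add: C_def cosh_def)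
  have S: "((exp (Im u) - exp (- Im u)) / 2)\<^sup>2 = C\<^sup>2 - 1"
    by (simp add: C_def power2_eq_square field_simps flip: exp_add)
  have "Re (cos u - 1) = cos (Re u) * C - 1" "Im (cos u - 1) = - (sin (Re u) * ((exp (Im u) - exp (- Im u)) / 2))"
    by (simp_all add: Re_cos Im_cos C_def field_simps)
  then have "(norm (cos u - 1))\<^sup>2 = (cos (Re u) * C - 1)\<^sup>2 + (sin (Re u))\<^sup>2 * ((exp (Im u) - exp (- Im u)) / 2)\<^sup>2"
    by (simp only: cmod_power2 power2_minus power_mult_distrib)
  also have "\<dots> = (C - cos (Re u))\<^sup>2"
    unfolding S sin_squared_eq by (simp add: power2_eq_square field_simps)
  finally have "norm (cos u - 1) = \<bar>C - cos (Re u)\<bar>" 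
    by (smt (verit) abs_norm_cancel power2_eq_iff)
  then show ?thesis using C cos_le_one[of "Re u"] unfolding C_def by linarith
qed

lemma norm_cos_plus_one: "norm (cos u + 1) = (exp (Im u) + exp (- Im u)) / 2 + cos (Re u)"
proof -
  have "cos (u + of_real pi) = - cos u" by (simp add: cos_add)
  then have "cos u + 1 = - (cos (u + of_real pi) - 1)" by simp
  then have "norm (cos u + 1) = norm (cos (u + of_real pi) - 1)" by (metis norm_minus_cancel)
  then show ?thesis unfolding norm_cos_minus_one by simp
qed

text \<open>The two focal distances of cos u add up to 2 cosh (Im u). Thus nearness of cos u to the
  segment [-1, 1] forces Im u to be small, uniformly in Re u, also at the end points of the
  segment.\<close>

lemma Im_bound_by_cos: "(Im u)\<^sup>2 / 2 \<le> norm (cos u - 1) + norm (cos u + 1) - 2"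
proof -
  have *: "2 + x\<^sup>2 / 2 \<le> exp x + exp (- x)" if "x \<ge> 0" for x :: real
    using exp_lower_Taylor_quadratic[OF that] exp_ge_add_one_self[of "- x"] by simp
  show ?thesis
    unfolding norm_cos_minus_one norm_cos_plus_one using *[of "Im u"] *[of "- Im u"]
    by (cases "Im u \<ge> 0") auto
qed

text \<open>In the coordinate \<open>u\<close> with \<open>z = m + r cos u\<close>, \<open>Im u > 0\<close>, the form \<open>k dz / slit_sqrt\<close> is
  \<open>- \<i> k du\<close>, which extends across the real \<open>u\<close>-axis and has vanishing real part on it.\<close>

lemma slit_boundary_limit:
  assumes pq: "p < q" and V: "open V" "of_real ` {p..q} \<subseteq> V"
    and k: "k holomorphic_on V" and kreal: "\<And>x. x \<in> {p..q} \<Longrightarrow> Im (k (of_real x)) = 0"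
    and g: "\<And>z. z \<in> V \<Longrightarrow> z \<notin> of_real ` {p..q} \<Longrightarrow>
        (g has_derivative (\<lambda>h. Re (k z / slit_sqrt p q z * h))) (at z)"
  obtains L where "\<And>x. x \<in> {p..q} \<Longrightarrow> (g \<longlongrightarrow> L) (at (of_real x) within - of_real ` {p..q})"
proof -
  define m r where "m = (p + q) / 2" and "r = (q - p) / 2"
  have r: "r > 0" using pq by (simp add: r_def)
  have mr: "p = m - r" "q = m + r" by (simp_all add: m_def r_def field_simps)
  define Z where "Z u = of_real m + of_real r * cos u" for u :: complex
  have Zhol: "Z holomorphic_on A" for A unfolding Z_def by (intro holomorphic_intros)
  have dZ: "(Z has_field_derivative - of_real r * sin u) (at u)" for u
    unfolding Z_def by (auto intro!: derivative_eq_intros)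
  have Zreal: "Z u \<in> of_real ` {p..q} \<and> Im (k (Z u)) = 0" if "Im u = 0" for u
  proof -
    have "u = of_real (Re u)" using that by (simp add: complex_eq_iff)
    then have "Z u = of_real (m + r * cos (Re u))" unfolding Z_def by (metis cos_of_real of_real_add of_real_mult)
    moreover have "m + r * cos (Re u) \<in> {p..q}"
      using mult_left_mono[OF cos_ge_minus_one, of r "Re u"] mult_left_mono[OF cos_le_one, of r "Re u"] r mr
      by auto
    ultimately show ?thesis using kreal by (metis imageI)
  qed
  have Zoff: "Z u \<notin> of_real ` {p..q}" if "Im u > 0" for u
  proof
    assume "Z u \<in> of_real ` {p..q}"
    then obtain x where x: "x \<in> {p..q}" "of_real m + of_real r * cos u = of_real x" by (auto simp: Z_def)
    define t where "t = (x - m) / r"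
    have t: "\<bar>t\<bar> \<le> 1" using x(1) r mr by (auto simp: t_def abs_le_iff field_simps)
    have "cos u = of_real t" using x(2) r by (simp add: t_def field_simps)
    then have "cos u - 1 = of_real (t - 1)" "cos u + 1 = of_real (t + 1)" by simp_all
    then have "norm (cos u - 1) = \<bar>t - 1\<bar>" "norm (cos u + 1) = \<bar>t + 1\<bar>"
      by (simp_all only: norm_of_real)
    then have "(Im u)\<^sup>2 / 2 \<le> 0" using Im_bound_by_cos[of u] t by auto
    then show False using that by simp
  qed
  define W where "W = Z -` V"
  have Wo: "open W" unfolding W_def
    using continuous_open_preimage[of UNIV Z V] V(1) holomorphic_on_imp_continuous_on[OF Zhol] by auto
  define S where "S = (of_real ` {-pi..pi} :: complex set)"
  have "compact S" unfolding S_def by (intro compact_continuous_image continuous_intros compact_Icc)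
  moreover have "S \<subseteq> W"
    unfolding S_def W_def using Zreal[of "of_real _"] V(2) by (intro image_subsetI vimageI2) (metis Im_complex_of_real subsetD)
  ultimately obtain e0 where e0: "e0 > 0" "(\<Union>x\<in>S. ball x e0) \<subseteq> W"
    using compact_subset_open_imp_ball_epsilon_subset[OF _ Wo] by metis
  define e where "e = e0 / 2"
  have e: "e > 0" using e0 by (simp add: e_def)
  define U where "U = box (Complex (- pi - e) (- e)) (Complex (pi + e) e)"
  have U: "u \<in> U \<longleftrightarrow> - pi - e < Re u \<and> Re u < pi + e \<and> - e < Im u \<and> Im u < e" for u
    by (auto simp: U_def in_box_complex_iff)
  have Uo: "open U" "convex U" by (auto simp: U_def)
  have "U \<subseteq> W"
  proof
    fix u assume u: "u \<in> U"
    define x where "x = max (- pi) (min pi (Re u))"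
    have x: "x \<in> {-pi..pi}" "\<bar>Re u - x\<bar> < e" using u e by (auto simp: U x_def max_def min_def)
    have "norm (u - of_real x) \<le> \<bar>Re u - x\<bar> + \<bar>Im u\<bar>" using cmod_le[of "u - of_real x"] by simp
    also have "\<dots> < e + e" using x u by (intro add_strict_mono) (auto simp: U)
    also have "e + e = e0" by (simp add: e_def)
    finally have "u \<in> ball (of_real x) e0" by (simp add: dist_norm norm_minus_commute)
    then show "u \<in> W" using e0(2) x(1) unfolding S_def by blast
  qed
  then have UV: "Z u \<in> V" if "u \<in> U" for u using that by (auto simp: W_def)
  have "(\<lambda>u. - \<i> * k (Z u)) holomorphic_on U"
    using holomorphic_on_compose_gen[OF Zhol k, of U] UV by (auto simp: o_def intro!: holomorphic_intros)
  then obtain Q where Q0: "\<And>u. u \<in> U \<Longrightarrow> (Q has_field_derivative - \<i> * k (Z u)) (at u within U)"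
    using holomorphic_convex_primitive'[OF Uo(2,1)] by blast
  then have Q: "(Q has_field_derivative - \<i> * k (Z u)) (at u)" if "u \<in> U" for u
    using that Uo(1) by (metis at_within_open)
  have dQ: "((\<lambda>u. Re (Q u)) has_derivative (\<lambda>h. Re (- \<i> * k (Z u) * h))) (at u)" if "u \<in> U" for u
    using bounded_linear.has_derivative[OF bounded_linear_Re Q[OF that, unfolded has_field_derivative_def]] .
  define U1 where "U1 = U \<inter> {u. Im u > 0}"
  have U1: "convex U1" "open U1"
    unfolding U1_def using Uo by (auto intro!: convex_Int convex_halfspace_Im_gt open_Int open_halfspace_Im_gt)
  have "\<exists>c. \<forall>u\<in>U1. g (Z u) - Re (Q u) = c"
  proof (rule has_derivative_zero_constant[OF U1(1)])
    fix u assume "u \<in> U1"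
    then have u: "u \<in> U" "Im u > 0" by (auto simp: U1_def)
    have "((\<lambda>u. g (Z u)) has_derivative
        (\<lambda>h. Re (k (Z u) / slit_sqrt p q (Z u) * (- of_real r * sin u * h)))) (at u)"
      using has_derivative_compose[OF dZ[unfolded has_field_derivative_def] g[OF UV[OF u(1)] Zoff[OF u(2)]]] .
    moreover have "k (Z u) / slit_sqrt p q (Z u) * (- of_real r * sin u * h) = - \<i> * k (Z u) * h" for h
    proof -
      have s: "slit_sqrt p q (Z u) = - \<i> * of_real r * sin u"
        using slit_sqrt_cos[OF pq u(2)] by (simp only: Z_def m_def r_def)
      have "slit_sqrt p q (Z u) \<noteq> 0" using slit_sqrt_nonzero[OF less_imp_le[OF pq] Zoff[OF u(2)]] .
      then have "sin u \<noteq> 0" using s by auto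
      then show ?thesis unfolding s using r by (simp add: field_simps)
    qed
    ultimately have "((\<lambda>u. g (Z u)) has_derivative (\<lambda>h. Re (- \<i> * k (Z u) * h))) (at u)" by (simp only:)
    from has_derivative_diff[OF this dQ[OF u(1)]]
    show "((\<lambda>u. g (Z u) - Re (Q u)) has_derivative (\<lambda>h. 0)) (at u within U1)"
      by (simp add: has_derivative_at_withinI)
  qed
  then obtain c where c: "\<And>u. u \<in> U \<Longrightarrow> Im u > 0 \<Longrightarrow> g (Z u) = Re (Q u) + c"
    by (auto simp: U1_def algebra_simps)
  \<comment> \<open>On the real u-axis k o Z is real, so -\<open>\<i>\<close> k du has vanishing
    real part. This is why all points of the slit, approached from either side, share one
    limit.\<close>
  have "\<exists>L. \<forall>x\<in>{-pi - e<..<pi + e}. Re (Q (of_real x)) = L"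
  proof (rule has_derivative_zero_constant)
    fix x assume x: "x \<in> {-pi - e<..<pi + e}"
    then have xU: "of_real x \<in> U" using e by (auto simp: U)
    have "((\<lambda>x. complex_of_real x) has_derivative of_real) (at x)" by (auto intro!: derivative_eq_intros)
    from has_derivative_compose[OF this dQ[OF xU]]
    have "((\<lambda>x. Re (Q (of_real x))) has_derivative (\<lambda>h. Re (- \<i> * k (Z (of_real x)) * of_real h))) (at x)" .
    then show "((\<lambda>x. Re (Q (of_real x))) has_derivative (\<lambda>h. 0)) (at x within {-pi - e<..<pi + e})"
      using Zreal[of "of_real x"] by (simp add: has_derivative_at_withinI)
  qed auto
  then obtain L where L: "\<And>x. x \<in> {-pi - e<..<pi + e} \<Longrightarrow> Re (Q (of_real x)) = L" by auto
  define C where "C = cbox (Complex (- pi) 0) (Complex pi (e / 2))"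
  have C: "u \<in> C \<longleftrightarrow> - pi \<le> Re u \<and> Re u \<le> pi \<and> 0 \<le> Im u \<and> Im u \<le> e / 2" for u
    by (auto simp: C_def in_cbox_complex_iff)
  have "C \<subseteq> U" using e by (auto simp: C U)
  have "compact C" by (simp add: C_def)
  moreover have "continuous_on C (\<lambda>u. Re (Q u))"
    using \<open>C \<subseteq> U\<close> by (intro continuous_intros DERIV_continuous_on[of C Q]) (auto intro: DERIV_subset[OF Q])
  ultimately have uc: "uniformly_continuous_on C (\<lambda>u. Re (Q u))"
    by (blast intro: compact_uniformly_continuous)
  have near: "\<exists>d>0. \<forall>u. Im u > 0 \<longrightarrow> Im u < d \<longrightarrow> \<bar>Re u\<bar> \<le> pi \<longrightarrow> \<bar>g (Z u) - (L + c)\<bar> < \<epsilon>" if \<epsilon>: "\<epsilon> > 0" for \<epsilon>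
  proof -
    obtain d where d: "d > 0" "\<And>u v. u \<in> C \<Longrightarrow> v \<in> C \<Longrightarrow> dist v u < d \<Longrightarrow> dist (Re (Q v)) (Re (Q u)) < \<epsilon>"
      using uc \<epsilon> unfolding uniformly_continuous_on_def by metis
    show ?thesis
    proof (intro exI[of _ "min d (e / 2)"] conjI allI impI)
      fix u assume u: "Im u > 0" "Im u < min d (e / 2)" "\<bar>Re u\<bar> \<le> pi"
      then have uC: "u \<in> C" "of_real (Re u) \<in> C" using e by (auto simp: C)
      have "u - of_real (Re u) = of_real (Im u) * \<i>" by (simp add: complex_eq_iff)
      then have "dist u (of_real (Re u)) = Im u" using u by (simp add: dist_norm norm_mult)
      then have "dist (Re (Q u)) (Re (Q (of_real (Re u)))) < \<epsilon>" using u uC d(2) by auto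
      moreover have "Re (Q (of_real (Re u))) = L" using u e by (intro L) (auto simp: abs_le_iff)
      moreover have "g (Z u) = Re (Q u) + c" using uC \<open>C \<subseteq> U\<close> u by (intro c) auto
      ultimately show "\<bar>g (Z u) - (L + c)\<bar> < \<epsilon>" by (simp add: dist_real_def)
    qed (use d e in auto)
  qed
  have "(g \<longlongrightarrow> L + c) (at (of_real x) within - of_real ` {p..q})" if x: "x \<in> {p..q}" for x
  proof (rule tendstoI)
    fix \<epsilon> :: real assume "\<epsilon> > 0"
    then obtain d where d: "d > 0"
      "\<And>u. Im u > 0 \<Longrightarrow> Im u < d \<Longrightarrow> \<bar>Re u\<bar> \<le> pi \<Longrightarrow> \<bar>g (Z u) - (L + c)\<bar> < \<epsilon>"
      using near by metis
    define t where "t = (x - m) / r"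
    have t: "\<bar>t\<bar> \<le> 1" using x r mr by (auto simp: t_def abs_le_iff field_simps)
    \<comment> \<open>The sum of the focal distances minus 2, in the coordinate that maps the slit
      to [-1, 1]. It is continuous, vanishes on the slit and dominates (Im u)^2 / 2.\<close>
    define \<nu> where "\<nu> z = norm ((z - of_real m) / of_real r - 1) + norm ((z - of_real m) / of_real r + 1) - 2" for z :: complex
    have "(\<nu> \<longlongrightarrow> \<nu> (of_real x)) (at (of_real x) within - of_real ` {p..q})"
      unfolding \<nu>_def using r by (intro tendsto_intros) auto
    moreover have "\<nu> (of_real x) = 0"
    proof -
      have "(of_real x - of_real m) / complex_of_real r - 1 = of_real (t - 1)"
        "(of_real x - of_real m) / complex_of_real r + 1 = of_real (t + 1)" by (simp_all add: t_def)
      then show ?thesis unfolding \<nu>_def using t by (simp only: norm_of_real)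
    qed
    ultimately have "eventually (\<lambda>z. \<nu> z < d\<^sup>2 / 2) (at (of_real x) within - of_real ` {p..q})"
      using d by (intro order_tendstoD[where y = 0]) auto
    moreover have "eventually (\<lambda>z. z \<notin> of_real ` {p..q}) (at (of_real x) within - of_real ` {p..q})"
      by (auto simp: eventually_at_filter)
    ultimately show "eventually (\<lambda>z. dist (g z) (L + c) < \<epsilon>) (at (of_real x) within - of_real ` {p..q})"
    proof eventually_elim
      case (elim z)
      define u0 where "u0 = Arccos ((z - of_real m) / of_real r)"
      \<comment> \<open>Since cos is even, the sign of the preimage is free; the one in the upper
        half plane is taken, where \<open>g (Z u)\<close> is controlled.\<close>
      define u where "u = (if Im u0 > 0 then u0 else - u0)"
      have cu: "cos u = (z - of_real m) / of_real r" by (simp add: u_def u0_def)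
      then have Zu: "Z u = z" using r by (simp add: Z_def)
      have "Im u \<noteq> 0" using Zreal[of u] elim(2) Zu by auto
      then have Imu: "Im u > 0" by (auto simp: u_def split: if_splits)
      have Reu: "\<bar>Re u\<bar> \<le> pi" using Re_Arccos_bound by (simp add: u_def u0_def)
      have "(Im u)\<^sup>2 / 2 < d\<^sup>2 / 2" using Im_bound_by_cos[of u] elim(1) unfolding cu \<nu>_def by linarith
      then have "Im u < d" using d(1) by (simp add: power2_less_imp_less)
      from d(2)[OF Imu this Reu] show ?case unfolding Zu by (simp add: dist_real_def)
    qed
  qed
  then show ?thesis by (rule that)
qed

subsection \<open>Green functions of one and two slits\<close>

text \<open>Subtracting the common boundary limit L normalizes a real primitive to the Green
  function. The expansion P at infinity, with P 0 = 1, supplies the logarithmic pole of coefficient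
  1.\<close>

lemma is_green_funI:
  fixes f P :: "complex \<Rightarrow> complex" and g :: "complex \<Rightarrow> real"
  assumes K: "compact K" and f: "f holomorphic_on - K"
    and g: "\<And>z. z \<notin> K \<Longrightarrow> (g has_derivative (\<lambda>h. Re (f z * h))) (at z)"
    and P: "(P has_field_derivative D) (at 0)" "P 0 = 1"
      "eventually (\<lambda>z. f z = P (1 / z) / z) at_infinity"
    and L: "\<And>\<zeta>. \<zeta> \<in> K \<Longrightarrow> (g \<longlongrightarrow> L) (at \<zeta> within - K)"
  shows "is_green_fun K (\<lambda>z. if z \<in> K then 0 else g z - L)"
proof -
  define G where "G z = (if z \<in> K then 0 else g z - L)" for z :: complex
  have oK: "open (- K)" using K compact_imp_closed by blast
  have dG: "(G has_derivative (\<lambda>h. Re (f z * h))) (at z)" if "z \<in> - K" for z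
  proof -
    have "((\<lambda>z. g z - L) has_derivative (\<lambda>h. Re (f z * h))) (at z)"
      using has_derivative_diff[OF g has_derivative_const, of z L] that by simp
    then show ?thesis
      by (rule has_derivative_transform_within_open[OF _ oK that]) (auto simp: G_def)
  qed
  have "harmonic_on G (- K)" using harmonic_on_real_primitive[OF oK f dG] by blast
  moreover have "(\<lambda>z. G z - ln (norm z)) \<in> O[at_infinity](\<lambda>_. 1)"
  proof -
    obtain R0 where R0: "\<And>z. norm z \<ge> R0 \<Longrightarrow> norm (f z - 1 / z) \<le> (norm D + 1) / (norm z)\<^sup>2"
      using eventually_norm_minus_inverse_le[OF P] by (auto simp: eventually_at_infinity)
    obtain R1 where R1: "\<And>z. z \<in> K \<Longrightarrow> norm z \<le> R1"
      using K compact_imp_bounded bounded_iff by metis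
    define R where "R = max 1 (max R0 (R1 + 1))"
    show ?thesis
    proof (rule real_primitive_log_growth[where R = R and f = f])
      fix z :: complex assume z: "norm z \<ge> R"
      then have "z \<in> - K" using R1[of z] by (auto simp: R_def)
      then show "(G has_derivative (\<lambda>h. Re (f z * h))) (at z)" by (rule dG)
      show "norm (f z - 1 / z) \<le> (norm D + 1) / (norm z)\<^sup>2" using R0[of z] z by (simp add: R_def)
    qed (auto simp: R_def)
  qed
  moreover have "(G \<longlongrightarrow> 0) (at \<zeta> within - K)" if "\<zeta> \<in> frontier K" for \<zeta>
  proof -
    have "\<zeta> \<in> K" using that K compact_imp_closed frontier_subset_closed by blast
    then have "((\<lambda>z. g z - L) \<longlongrightarrow> L - L) (at \<zeta> within - K)" by (intro tendsto_intros L)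
    moreover have "eventually (\<lambda>z. g z - L = G z) (at \<zeta> within - K)"
      by (auto simp: eventually_at_filter G_def)
    ultimately show ?thesis using Lim_transform_eventually by fastforce
  qed
  ultimately have "is_green_fun K G" by (simp add: is_green_fun_def) (simp add: G_def)
  then show ?thesis unfolding G_def[abs_def] .
qed

text \<open>Up to the factor 1 / pi this is the density of the equilibrium measure of
  [-1, 1].\<close>

definition arcsine_density :: "real \<Rightarrow> real" where
  "arcsine_density t = 1 / sqrt (1 - t\<^sup>2)"

text \<open>The quotient of \<open>slit_sqrt\<close> by z, written in the local coordinate w = 1 / z
  so that it is analytic at w = 0.\<close>

definition slit_sqrt_at_infinity :: "real \<Rightarrow> real \<Rightarrow> complex \<Rightarrow> complex" where
  "slit_sqrt_at_infinity p q w = (1 - of_real ((p + q) / 2) * w) * csqrt (1 -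
     (of_real ((q - p) / 2) * w / (1 - of_real ((p + q) / 2) * w))\<^sup>2)"

lemma slit_sqrt_eq_at_infinity: "z \<noteq> 0 \<Longrightarrow> slit_sqrt p q z = z * slit_sqrt_at_infinity p q (1 / z)"
  unfolding slit_sqrt_at_infinity_def by (rule slit_sqrt_inverse)

lemma slit_sqrt_at_infinity_0 [simp]: "slit_sqrt_at_infinity p q 0 = 1"
  by (simp add: slit_sqrt_at_infinity_def)

lemma slit_sqrt_at_infinity_differentiable: "slit_sqrt_at_infinity p q field_differentiable at 0"
proof -
  have "slit_sqrt_at_infinity p q analytic_on {0}"
    unfolding slit_sqrt_at_infinity_def by (intro analytic_intros) auto
  then show ?thesis using analytic_on_imp_differentiable_at by blast
qed

lemma tendsto_real_path:
  assumes g: "(g \<longlongrightarrow> L) (at (complex_of_real x) within - A)"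
    and u: "(u \<longlongrightarrow> x) F" and ev: "eventually (\<lambda>t. of_real (u t) \<notin> A) F" and x: "of_real x \<in> A"
  shows "((\<lambda>t. g (of_real (u t))) \<longlongrightarrow> L) F"
proof (rule filterlim_compose[OF g])
  show "filterlim (\<lambda>t. complex_of_real (u t)) (at (of_real x) within - A) F"
    unfolding filterlim_at using ev x
    by (intro conjI tendsto_of_real u) (auto elim!: eventually_mono)
qed

lemma cos_sin_bounds:
  assumes "0 < \<theta>" "\<theta> < pi"
  shows "-1 < cos \<theta>" "cos \<theta> < 1" "sin \<theta> > 0"
  using assms cos_monotone_0_pi[of 0 \<theta>] cos_monotone_0_pi[of \<theta> pi] sin_gt_zero by auto

text \<open>The differential has its zero at c = \<alpha> + \<delta> \<gamma>. Pulled back to the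
  gap, its real primitive has the same derivative as F, so the two differ by a constant c0; the
  zeros of F at 0 and pi then force the limits at both slits to be c0.\<close>

lemma green_fun_two_slits:
  fixes \<alpha> \<delta> \<gamma> :: real and F :: "real \<Rightarrow> real"
  assumes \<delta>: "\<delta> > 0" and a: "-1 < \<alpha> - \<delta>" and b: "\<alpha> + \<delta> < 1"
    and F: "continuous_on {0..pi} F" "F 0 = 0" "F pi = 0"
    and dF: "\<And>\<theta>. 0 < \<theta> \<Longrightarrow> \<theta> < pi \<Longrightarrow>
       (F has_real_derivative \<delta> * (\<gamma> + cos \<theta>) * arcsine_density (\<alpha> - \<delta> * cos \<theta>)) (at \<theta>)"
  defines K_eq: "K \<equiv> complex_of_real ` ({-1..\<alpha> - \<delta>} \<union> {\<alpha> + \<delta>..1})"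
  shows "\<And>\<theta>. 0 < \<theta> \<Longrightarrow> \<theta> < pi \<Longrightarrow> green_fun K (of_real (\<alpha> - \<delta> * cos \<theta>)) = F \<theta>"
    and "\<And>z. z \<in> K \<Longrightarrow> green_fun K z = 0"
proof -
  define a' b' c where "a' = \<alpha> - \<delta>" and "b' = \<alpha> + \<delta>" and "c = \<alpha> + \<delta> * \<gamma>"
  have ab: "-1 < a'" "a' < b'" "b' < 1" using \<delta> a b by (auto simp: a'_def b'_def)
  have K_def: "K = complex_of_real ` ({-1..a'} \<union> {b'..1})" by (simp add: K_eq a'_def b'_def)
  define K1 K2 where "K1 = complex_of_real ` {-1..a'}" and "K2 = complex_of_real ` {b'..1}"
  have K12: "K = K1 \<union> K2" by (auto simp: K_def K1_def K2_def)
  have dis: "K1 \<inter> K2 = {}" using ab by (auto simp: K1_def K2_def)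
  have cp: "compact K1" "compact K2"
    unfolding K1_def K2_def by (intro compact_continuous_image continuous_intros compact_Icc)+
  then have K: "compact K" "closed K" unfolding K12 by (auto intro: compact_Un compact_imp_closed)
  have op: "open (- K1)" "open (- K2)" using cp compact_imp_closed by blast+
  have "K \<subseteq> \<real>" by (auto simp: K_def)
  define S1 S2 where "S1 = slit_sqrt (-1) a'" and "S2 = slit_sqrt b' 1"
  have hS: "S1 holomorphic_on - K1" "S2 holomorphic_on - K2"
    using holomorphic_slit_sqrt[of "-1" a'] holomorphic_slit_sqrt[of b' 1] ab
    by (auto simp: S1_def S2_def K1_def K2_def)
  have nS: "z \<notin> K1 \<Longrightarrow> S1 z \<noteq> 0" "z \<notin> K2 \<Longrightarrow> S2 z \<noteq> 0" for z
    using slit_sqrt_nonzero[of "-1" a' z] slit_sqrt_nonzero[of b' 1 z] ab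
    by (auto simp: S1_def S2_def K1_def K2_def)
  have cS: "z \<notin> K1 \<Longrightarrow> S1 (cnj z) = cnj (S1 z)" "z \<notin> K2 \<Longrightarrow> S2 (cnj z) = cnj (S2 z)" for z
    using slit_sqrt_cnj[of "-1" a' z] slit_sqrt_cnj[of b' 1 z] ab
    by (auto simp: S1_def S2_def K1_def K2_def)
  define f where "f z = (z - of_real c) / (S1 z * S2 z)" for z
  have f: "f holomorphic_on - K"
    unfolding f_def using nS
    by (intro holomorphic_intros holomorphic_on_subset[OF hS(1)] holomorphic_on_subset[OF hS(2)])
      (auto simp: K12)
  have "f (cnj z) = cnj (f z)" if "z \<notin> K" for z
    using that cS[of z] by (simp add: f_def K12)
  then obtain g where g: "\<And>z. z \<notin> K \<Longrightarrow> (g has_derivative (\<lambda>h. Re (f z * h))) (at z)"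
    using symmetric_real_primitive[OF K(2) \<open>K \<subseteq> \<real>\<close> f] by blast
  \<comment> \<open>Off the right slit the factor S2 is holomorphic, and it is real on the left
    slit; so (z - c) / S2 can serve as the numerator k there. The right slit is treated with the
    roles exchanged.\<close>
  obtain L1 where L1: "\<And>x. x \<in> {-1..a'} \<Longrightarrow> (g \<longlongrightarrow> L1) (at (of_real x) within - K1)"
    unfolding K1_def
  proof (rule slit_boundary_limit[of "-1" a' "- K2" "\<lambda>z. (z - of_real c) / S2 z" g])
    show "(\<lambda>z. (z - of_real c) / S2 z) holomorphic_on - K2"
      using nS by (intro holomorphic_intros hS) auto
    show "Im ((of_real x - of_real c) / S2 (of_real x)) = 0" if "x \<in> {-1..a'}" for x
      using that ab slit_sqrt_less[of b' 1 x] by (simp add: S2_def flip: of_real_diff of_real_mult of_real_divide of_real_minus)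
    show "(g has_derivative (\<lambda>h. Re ((z - of_real c) / S2 z / slit_sqrt (-1) a' z * h))) (at z)"
      if "z \<in> - K2" "z \<notin> of_real ` {-1..a'}" for z
      using g[of z] that by (simp add: K12 K1_def f_def S1_def mult.commute)
  qed (use ab op dis in \<open>auto simp: K1_def\<close>)
  obtain L2 where L2: "\<And>x. x \<in> {b'..1} \<Longrightarrow> (g \<longlongrightarrow> L2) (at (of_real x) within - K2)"
    unfolding K2_def
  proof (rule slit_boundary_limit[of b' 1 "- K1" "\<lambda>z. (z - of_real c) / S1 z" g])
    show "(\<lambda>z. (z - of_real c) / S1 z) holomorphic_on - K1"
      using nS by (intro holomorphic_intros hS) auto
    show "Im ((of_real x - of_real c) / S1 (of_real x)) = 0" if "x \<in> {b'..1}" for x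
      using that ab slit_sqrt_greater[of "-1" a' x] by (simp add: S1_def flip: of_real_diff of_real_mult of_real_divide of_real_minus)
    show "(g has_derivative (\<lambda>h. Re ((z - of_real c) / S1 z / slit_sqrt b' 1 z * h))) (at z)"
      if "z \<in> - K1" "z \<notin> of_real ` {b'..1}" for z
      using g[of z] that by (simp add: K12 K2_def f_def S2_def)
  qed (use ab op dis in \<open>auto simp: K2_def\<close>)
  define u where "u t = \<alpha> - \<delta> * cos t" for t
  have u_gap: "a' < u t \<and> u t < b'" if "0 < t" "t < pi" for t
    using cos_sin_bounds[OF that] \<delta> mult_strict_left_mono[of "cos t" 1 \<delta>] mult_strict_left_mono[of "-1" "cos t" \<delta>]
    by (auto simp: u_def a'_def b'_def)
  have u_notin: "of_real (u t) \<notin> K" if "0 < t" "t < pi" for t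
    using u_gap[OF that] by (auto simp: K_def)
  have dgu: "((\<lambda>t. g (of_real (u t))) has_real_derivative \<delta> * (\<gamma> + cos t) * arcsine_density (\<alpha> - \<delta> * cos t)) (at t)"
    if t: "0 < t" "t < pi" for t
  proof -
    note cb = cos_sin_bounds[OF t]
    have du: "((\<lambda>t. complex_of_real (u t)) has_derivative (\<lambda>h. of_real (\<delta> * sin t * h))) (at t)"
      unfolding u_def by (auto intro!: derivative_eq_intros simp: algebra_simps)
    define x where "x = u t"
    have x: "-1 < x" "a' < x" "x < b'" "x < 1" using u_gap[OF t] ab by (auto simp: x_def)
    have "S1 (of_real x) = of_real (sqrt ((x - -1) * (x - a')))"
      unfolding S1_def using ab x by (intro slit_sqrt_greater) auto
    moreover have "S2 (of_real x) = - of_real (sqrt ((b' - x) * (1 - x)))"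
      unfolding S2_def using ab x by (intro slit_sqrt_less) auto
    ultimately have fx: "f (of_real x) = of_real ((x - c) / - (sqrt ((x - -1) * (x - a')) * sqrt ((b' - x) * (1 - x))))"
      unfolding f_def by simp
    \<comment> \<open>The end point factors (x - a') (b' - x) combine to the square of \<delta> sin
      t, which is the Jacobian of the substitution.\<close>
    have "sqrt ((x - -1) * (x - a')) * sqrt ((b' - x) * (1 - x)) = sqrt ((1 - x\<^sup>2) * ((x - a') * (b' - x)))"
      by (simp add: power2_eq_square algebra_simps flip: real_sqrt_mult)
    also have "(x - a') * (b' - x) = (\<delta> * sin t)\<^sup>2"
      unfolding power_mult_distrib sin_squared_eq
      by (simp add: x_def u_def a'_def b'_def power2_eq_square algebra_simps)
    also have "sqrt ((1 - x\<^sup>2) * (\<delta> * sin t)\<^sup>2) = sqrt (1 - x\<^sup>2) * (\<delta> * sin t)"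
      using cb \<delta> by (simp add: real_sqrt_mult)
    finally have "Re (f (of_real x) * of_real (\<delta> * sin t * h)) = (x - c) / - (sqrt (1 - x\<^sup>2) * (\<delta> * sin t)) * (\<delta> * sin t * h)" for h
      unfolding fx by (simp only: of_real_mult[symmetric] Re_complex_of_real)
    moreover have "(x - c) / - (sqrt (1 - x\<^sup>2) * (\<delta> * sin t)) * (\<delta> * sin t * h) = \<delta> * (\<gamma> + cos t) * arcsine_density x * h" for h
    proof -
      have "x - c = - \<delta> * (\<gamma> + cos t)" by (simp add: x_def u_def c_def algebra_simps)
      then show ?thesis using cb \<delta> by (simp add: arcsine_density_def)
    qed
    ultimately have "(\<lambda>h. Re (f (of_real (u t)) * of_real (\<delta> * sin t * h))) = (\<lambda>h. \<delta> * (\<gamma> + cos t) * arcsine_density (u t) * h)"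
      by (simp only: x_def[symmetric])
    with has_derivative_compose[OF du g[OF u_notin[OF t]]] show ?thesis
      unfolding has_field_derivative_def u_def by (simp only:)
  qed
  have "\<exists>c. \<forall>t\<in>{0<..<pi}. g (of_real (u t)) - F t = c"
  proof (rule has_field_derivative_zero_constant)
    fix t assume "t \<in> {0<..<pi}"
    then have "((\<lambda>t. g (of_real (u t)) - F t) has_real_derivative 0) (at t)"
      using DERIV_diff[OF dgu dF, of t] by simp
    then show "((\<lambda>t. g (of_real (u t)) - F t) has_real_derivative 0) (at t within {0<..<pi})"
      by (rule DERIV_subset) simp
  qed simp
  then obtain c0 where c0: "\<And>t. 0 < t \<Longrightarrow> t < pi \<Longrightarrow> g (of_real (u t)) = F t + c0"
    by (auto simp: algebra_simps)
  have ev0: "eventually (\<lambda>t. 0 < t \<and> t < pi) (at_right 0)"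
    unfolding eventually_at_right_field by (intro exI[of _ pi]) auto
  have evpi: "eventually (\<lambda>t. 0 < t \<and> t < pi) (at_left pi)"
    unfolding eventually_at_left_field by (intro exI[of _ 0]) auto
  have u0: "(u \<longlongrightarrow> a') (at_right 0)"
  proof -
    have "(u \<longlongrightarrow> \<alpha> - \<delta> * cos 0) (at_right 0)" unfolding u_def by (intro tendsto_intros)
    then show ?thesis by (simp add: a'_def)
  qed
  have upi: "(u \<longlongrightarrow> b') (at_left pi)"
  proof -
    have "(u \<longlongrightarrow> \<alpha> - \<delta> * cos pi) (at_left pi)" unfolding u_def by (intro tendsto_intros)
    then show ?thesis by (simp add: b'_def)
  qed
  have "((\<lambda>t. g (of_real (u t))) \<longlongrightarrow> L1) (at_right 0)"
    using ab by (intro tendsto_real_path[OF L1[of a'] u0])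
      (auto simp: K1_def intro!: eventually_mono[OF ev0] dest: u_gap)
  moreover have "((\<lambda>t. g (of_real (u t))) \<longlongrightarrow> 0 + c0) (at_right 0)"
  proof -
    have "(F \<longlongrightarrow> F 0) (at 0 within {0..pi})" using F(1) by (auto simp: continuous_on)
    then have "(F \<longlongrightarrow> F 0) (at_right 0)" by (simp add: at_within_Icc_at_right)
    then have "((\<lambda>t. F t + c0) \<longlongrightarrow> F 0 + c0) (at_right 0)" by (intro tendsto_intros)
    then show ?thesis unfolding F(2)
      by (rule Lim_transform_eventually) (use ev0 c0 in \<open>auto elim!: eventually_mono\<close>)
  qed
  \<comment> \<open>The limit at a whole slit is computed at one point of it, the end adjacent to
    the gap, approached along the real axis.\<close>
  ultimately have "L1 = 0 + c0" using tendsto_unique trivial_limit_at_right_real by blast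
  have "((\<lambda>t. g (of_real (u t))) \<longlongrightarrow> L2) (at_left pi)"
    using ab by (intro tendsto_real_path[OF L2[of b'] upi])
      (auto simp: K2_def intro!: eventually_mono[OF evpi] dest: u_gap)
  moreover have "((\<lambda>t. g (of_real (u t))) \<longlongrightarrow> 0 + c0) (at_left pi)"
  proof -
    have "(F \<longlongrightarrow> F pi) (at pi within {0..pi})" using F(1) by (auto simp: continuous_on)
    then have "(F \<longlongrightarrow> F pi) (at_left pi)" by (simp add: at_within_Icc_at_left)
    then have "((\<lambda>t. F t + c0) \<longlongrightarrow> F pi + c0) (at_left pi)" by (intro tendsto_intros)
    then show ?thesis unfolding F(3)
      by (rule Lim_transform_eventually) (use evpi c0 in \<open>auto elim!: eventually_mono\<close>)
  qed
  ultimately have "L2 = 0 + c0" using tendsto_unique trivial_limit_at_left_real by blast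
  have L: "(g \<longlongrightarrow> c0) (at \<zeta> within - K)" if "\<zeta> \<in> K" for \<zeta>
  proof -
    have "- K \<subseteq> - K1" "- K \<subseteq> - K2" by (auto simp: K12)
    moreover have "\<exists>A\<in>{K1, K2}. (g \<longlongrightarrow> c0) (at \<zeta> within - A)"
      using that L1 L2 \<open>L1 = 0 + c0\<close> \<open>L2 = 0 + c0\<close> by (auto simp: K12 K1_def K2_def)
    ultimately show ?thesis by (auto intro: tendsto_within_subset)
  qed
  define P where "P w = (1 - of_real c * w) / (slit_sqrt_at_infinity (-1) a' w * slit_sqrt_at_infinity b' 1 w)" for w
  have "P field_differentiable at 0"
    unfolding P_def by (intro derivative_intros slit_sqrt_at_infinity_differentiable) auto
  then obtain D where D: "(P has_field_derivative D) (at 0)" by (auto simp: field_differentiable_def)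
  have "eventually (\<lambda>z. f z = P (1 / z) / z) at_infinity"
    unfolding eventually_at_infinity
  proof (intro exI[of _ 1] allI impI)
    fix z :: complex assume "1 \<le> norm z"
    then have z: "z \<noteq> 0" by auto
    have "f z = (z * (1 - of_real c * (1 / z))) / (z * slit_sqrt_at_infinity (-1) a' (1 / z) * (z * slit_sqrt_at_infinity b' 1 (1 / z)))"
      unfolding f_def S1_def S2_def slit_sqrt_eq_at_infinity[OF z] using z by (simp add: right_diff_distrib)
    also have "\<dots> = P (1 / z) / z" unfolding P_def using z by simp
    finally show "f z = P (1 / z) / z" .
  qed
  then have "is_green_fun K (\<lambda>z. if z \<in> K then 0 else g z - c0)"
    by (intro is_green_funI[OF K(1) f g D _ _ L]) (simp_all add: P_def)
  then have gf: "green_fun K = (\<lambda>z. if z \<in> K then 0 else g z - c0)"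
    by (rule green_fun_eqI[OF K(2)])
  show "green_fun K (of_real (\<alpha> - \<delta> * cos \<theta>)) = F \<theta>" if "0 < \<theta>" "\<theta> < pi" for \<theta>
    using u_notin[OF that] c0[OF that] unfolding gf by (simp add: u_def)
  show "green_fun K z = 0" if "z \<in> K" for z
    using that by (simp add: gf)
qed

text \<open>Here \<theta> -> 0 leads to -1, an ordinary point of the domain, so the constant is
  fixed at the slit end \<theta> = pi alone. The formula is the two-slit one with \<gamma> = -1,
  which makes the limit of the two-slit functions directly comparable.\<close>

lemma green_fun_one_slit:
  fixes \<delta> :: real and F :: "real \<Rightarrow> real"
  assumes \<delta>: "0 < \<delta>" "\<delta> < 1"
    and F: "continuous_on {pi / 2..pi} F" "F pi = 0"
    and dF: "\<And>\<theta>. 0 < \<theta> \<Longrightarrow> \<theta> < pi \<Longrightarrow>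
       (F has_real_derivative \<delta> * (- 1 + cos \<theta>) * arcsine_density (\<delta> - 1 - \<delta> * cos \<theta>)) (at \<theta>)"
  defines K_eq: "K \<equiv> complex_of_real ` {-1 + 2 * \<delta>..1}"
  shows "\<And>\<theta>. 0 < \<theta> \<Longrightarrow> \<theta> < pi \<Longrightarrow> green_fun K (of_real (\<delta> - 1 - \<delta> * cos \<theta>)) = F \<theta>"
    and "\<And>z. z \<in> K \<Longrightarrow> green_fun K z = 0"
proof -
  define b where "b = -1 + 2 * \<delta>"
  have b: "b < 1" using \<delta> by (simp add: b_def)
  have K_def: "K = complex_of_real ` {b..1}" by (simp add: K_eq b_def)
  have K: "compact K" "closed K" 
    unfolding K_def by (auto intro!: compact_continuous_image continuous_intros compact_Icc compact_imp_closed)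
  have "K \<subseteq> \<real>" by (auto simp: K_def)
  define f where "f z = 1 / slit_sqrt b 1 z" for z
  have f: "f holomorphic_on - K"
    unfolding f_def K_def using b slit_sqrt_nonzero[of b 1]
    by (intro holomorphic_intros holomorphic_slit_sqrt) auto
  have "f (cnj z) = cnj (f z)" if "z \<notin> K" for z
    using that slit_sqrt_cnj[of b 1 z] b by (simp add: f_def K_def)
  then obtain g where g: "\<And>z. z \<notin> K \<Longrightarrow> (g has_derivative (\<lambda>h. Re (f z * h))) (at z)"
    using symmetric_real_primitive[OF K(2) \<open>K \<subseteq> \<real>\<close> f] by blast
  obtain L where L: "\<And>x. x \<in> {b..1} \<Longrightarrow> (g \<longlongrightarrow> L) (at (of_real x) within - K)"
    unfolding K_def
  proof (rule slit_boundary_limit[of b 1 UNIV "\<lambda>z. 1" g])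
    show "(g has_derivative (\<lambda>h. Re (1 / slit_sqrt b 1 z * h))) (at z)"
      if "z \<notin> of_real ` {b..1}" for z
      using g[of z] that by (simp add: K_def f_def)
  qed (use b in auto)
  define u where "u t = \<delta> - 1 - \<delta> * cos t" for t
  have u_gap: "u t < b" if "0 < t" "t < pi" for t
    using cos_sin_bounds[OF that] \<delta> mult_strict_left_mono[of "-1" "cos t" \<delta>]
    by (auto simp: u_def b_def)
  have u_notin: "of_real (u t) \<notin> K" if "0 < t" "t < pi" for t
    using u_gap[OF that] by (auto simp: K_def)
  have dgu: "((\<lambda>t. g (of_real (u t))) has_real_derivative \<delta> * (- 1 + cos t) * arcsine_density (\<delta> - 1 - \<delta> * cos t)) (at t)"
    if t: "0 < t" "t < pi" for t
  proof -
    note cb = cos_sin_bounds[OF t]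
    have du: "((\<lambda>t. complex_of_real (u t)) has_derivative (\<lambda>h. of_real (\<delta> * sin t * h))) (at t)"
      unfolding u_def by (auto intro!: derivative_eq_intros simp: algebra_simps)
    define x where "x = u t"
    have x: "x < b" "x < 1" using u_gap[OF t] b by (auto simp: x_def)
    have fx: "f (of_real x) = of_real (1 / - sqrt ((b - x) * (1 - x)))"
      unfolding f_def using slit_sqrt_less[of b 1 x] b x by simp
    have p: "1 + x = \<delta> * (1 - cos t)" "b - x = \<delta> * (1 + cos t)"
      by (simp_all add: x_def u_def b_def algebra_simps)
    have s: "sin t = sqrt (1 - cos t) * sqrt (1 + cos t)"
    proof -
      have "sqrt (1 - cos t) * sqrt (1 + cos t) = sqrt ((sin t)\<^sup>2)"
        unfolding sin_squared_eq by (simp add: power2_eq_square algebra_simps flip: real_sqrt_mult)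
      then show ?thesis using cb by simp
    qed
    \<comment> \<open>As 1 + x = \<delta> (1 - cos t), the numerator cancels the singularity of the
      density at -1, and the one-slit differential remains.\<close>
    have "1 / - sqrt ((b - x) * (1 - x)) * (\<delta> * sin t) = \<delta> * (- 1 + cos t) * (1 / sqrt ((1 - x) * (1 + x)))"
    proof -
      define s' where "s' = sqrt (1 - cos t)"
      have q: "1 - cos t = s' * s'" "s' > 0" using cb by (simp_all add: s'_def)
      have m: "\<delta> * (- 1 + cos t) = - (\<delta> * (1 - cos t))" by (simp add: algebra_simps)
      have "\<delta> * (- 1 + cos t) * (1 / sqrt ((1 - x) * (1 + x))) = - (\<delta> * (1 - cos t)) / (sqrt (1 - x) * (sqrt \<delta> * sqrt (1 - cos t)))"
        unfolding p m by (simp only: real_sqrt_mult times_divide_eq_right mult_1_right)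
      also have "\<dots> = - (\<delta> * sqrt (1 - cos t)) / (sqrt (1 - x) * sqrt \<delta>)"
        unfolding s'_def[symmetric] unfolding q(1) using q(2) by simp
      also have "\<dots> = 1 / - sqrt ((b - x) * (1 - x)) * (\<delta> * sin t)"
        unfolding p s using cb \<delta> x by (simp add: real_sqrt_mult)
      finally show ?thesis by simp
    qed
    also have "(1 - x) * (1 + x) = 1 - x\<^sup>2" by (simp add: power2_eq_square algebra_simps)
    finally have "Re (f (of_real x) * of_real (\<delta> * sin t * h)) = \<delta> * (- 1 + cos t) * arcsine_density x * h" for h
      unfolding fx arcsine_density_def
      by (simp only: of_real_mult[symmetric] Re_complex_of_real mult.assoc[symmetric])
    then have "(\<lambda>h. Re (f (of_real (u t)) * of_real (\<delta> * sin t * h))) = (\<lambda>h. \<delta> * (- 1 + cos t) * arcsine_density (u t) * h)"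
      by (simp only: x_def[symmetric])
    with has_derivative_compose[OF du g[OF u_notin[OF t]]] show ?thesis
      unfolding has_field_derivative_def u_def by (simp only:)
  qed
  have "\<exists>c. \<forall>t\<in>{0<..<pi}. g (of_real (u t)) - F t = c"
  proof (rule has_field_derivative_zero_constant)
    fix t assume "t \<in> {0<..<pi}"
    then have "((\<lambda>t. g (of_real (u t)) - F t) has_real_derivative 0) (at t)"
      using DERIV_diff[OF dgu dF, of t] by simp
    then show "((\<lambda>t. g (of_real (u t)) - F t) has_real_derivative 0) (at t within {0<..<pi})"
      by (rule DERIV_subset) simp
  qed simp
  then obtain c0 where c0: "\<And>t. 0 < t \<Longrightarrow> t < pi \<Longrightarrow> g (of_real (u t)) = F t + c0"
    by (auto simp: algebra_simps)
  have evpi: "eventually (\<lambda>t. 0 < t \<and> t < pi) (at_left pi)"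
    unfolding eventually_at_left_field by (intro exI[of _ 0]) auto
  have upi: "(u \<longlongrightarrow> b) (at_left pi)"
  proof -
    have "(u \<longlongrightarrow> \<delta> - 1 - \<delta> * cos pi) (at_left pi)" unfolding u_def by (intro tendsto_intros)
    then show ?thesis by (simp add: b_def)
  qed
  have "((\<lambda>t. g (of_real (u t))) \<longlongrightarrow> L) (at_left pi)"
    using b by (intro tendsto_real_path[OF L[of b] upi])
      (auto simp: K_def intro!: eventually_mono[OF evpi] dest: u_gap)
  moreover have "((\<lambda>t. g (of_real (u t))) \<longlongrightarrow> 0 + c0) (at_left pi)"
  proof -
    have "(F \<longlongrightarrow> F pi) (at pi within {pi / 2..pi})" using F(1) by (auto simp: continuous_on)
    then have "(F \<longlongrightarrow> F pi) (at_left pi)" by (simp add: at_within_Icc_at_left)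
    then have "((\<lambda>t. F t + c0) \<longlongrightarrow> F pi + c0) (at_left pi)" by (intro tendsto_intros)
    then show ?thesis unfolding F(2)
      by (rule Lim_transform_eventually) (use evpi c0 in \<open>auto elim!: eventually_mono\<close>)
  qed
  ultimately have "L = 0 + c0" using tendsto_unique trivial_limit_at_left_real by blast
  have L': "(g \<longlongrightarrow> c0) (at \<zeta> within - K)" if "\<zeta> \<in> K" for \<zeta>
    using that L \<open>L = 0 + c0\<close> by (auto simp: K_def)
  define P where "P w = 1 / slit_sqrt_at_infinity b 1 w" for w
  have "P field_differentiable at 0"
    unfolding P_def by (intro derivative_intros slit_sqrt_at_infinity_differentiable) auto
  then obtain D where D: "(P has_field_derivative D) (at 0)" by (auto simp: field_differentiable_def)
  have "eventually (\<lambda>z. f z = P (1 / z) / z) at_infinity"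
    unfolding eventually_at_infinity
  proof (intro exI[of _ 1] allI impI)
    fix z :: complex assume "1 \<le> norm z"
    then have "z \<noteq> 0" by auto
    then show "f z = P (1 / z) / z" by (simp add: f_def P_def slit_sqrt_eq_at_infinity)
  qed
  then have "is_green_fun K (\<lambda>z. if z \<in> K then 0 else g z - c0)"
    by (intro is_green_funI[OF K(1) f g D _ _ L']) (simp_all add: P_def)
  then have gf: "green_fun K = (\<lambda>z. if z \<in> K then 0 else g z - c0)"
    by (rule green_fun_eqI[OF K(2)])
  show "green_fun K (of_real (\<delta> - 1 - \<delta> * cos \<theta>)) = F \<theta>" if "0 < \<theta>" "\<theta> < pi" for \<theta>
    using u_notin[OF that] c0[OF that] unfolding gf by (simp add: u_def)
  show "green_fun K z = 0" if "z \<in> K" for z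
    using that by (simp add: gf)
qed

subsection \<open>The Green function in the gap\<close>

lemma arcsine_density_pos: "\<bar>t\<bar> < 1 \<Longrightarrow> arcsine_density t > 0"
  by (simp add: arcsine_density_def abs_square_less_1)

lemma DERIV_arcsine_density:
  assumes "\<bar>t\<bar> < 1"
  shows "(arcsine_density has_real_derivative t * arcsine_density t ^ 3) (at t)"
proof -
  define s where "s = sqrt (1 - t\<^sup>2)"
  have p: "1 - t\<^sup>2 > 0" using assms by (simp add: abs_square_less_1)
  then have s: "s > 0" by (simp add: s_def)
  have "((\<lambda>t. 1 / sqrt (1 - t\<^sup>2)) has_real_derivative - (- (2 * t) * (inverse s / 2)) / (s * s)) (at t)"
    unfolding s_def using p by (auto intro!: derivative_eq_intros)
  also have "- (- (2 * t) * (inverse s / 2)) / (s * s) = t * arcsine_density t ^ 3"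
    using s by (simp add: arcsine_density_def s_def[symmetric] field_simps power3_eq_cube)
  finally show ?thesis by (simp add: arcsine_density_def[abs_def])
qed

lemma continuous_on_arcsine_density [continuous_intros]:
  assumes "continuous_on S f" "\<And>x. x \<in> S \<Longrightarrow> \<bar>f x\<bar> < 1"
  shows "continuous_on S (\<lambda>x. arcsine_density (f x))"
proof -
  have "sqrt (1 - (f x)\<^sup>2) \<noteq> 0" if "x \<in> S" for x
    using abs_square_less_1[of "f x"] assms(2)[OF that] by simp
  then show ?thesis unfolding arcsine_density_def by (intro continuous_intros assms(1)) blast
qed

lemma DERIV_integral_upper:
  fixes h :: "real \<Rightarrow> real"
  assumes "continuous_on UNIV h" "0 < \<theta>"
  shows "((\<lambda>\<theta>. integral {0..\<theta>} h) has_real_derivative h \<theta>) (at \<theta>)"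
proof -
  have "((\<lambda>\<theta>. integral {0..\<theta>} h) has_real_derivative h \<theta>) (at \<theta> within {0..\<theta> + 1})"
    using assms by (intro integral_has_real_derivative continuous_on_subset[OF assms(1)]) auto
  then show ?thesis using assms(2) by (simp add: at_within_Icc_at)
qed

locale remez_gap =
  fixes \<delta> :: real
  assumes \<delta>: "0 < \<delta>" "\<delta> < 1"
begin

text \<open>All centres for which both slits are nondegenerate. The range extends beyond 0, so that
  \<alpha> = 0 is an interior point and has two-sided derivatives.\<close>

abbreviation "centers \<equiv> {\<delta> - 1<..<1 - \<delta>}"

lemma in_centers: "\<alpha> \<in> centers \<Longrightarrow> \<bar>\<alpha> - \<delta> * cos \<theta>\<bar> < 1"
proof -
  assume "\<alpha> \<in> centers"
  moreover have "\<bar>\<delta> * cos \<theta>\<bar> \<le> \<delta>" using \<delta> mult_left_le[of "\<bar>cos \<theta>\<bar>" \<delta>] by (simp add: abs_mult)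
  ultimately show ?thesis by (auto simp: abs_if split: if_splits)
qed

definition J :: "(real \<Rightarrow> real) \<Rightarrow> real \<Rightarrow> real \<Rightarrow> real" where
  "J \<psi> \<alpha> \<theta> = integral {0..\<theta>} (\<lambda>\<phi>. \<psi> \<phi> * arcsine_density (\<alpha> - \<delta> * cos \<phi>))"

text \<open>The partial derivative of J in its centre argument: t w(t)^3 is the derivative of the
  density w.\<close>

definition J' :: "(real \<Rightarrow> real) \<Rightarrow> real \<Rightarrow> real \<Rightarrow> real" where
  "J' \<psi> \<alpha> \<theta> = integral {0..\<theta>} (\<lambda>\<phi>. \<psi> \<phi> * ((\<alpha> - \<delta> * cos \<phi>) * arcsine_density (\<alpha> - \<delta> * cos \<phi>) ^ 3))"

lemma continuous_J_integrands:
  assumes "continuous_on UNIV \<psi>" "\<alpha> \<in> centers"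
  shows "continuous_on S (\<lambda>\<phi>. \<psi> \<phi> * arcsine_density (\<alpha> - \<delta> * cos \<phi>))"
    and "continuous_on S (\<lambda>\<phi>. \<psi> \<phi> * ((\<alpha> - \<delta> * cos \<phi>) * arcsine_density (\<alpha> - \<delta> * cos \<phi>) ^ 3))"
proof -
  have "continuous_on S \<psi>" using assms(1) continuous_on_subset by blast
  then show "continuous_on S (\<lambda>\<phi>. \<psi> \<phi> * arcsine_density (\<alpha> - \<delta> * cos \<phi>))"
    and "continuous_on S (\<lambda>\<phi>. \<psi> \<phi> * ((\<alpha> - \<delta> * cos \<phi>) * arcsine_density (\<alpha> - \<delta> * cos \<phi>) ^ 3))"
    by (intro continuous_intros in_centers assms(2); assumption)+
qed

lemma DERIV_J_upper:
  assumes "continuous_on UNIV \<psi>" "\<alpha> \<in> centers" "0 < \<theta>"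
  shows "(J \<psi> \<alpha> has_real_derivative \<psi> \<theta> * arcsine_density (\<alpha> - \<delta> * cos \<theta>)) (at \<theta>)"
    and "(J' \<psi> \<alpha> has_real_derivative \<psi> \<theta> * ((\<alpha> - \<delta> * cos \<theta>) * arcsine_density (\<alpha> - \<delta> * cos \<theta>) ^ 3)) (at \<theta>)"
  unfolding J_def[abs_def] J'_def[abs_def]
  by (rule DERIV_integral_upper; use assms continuous_J_integrands in blast)+

lemma continuous_on_J_upper:
  assumes "continuous_on UNIV \<psi>" "\<alpha> \<in> centers"
  shows "continuous_on {0..b} (J \<psi> \<alpha>)"
  unfolding J_def[abs_def]
  by (intro indefinite_integral_continuous_1 integrable_continuous_real continuous_J_integrands assms)

lemma DERIV_J_param:
  assumes \<psi>: "continuous_on UNIV \<psi>" and \<alpha>: "\<alpha> \<in> centers"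
  shows "((\<lambda>\<alpha>. J \<psi> \<alpha> \<theta>) has_real_derivative J' \<psi> \<alpha> \<theta>) (at \<alpha>)"
proof -
  have "((\<lambda>\<alpha>. J \<psi> \<alpha> \<theta>) has_real_derivative J' \<psi> \<alpha> \<theta>) (at \<alpha> within centers)"
    unfolding J_def J'_def cbox_interval[symmetric]
  proof (rule leibniz_rule_field_derivative)
    fix a t assume a: "a \<in> centers"
    have "((\<lambda>a. a - \<delta> * cos t) has_real_derivative 1) (at a within centers)"
      by (auto intro!: derivative_eq_intros)
    from DERIV_cmult[where c = "\<psi> t", OF DERIV_chain2[where g = "\<lambda>a. a - \<delta> * cos t", OF DERIV_arcsine_density[OF in_centers[OF a]] this]]
    show "((\<lambda>a. \<psi> t * arcsine_density (a - \<delta> * cos t)) has_real_derivative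
        \<psi> t * ((a - \<delta> * cos t) * arcsine_density (a - \<delta> * cos t) ^ 3)) (at a within centers)"
      by simp
  next
    show "continuous_on (centers \<times> cbox 0 \<theta>) (\<lambda>(a, t). \<psi> t * ((a - \<delta> * cos t) * arcsine_density (a - \<delta> * cos t) ^ 3))"
      unfolding split_beta
      by (intro continuous_intros continuous_on_compose2[OF \<psi>]) (auto intro: in_centers)
  next
    fix a assume "a \<in> centers"
    then show "(\<lambda>t. \<psi> t * arcsine_density (a - \<delta> * cos t)) integrable_on cbox 0 \<theta>"
      by (rule integrable_continuous[OF continuous_J_integrands(1)[OF \<psi>]])
  qed (rule \<alpha>, rule convex_real_interval)
  then show ?thesis by (simp only: at_within_open[OF \<alpha> open_greaterThanLessThan])
qed

text \<open>The chain rule along a curve in the (\<alpha>, \<theta>) plane. Total differentiability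
  of J comes from its two partial derivatives and the joint continuity of the one in \<theta>, the
  integrand.\<close>

lemma DERIV_J_path:
  assumes \<psi>: "continuous_on UNIV \<psi>" and \<alpha>: "\<alpha> \<in> centers"
    and \<Theta>: "(\<Theta> has_real_derivative d) (at \<alpha>)" "0 < \<Theta> \<alpha>"
  shows "((\<lambda>a. J \<psi> a (\<Theta> a)) has_real_derivative
     J' \<psi> \<alpha> (\<Theta> \<alpha>) + \<psi> (\<Theta> \<alpha>) * arcsine_density (\<alpha> - \<delta> * cos (\<Theta> \<alpha>)) * d) (at \<alpha>)"
proof -
  define h where "h a t = \<psi> t * arcsine_density (a - \<delta> * cos t)" for a t
  have "continuous_on (centers \<times> {0<..}) (\<lambda>z. h (fst z) (snd z))"
    unfolding h_def by (intro continuous_intros continuous_on_compose2[OF \<psi>]) (auto intro: in_centers)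
  then have ch: "continuous (at (\<alpha>, \<Theta> \<alpha>) within centers \<times> {0<..}) (\<lambda>z. h (fst z) (snd z))"
    using \<alpha> \<Theta>(2) by (auto simp: continuous_on_eq_continuous_within)
  have "((\<lambda>(a, t). J \<psi> a t) has_derivative
      (\<lambda>(x, y). J' \<psi> \<alpha> (\<Theta> \<alpha>) * x + blinfun_mult_right (h \<alpha> (\<Theta> \<alpha>)) y)) (at (\<alpha>, \<Theta> \<alpha>) within centers \<times> {0<..})"
  proof (rule has_derivative_partialsI)
    show "((\<lambda>a. J \<psi> a (\<Theta> \<alpha>)) has_derivative (*) (J' \<psi> \<alpha> (\<Theta> \<alpha>))) (at \<alpha> within centers)"
      using DERIV_J_param[OF \<psi> \<alpha>, of "\<Theta> \<alpha>"]
      by (auto simp: has_field_derivative_def intro: has_derivative_at_withinI)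
    fix a t assume "a \<in> centers" "t \<in> {0::real<..}"
    then show "(J \<psi> a has_derivative blinfun_apply (blinfun_mult_right (h a t))) (at t within {0<..})"
      using DERIV_J_upper(1)[OF \<psi>, of a t]
      by (auto simp: has_field_derivative_def h_def intro: has_derivative_at_withinI)
  next
    show "continuous (at (\<alpha>, \<Theta> \<alpha>) within centers \<times> {0<..}) (\<lambda>(a, t). blinfun_mult_right (h a t))"
      unfolding split_beta by (intro continuous_intros bounded_linear.continuous[OF bounded_linear_blinfun_mult_right] ch)
  qed (use \<Theta> in auto)
  then have "((\<lambda>(a, t). J \<psi> a t) has_derivative
      (\<lambda>(x, y). J' \<psi> \<alpha> (\<Theta> \<alpha>) * x + h \<alpha> (\<Theta> \<alpha>) * y)) (at (\<alpha>, \<Theta> \<alpha>))"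
    using \<alpha> \<Theta>(2) by (subst (asm) at_within_open) (auto intro!: open_Times)
  from has_derivative_compose[OF has_derivative_Pair[OF has_derivative_ident \<Theta>(1)[unfolded has_field_derivative_def]] this]
  have "((\<lambda>a. J \<psi> a (\<Theta> a)) has_derivative (\<lambda>x. J' \<psi> \<alpha> (\<Theta> \<alpha>) * x + h \<alpha> (\<Theta> \<alpha>) * (d * x))) (at \<alpha>)"
    by simp
  then show ?thesis
    unfolding has_field_derivative_def
    by (rule has_derivative_eq_rhs) (auto simp: h_def fun_eq_iff algebra_simps)
qed

text \<open>\<open>\<gamma> \<alpha>\<close> places the critical point \<open>\<alpha> + \<delta> \<gamma> \<alpha>\<close> of the Green function in the gap.\<close>

definition \<gamma> :: "real \<Rightarrow> real" where "\<gamma> \<alpha> = - J cos \<alpha> pi / J (\<lambda>_. 1) \<alpha> pi"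

definition \<gamma>' :: "real \<Rightarrow> real" where
  "\<gamma>' \<alpha> = (J cos \<alpha> pi * J' (\<lambda>_. 1) \<alpha> pi - J' cos \<alpha> pi * J (\<lambda>_. 1) \<alpha> pi) / (J (\<lambda>_. 1) \<alpha> pi)\<^sup>2"

lemma continuous_on_one: "continuous_on UNIV (\<lambda>_. 1 :: real)" and continuous_on_cosine: "continuous_on UNIV (cos :: real \<Rightarrow> real)"
  by (auto intro!: continuous_intros)

lemma J_one_pos:
  assumes "\<alpha> \<in> centers"
  shows "J (\<lambda>_. 1) \<alpha> pi > 0"
proof -
  have "J (\<lambda>_. 1) \<alpha> 0 < J (\<lambda>_. 1) \<alpha> pi"
  proof (rule DERIV_pos_imp_increasing_open[OF pi_gt_zero])
    fix t :: real assume "0 < t" "t < pi"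
    then show "\<exists>y. (J (\<lambda>_. 1) \<alpha> has_real_derivative y) (at t) \<and> 0 < y"
      using DERIV_J_upper(1)[OF continuous_on_one assms, of t] arcsine_density_pos[OF in_centers[OF assms, of t]] by auto
  qed (rule continuous_on_J_upper[OF continuous_on_one assms])
  then show ?thesis by (simp add: J_def)
qed

lemma DERIV_gamma:
  assumes "\<alpha> \<in> centers"
  shows "(\<gamma> has_real_derivative \<gamma>' \<alpha>) (at \<alpha>)"
  unfolding \<gamma>_def[abs_def] \<gamma>'_def using J_one_pos[OF assms]
  by (auto intro!: derivative_eq_intros DERIV_J_param assms continuous_on_one continuous_on_cosine simp: power2_eq_square diff_divide_distrib)

text \<open>\<open>F \<alpha> \<theta>\<close> is the value of the Green function at the point \<open>\<alpha> - \<delta> cos \<theta>\<close> of the gap; this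
  parametrization removes the singularities of its derivative at the ends of the gap.\<close>

definition F :: "real \<Rightarrow> real \<Rightarrow> real" where
  "F \<alpha> \<theta> = \<delta> * (\<gamma> \<alpha> * J (\<lambda>_. 1) \<alpha> \<theta> + J cos \<alpha> \<theta>)"

lemma F_0 [simp]: "F \<alpha> 0 = 0"
  by (simp add: F_def J_def)

lemma F_pi: "\<alpha> \<in> centers \<Longrightarrow> F \<alpha> pi = 0"
  using J_one_pos[of \<alpha>] by (simp add: F_def \<gamma>_def)

lemma DERIV_F_upper:
  assumes "\<alpha> \<in> centers" "0 < \<theta>"
  shows "(F \<alpha> has_real_derivative \<delta> * (\<gamma> \<alpha> + cos \<theta>) * arcsine_density (\<alpha> - \<delta> * cos \<theta>)) (at \<theta>)"
  unfolding F_def[abs_def]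
  by (auto intro!: derivative_eq_intros DERIV_J_upper assms continuous_on_one continuous_on_cosine simp: algebra_simps)

lemma continuous_on_F_upper: "\<alpha> \<in> centers \<Longrightarrow> continuous_on {0..b} (F \<alpha>)"
  unfolding F_def[abs_def]
  by (intro continuous_intros continuous_on_J_upper continuous_on_one continuous_on_cosine)

text \<open>The number -\<gamma> \<alpha> is a weighted mean of cos over [0, pi] with a positive
  weight, and 1 + cos and 1 - cos are positive inside the interval.\<close>

lemma gamma_bounds:
  assumes \<alpha>: "\<alpha> \<in> centers"
  shows "-1 < \<gamma> \<alpha>" "\<gamma> \<alpha> < 1"
proof -
  have *: "0 < J (\<lambda>_. 1) \<alpha> pi + c * J cos \<alpha> pi" if c: "c = 1 \<or> c = -1" for c
  proof -
    have "J (\<lambda>_. 1) \<alpha> 0 + c * J cos \<alpha> 0 < J (\<lambda>_. 1) \<alpha> pi + c * J cos \<alpha> pi"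
    proof (rule DERIV_pos_imp_increasing_open[OF pi_gt_zero])
      fix t :: real assume t: "0 < t" "t < pi"
      have "((\<lambda>t. J (\<lambda>_. 1) \<alpha> t + c * J cos \<alpha> t) has_real_derivative (1 + c * cos t) * arcsine_density (\<alpha> - \<delta> * cos t)) (at t)"
        using t by (auto intro!: derivative_eq_intros DERIV_J_upper \<alpha> continuous_on_one continuous_on_cosine simp: algebra_simps)
      moreover have "(1 + c * cos t) * arcsine_density (\<alpha> - \<delta> * cos t) > 0"
        using c cos_sin_bounds[OF t] arcsine_density_pos[OF in_centers[OF \<alpha>, of t]] by auto
      ultimately show "\<exists>y. ((\<lambda>t. J (\<lambda>_. 1) \<alpha> t + c * J cos \<alpha> t) has_real_derivative y) (at t) \<and> 0 < y" by blast
    qed (intro continuous_intros continuous_on_J_upper continuous_on_one continuous_on_cosine \<alpha>)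
    then show ?thesis by (simp add: J_def)
  qed
  from *[of 1] *[of "-1"] show "-1 < \<gamma> \<alpha>" "\<gamma> \<alpha> < 1"
    using J_one_pos[OF \<alpha>] by (auto simp: \<gamma>_def field_simps)
qed

text \<open>Chebyshev's argument: the logarithmic derivative \<open>t / (1 - t\<^sup>2)\<close> of the density increases with
  \<open>t = \<alpha> - \<delta> cos \<phi>\<close>, whereas \<open>cos \<phi>\<close> decreases.\<close>

lemma gamma'_nonneg:
  assumes \<alpha>: "\<alpha> \<in> centers"
  shows "\<gamma>' \<alpha> \<ge> 0"
proof -
  define A B where "A = J cos \<alpha> pi" and "B = J (\<lambda>_. 1) \<alpha> pi"
  have B: "B > 0" using J_one_pos[OF \<alpha>] by (simp add: B_def)
  \<comment> \<open>The weighted mean of cos, that is, -\<gamma> \<alpha>; the function \<rho> below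
    is the logarithmic derivative of the density.\<close>
  define \<kappa> where "\<kappa> = A / B"
  have \<kappa>: "\<bar>\<kappa>\<bar> < 1" using gamma_bounds[OF \<alpha>] by (auto simp: \<kappa>_def \<gamma>_def A_def B_def)
  define \<rho> where "\<rho> t = t * (arcsine_density t)\<^sup>2" for t
  have \<rho>: "\<rho> s \<le> \<rho> t" if "s \<le> t" "\<bar>s\<bar> < 1" "\<bar>t\<bar> < 1" for s t
  proof -
    have r: "\<rho> x = x / (1 - x\<^sup>2)" "1 - x\<^sup>2 > 0" if "\<bar>x\<bar> < 1" for x
      using abs_square_less_1[of x] that by (simp_all add: \<rho>_def arcsine_density_def power_divide)
    have "\<bar>s * t\<bar> < 1 * 1" unfolding abs_mult using that by (intro mult_strict_mono') auto
    then have "(t - s) * (1 + s * t) \<ge> 0" using that by (intro mult_nonneg_nonneg) auto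
    also have "(t - s) * (1 + s * t) = t * (1 - s\<^sup>2) - s * (1 - t\<^sup>2)" by (simp add: power2_eq_square algebra_simps)
    finally have "s * (1 - t\<^sup>2) \<le> t * (1 - s\<^sup>2)" by simp
    then show ?thesis unfolding r(1)[OF that(2)] r(1)[OF that(3)]
      using r(2)[OF that(2)] r(2)[OF that(3)] by (simp only: pos_divide_le_eq pos_le_divide_eq times_divide_eq_left)
  qed
  define t0 where "t0 = \<alpha> - \<delta> * \<kappa>"
  have t0: "\<bar>t0\<bar> < 1" using in_centers[OF \<alpha>, of "arccos \<kappa>"] \<kappa> by (simp add: t0_def)
  have "J' cos \<alpha> pi - \<kappa> * J' (\<lambda>_. 1) \<alpha> pi = integral {0..pi} (\<lambda>\<phi>. (cos \<phi> - \<kappa>) * ((\<alpha> - \<delta> * cos \<phi>) * arcsine_density (\<alpha> - \<delta> * cos \<phi>) ^ 3))"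
    unfolding J'_def left_diff_distrib mult.assoc integral_mult_right[symmetric]
    by (subst integral_diff)
      (auto intro!: integrable_continuous_real continuous_intros in_centers[OF \<alpha>])
  also have "\<dots> \<le> integral {0..pi} (\<lambda>\<phi>. \<rho> t0 * ((cos \<phi> - \<kappa>) * arcsine_density (\<alpha> - \<delta> * cos \<phi>)))"
  proof (rule integral_le)
    fix \<phi>
    define t where "t = \<alpha> - \<delta> * cos \<phi>"
    have t: "\<bar>t\<bar> < 1" using in_centers[OF \<alpha>] by (simp add: t_def)
    have "(cos \<phi> - \<kappa>) * \<rho> t \<le> (cos \<phi> - \<kappa>) * \<rho> t0"
    proof (cases "cos \<phi> \<ge> \<kappa>")
      case True
      then have "t \<le> t0" using \<delta> by (simp add: t_def t0_def)
      with True show ?thesis using \<rho>[OF _ t t0] by (intro mult_left_mono) auto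
    next
      case False
      then have "t0 \<le> t" using \<delta> by (simp add: t_def t0_def)
      with False show ?thesis using \<rho>[OF _ t0 t] by (intro mult_left_mono_neg) auto
    qed
    then have "(cos \<phi> - \<kappa>) * \<rho> t * arcsine_density t \<le> (cos \<phi> - \<kappa>) * \<rho> t0 * arcsine_density t"
      using arcsine_density_pos[OF t] by (intro mult_right_mono) auto
    then show "(cos \<phi> - \<kappa>) * ((\<alpha> - \<delta> * cos \<phi>) * arcsine_density (\<alpha> - \<delta> * cos \<phi>) ^ 3) \<le> \<rho> t0 * ((cos \<phi> - \<kappa>) * arcsine_density (\<alpha> - \<delta> * cos \<phi>))"
      unfolding t_def[symmetric] \<rho>_def[of t] by (simp add: power3_eq_cube power2_eq_square algebra_simps)
  qed (auto intro!: integrable_continuous_real continuous_intros in_centers[OF \<alpha>])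
  also have "\<dots> = \<rho> t0 * (A - \<kappa> * B)"
    unfolding A_def B_def J_def integral_mult_right left_diff_distrib
    by (subst integral_diff)
      (auto intro!: integrable_continuous_real continuous_intros in_centers[OF \<alpha>])
  also have "A - \<kappa> * B = 0" using B by (simp add: \<kappa>_def)
  finally have "J' cos \<alpha> pi \<le> A / B * J' (\<lambda>_. 1) \<alpha> pi" by (simp add: \<kappa>_def)
  then have "J' cos \<alpha> pi * B \<le> A * J' (\<lambda>_. 1) \<alpha> pi" using B by (simp add: field_simps)
  then show ?thesis by (simp add: \<gamma>'_def A_def B_def)
qed

end

subsection \<open>Dependence on the centre of the gap\<close>

text \<open>The moving limit is carried into the integrand by the affine substitution onto [0, 1];
  the factor d - \<theta> x covers the degenerate case \<theta> x = d.\<close>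

lemma continuous_on_integral_lower:
  fixes h :: "'a::topological_space \<Rightarrow> real \<Rightarrow> real"
  assumes h: "continuous_on (X \<times> {c..d}) (\<lambda>(x, t). h x t)"
    and \<theta>: "continuous_on X \<theta>" "\<And>x. x \<in> X \<Longrightarrow> \<theta> x \<in> {c..d}"
  shows "continuous_on X (\<lambda>x. integral {\<theta> x..d} (h x))"
proof -
  have mem: "\<theta> x + (d - \<theta> x) * s \<in> {c..d}" if "x \<in> X" "s \<in> {0..1}" for x s
  proof -
    have "0 \<le> (d - \<theta> x) * s" "(d - \<theta> x) * s \<le> d - \<theta> x"
      using that \<theta>(2)[OF that(1)] by (auto intro: mult_left_le)
    then show ?thesis using \<theta>(2)[OF that(1)] by auto
  qed
  have eq: "(d - \<theta> x) * integral {0..1} (\<lambda>s. h x (\<theta> x + (d - \<theta> x) * s)) = integral {\<theta> x..d} (h x)"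
    if x: "x \<in> X" for x
  proof (cases "\<theta> x = d")
    case False
    then have m: "d - \<theta> x > 0" using \<theta>(2)[OF x] by auto
    have "continuous_on {\<theta> x..d} (\<lambda>t. case (x, t) of (x, t) \<Rightarrow> h x t)"
      by (rule continuous_on_compose2[OF h]) (use x \<theta>(2)[OF x] in \<open>auto intro!: continuous_intros\<close>)
    then have "(h x has_integral integral {\<theta> x..d} (h x)) (cbox (\<theta> x) d)"
      by (simp add: integrable_integral integrable_continuous_real)
    from has_integral_affinity'[OF this m, of "\<theta> x"] m
    have "((\<lambda>s. h x ((d - \<theta> x) * s + \<theta> x)) has_integral integral {\<theta> x..d} (h x) / (d - \<theta> x)) {0..1}"
      by (simp add: field_simps)
    from integral_unique[OF this] show ?thesis using m by (simp add: add.commute)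
  qed simp
  have "continuous_on X (\<lambda>x. (d - \<theta> x) * integral (cbox 0 1) (\<lambda>s. h x (\<theta> x + (d - \<theta> x) * s)))"
  proof (intro continuous_intros \<theta>(1) integral_continuous_on_param)
    have *: "continuous_on (X \<times> cbox 0 1) (\<lambda>z. \<theta> (fst z))"
      by (rule continuous_on_compose2[OF \<theta>(1)]) (auto intro!: continuous_intros)
    have "continuous_on (X \<times> cbox 0 1) (\<lambda>z. (fst z, \<theta> (fst z) + (d - \<theta> (fst z)) * snd z))"
      by (intro continuous_intros *)
    from continuous_on_compose2[OF h this]
    show "continuous_on (X \<times> cbox 0 1) (\<lambda>(x, s). h x (\<theta> x + (d - \<theta> x) * s))"
      using mem by (force simp: split_beta)
  qed
  then show ?thesis
    by (rule continuous_on_eq) (simp add: eq)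
qed

lemma one_minus_cos_le: "1 - cos x \<le> x\<^sup>2 / 2" for x :: real
proof -
  have "1 - cos x = 2 * (sin (x / 2))\<^sup>2" using cos_double_sin[of "x / 2"] by simp
  also have "(sin (x / 2))\<^sup>2 \<le> (x / 2)\<^sup>2" using abs_sin_x_le_abs_x[of "x / 2"] by (simp only: abs_le_square_iff)
  finally show ?thesis by (simp add: power_divide)
qed

text \<open>With \<Phi> the integral from 0, the function \<Phi> (pi - t) + s \<Phi> t has
  derivative 0 on the first half. The case s = -1 is the odd one, where the integral vanishes, and s
  = 1 the even one, where it doubles.\<close>

lemma integral_reflect_pi:
  fixes h :: "real \<Rightarrow> real"
  assumes h: "continuous_on UNIV h" and sym: "\<And>x. h (pi - x) = s * h x"
  shows "integral {0..pi} h = (1 + s) * integral {0..pi / 2} h"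
proof -
  define \<Phi> where "\<Phi> t = integral {0..t} h" for t
  have \<Phi>: "(\<Phi> has_real_derivative h t) (at t)" if "t > 0" for t
    unfolding \<Phi>_def[abs_def] by (rule DERIV_integral_upper[OF h that])
  have c: "continuous_on {0..pi} \<Phi>" unfolding \<Phi>_def
    by (intro indefinite_integral_continuous_1 integrable_continuous_real continuous_on_subset[OF h]) auto
  have "\<Phi> (pi - pi / 2) + s * \<Phi> (pi / 2) = \<Phi> (pi - 0) + s * \<Phi> 0"
  proof (rule DERIV_isconst_end[where f = "\<lambda>t. \<Phi> (pi - t) + s * \<Phi> t"])
    show "continuous_on {0..pi / 2} (\<lambda>t. \<Phi> (pi - t) + s * \<Phi> t)"
      by (intro continuous_intros continuous_on_compose2[OF c]) auto
    fix t :: real assume t: "0 < t" "t < pi / 2"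
    have "((\<lambda>t. \<Phi> (pi - t)) has_real_derivative h (pi - t) * - 1) (at t)"
      by (rule DERIV_chain2[OF \<Phi>]) (use t in \<open>auto intro!: derivative_eq_intros\<close>)
    from DERIV_add[OF this DERIV_cmult[OF \<Phi>[OF t(1)], of s]]
    show "((\<lambda>t. \<Phi> (pi - t) + s * \<Phi> t) has_real_derivative 0) (at t)"
      by (simp add: sym)
  qed simp
  then show ?thesis by (simp add: \<Phi>_def algebra_simps)
qed

context remez_gap
begin

text \<open>The derivative of the Green function in \<open>\<alpha>\<close> with \<open>x = \<alpha> - \<delta> cos \<theta>\<close> held fixed, so that
  \<open>d\<theta>/d\<alpha> = - 1 / (\<delta> sin \<theta>)\<close>.\<close>

definition D :: "real \<Rightarrow> real \<Rightarrow> real" where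
  "D \<alpha> \<theta> = \<delta> * (\<gamma>' \<alpha> * J (\<lambda>_. 1) \<alpha> \<theta> + \<gamma> \<alpha> * J' (\<lambda>_. 1) \<alpha> \<theta> + J' cos \<alpha> \<theta>)
     - (\<gamma> \<alpha> + cos \<theta>) * arcsine_density (\<alpha> - \<delta> * cos \<theta>) / sin \<theta>"

lemma DERIV_F_center:
  assumes \<alpha>: "\<alpha> \<in> centers" and x: "\<bar>\<alpha> - x\<bar> < \<delta>"
  shows "((\<lambda>a. F a (arccos ((a - x) / \<delta>))) has_real_derivative D \<alpha> (arccos ((\<alpha> - x) / \<delta>))) (at \<alpha>)"
proof -
  define y where "y = (\<alpha> - x) / \<delta>"
  have y: "-1 < y" "y < 1" using x \<delta> by (auto simp: y_def field_simps)
  define \<theta> where "\<theta> = arccos y"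
  have \<theta>: "0 < \<theta>" "\<theta> < pi" "cos \<theta> = y" using arccos_lt_bounded[OF y] y by (auto simp: \<theta>_def)
  have s: "sin \<theta> = sqrt (1 - y\<^sup>2)" "sin \<theta> > 0"
    using sin_arccos_abs[of y] y cos_sin_bounds[OF \<theta>(1,2)] by (auto simp: \<theta>_def)
  have "((\<lambda>a. arccos ((a - x) / \<delta>)) has_real_derivative inverse (- sqrt (1 - y\<^sup>2)) * (1 / \<delta>)) (at \<alpha>)"
    by (rule DERIV_chain2[where f = arccos and g = "\<lambda>a. (a - x) / \<delta>"])
      (use DERIV_arccos[OF y] \<delta> in \<open>auto intro!: derivative_eq_intros simp: y_def\<close>)
  then have d: "((\<lambda>a. arccos ((a - x) / \<delta>)) has_real_derivative - (1 / (\<delta> * sin \<theta>))) (at \<alpha>)"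
    by (rule DERIV_cong) (use s \<delta> in \<open>simp add: field_simps\<close>)
  have J1: "((\<lambda>a. J \<psi> a (arccos ((a - x) / \<delta>))) has_real_derivative
     J' \<psi> \<alpha> \<theta> + \<psi> \<theta> * arcsine_density (\<alpha> - \<delta> * cos \<theta>) * - (1 / (\<delta> * sin \<theta>))) (at \<alpha>)"
    if "continuous_on UNIV \<psi>" for \<psi>
    using DERIV_J_path[OF that \<alpha> d] \<theta> by (simp add: \<theta>_def y_def)
  have "((\<lambda>a. \<delta> * (\<gamma> a * J (\<lambda>_. 1) a (arccos ((a - x) / \<delta>)) + J cos a (arccos ((a - x) / \<delta>)))) has_real_derivative
    \<delta> * (\<gamma>' \<alpha> * J (\<lambda>_. 1) \<alpha> \<theta> + (J' (\<lambda>_. 1) \<alpha> \<theta> + 1 * arcsine_density (\<alpha> - \<delta> * cos \<theta>) * - (1 / (\<delta> * sin \<theta>))) * \<gamma> \<alpha>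
      + (J' cos \<alpha> \<theta> + cos \<theta> * arcsine_density (\<alpha> - \<delta> * cos \<theta>) * - (1 / (\<delta> * sin \<theta>))))) (at \<alpha>)"
    using DERIV_cmult[OF DERIV_add[OF DERIV_mult[OF DERIV_gamma[OF \<alpha>] J1[OF continuous_on_one]] J1[OF continuous_on_cosine]], of \<delta>]
    by (simp add: \<theta>_def y_def)
  then have "((\<lambda>a. F a (arccos ((a - x) / \<delta>))) has_real_derivative
    \<delta> * (\<gamma>' \<alpha> * J (\<lambda>_. 1) \<alpha> \<theta> + (J' (\<lambda>_. 1) \<alpha> \<theta> + 1 * arcsine_density (\<alpha> - \<delta> * cos \<theta>) * - (1 / (\<delta> * sin \<theta>))) * \<gamma> \<alpha>
      + (J' cos \<alpha> \<theta> + cos \<theta> * arcsine_density (\<alpha> - \<delta> * cos \<theta>) * - (1 / (\<delta> * sin \<theta>))))) (at \<alpha>)"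
    unfolding F_def .
  then have "((\<lambda>a. F a (arccos ((a - x) / \<delta>))) has_real_derivative D \<alpha> \<theta>) (at \<alpha>)"
    by (rule DERIV_cong) (use s(2) \<delta> in \<open>simp add: D_def field_simps\<close>)
  then show ?thesis by (simp add: \<theta>_def y_def)
qed

lemma D_strict_mono:
  assumes \<alpha>: "\<alpha> \<in> centers" and \<theta>: "0 < \<theta>1" "\<theta>1 < \<theta>2" "\<theta>2 < pi"
  shows "D \<alpha> \<theta>1 < D \<alpha> \<theta>2"
proof (rule DERIV_pos_imp_increasing[OF \<theta>(2)])
  fix t assume "\<theta>1 \<le> t" "t \<le> \<theta>2"
  then have t: "0 < t" "t < pi" using \<theta> by auto
  define w where "w = arcsine_density (\<alpha> - \<delta> * cos t)"
  have w: "w > 0" using arcsine_density_pos[OF in_centers[OF \<alpha>]] by (simp add: w_def)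
  define w' where "w' = (\<alpha> - \<delta> * cos t) * w ^ 3"
  have s: "sin t > 0" using cos_sin_bounds[OF t] by simp
  have "((\<lambda>\<theta>. \<alpha> - \<delta> * cos \<theta>) has_real_derivative \<delta> * sin t) (at t)"
    by (auto intro!: derivative_eq_intros)
  from DERIV_chain2[where g = "\<lambda>\<theta>. \<alpha> - \<delta> * cos \<theta>", OF DERIV_arcsine_density[OF in_centers[OF \<alpha>]] this]
  have dw: "((\<lambda>\<theta>. arcsine_density (\<alpha> - \<delta> * cos \<theta>)) has_real_derivative w' * (\<delta> * sin t)) (at t)"
    by (simp add: w'_def w_def)
  have dg: "((\<lambda>\<theta>. \<gamma> \<alpha> + cos \<theta>) has_real_derivative - sin t) (at t)"
    by (auto intro!: derivative_eq_intros)
  have 1: "((\<lambda>\<theta>. (\<gamma> \<alpha> + cos \<theta>) * arcsine_density (\<alpha> - \<delta> * cos \<theta>) / sin \<theta>) has_real_derivative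
    ((- sin t * w + w' * (\<delta> * sin t) * (\<gamma> \<alpha> + cos t)) * sin t - (\<gamma> \<alpha> + cos t) * w * cos t) / (sin t * sin t)) (at t)"
    using DERIV_divide[OF DERIV_mult[OF dg dw] DERIV_sin] s by (simp add: w_def)
  have 2: "((\<lambda>\<theta>. \<delta> * (\<gamma>' \<alpha> * J (\<lambda>_. 1) \<alpha> \<theta> + \<gamma> \<alpha> * J' (\<lambda>_. 1) \<alpha> \<theta> + J' cos \<alpha> \<theta>)) has_real_derivative
      \<delta> * (\<gamma>' \<alpha> * w + \<gamma> \<alpha> * w' + cos t * w')) (at t)"
    using DERIV_cmult[OF DERIV_add[OF DERIV_add[OF DERIV_cmult[OF DERIV_J_upper(1)[OF continuous_on_one \<alpha> t(1)], of "\<gamma>' \<alpha>"]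
       DERIV_cmult[OF DERIV_J_upper(2)[OF continuous_on_one \<alpha> t(1)], of "\<gamma> \<alpha>"]] DERIV_J_upper(2)[OF continuous_on_cosine \<alpha> t(1)]], of \<delta>]
    by (simp add: w_def w'_def)
  \<comment> \<open>All terms in w', the derivative of the density, cancel. What is left is positive
    by \<open>gamma'_nonneg\<close> and because the product of \<gamma> \<alpha> and cos t has
    modulus below 1.\<close>
  have alg: "\<delta> * (g' * w + g * w' + c * w') - ((- s * w + w' * (\<delta> * s) * (g + c)) * s - (g + c) * w * c) / (s * s)
    = w * (\<delta> * g' * s\<^sup>2 + (s\<^sup>2 + c\<^sup>2) + g * c) / s\<^sup>2" if "s > 0" for s c g g' :: real
    using that by (simp add: power2_eq_square field_simps)
  have "\<delta> * (\<gamma>' \<alpha> * w + \<gamma> \<alpha> * w' + cos t * w') -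
    ((- sin t * w + w' * (\<delta> * sin t) * (\<gamma> \<alpha> + cos t)) * sin t - (\<gamma> \<alpha> + cos t) * w * cos t) / (sin t * sin t)
    = w * (\<delta> * \<gamma>' \<alpha> * (sin t)\<^sup>2 + ((sin t)\<^sup>2 + (cos t)\<^sup>2) + \<gamma> \<alpha> * cos t) / (sin t)\<^sup>2"
    by (rule alg[OF s])
  also have "\<dots> > 0"
  proof -
    have "\<bar>\<gamma> \<alpha> * cos t\<bar> < 1 * 1"
      unfolding abs_mult using gamma_bounds[OF \<alpha>] cos_sin_bounds[OF t] by (intro mult_strict_mono') auto
    moreover have "\<delta> * \<gamma>' \<alpha> * (sin t)\<^sup>2 \<ge> 0" using \<delta> gamma'_nonneg[OF \<alpha>] by simp
    ultimately show ?thesis using w s by (intro divide_pos_pos mult_pos_pos) auto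
  qed
  finally show "\<exists>y. (D \<alpha> has_real_derivative y) (at t) \<and> 0 < y"
    using DERIV_diff[OF 2 1] unfolding D_def[abs_def] by blast
qed

lemma arcsine_density_minus: "arcsine_density (- t) = arcsine_density t"
  by (simp add: arcsine_density_def)

text \<open>For \<open>\<alpha> = 0\<close> the set is symmetric about \<open>0\<close>, which makes the Green function at \<open>0\<close> stationary.\<close>

lemma D_0_pi_half: "D 0 (pi / 2) = 0"
proof -
  have 0: "0 \<in> centers" using \<delta> by auto
  have A: "J cos 0 pi = 0"
    unfolding J_def
    by (subst integral_reflect_pi[where s = "-1"])
      (use continuous_J_integrands(1)[OF continuous_on_cosine 0] in \<open>auto simp: arcsine_density_minus\<close>)
  then have \<gamma>0: "\<gamma> 0 = 0" by (simp add: \<gamma>_def)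
  have B: "J (\<lambda>_. 1) 0 pi = 2 * J (\<lambda>_. 1) 0 (pi / 2)"
    unfolding J_def
    by (subst integral_reflect_pi[where s = "1"])
      (use continuous_J_integrands(1)[OF continuous_on_one 0] in \<open>auto simp: arcsine_density_minus\<close>)
  have C: "J' cos 0 pi = 2 * J' cos 0 (pi / 2)"
    unfolding J'_def
    by (subst integral_reflect_pi[where s = "1"])
      (use continuous_J_integrands(2)[OF continuous_on_cosine 0] in \<open>auto simp: arcsine_density_minus\<close>)
  have "\<gamma>' 0 * J (\<lambda>_. 1) 0 pi + J' cos 0 pi = 0"
    using J_one_pos[OF 0] by (simp add: \<gamma>'_def A power2_eq_square)
  then have "\<gamma>' 0 * J (\<lambda>_. 1) 0 (pi / 2) + J' cos 0 (pi / 2) = 0" unfolding B C by simp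
  then show ?thesis by (simp add: D_def \<gamma>0)
qed

text \<open>F increases from 0 until cos \<theta> = -\<gamma> \<alpha> and decreases from there to 0
  at pi.\<close>

lemma F_pos:
  assumes \<alpha>: "\<alpha> \<in> centers" and \<theta>: "0 < \<theta>" "\<theta> < pi"
  shows "F \<alpha> \<theta> > 0"
proof -
  define \<phi> where "\<phi> = arccos (- \<gamma> \<alpha>)"
  have g: "-1 < - \<gamma> \<alpha>" "- \<gamma> \<alpha> < 1" using gamma_bounds[OF \<alpha>] by auto
  have \<phi>: "0 < \<phi>" "\<phi> < pi" "cos \<phi> = - \<gamma> \<alpha>" using arccos_lt_bounded[OF g] g by (auto simp: \<phi>_def)
  have wp: "arcsine_density (\<alpha> - \<delta> * cos t) > 0" for t using arcsine_density_pos[OF in_centers[OF \<alpha>]] .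
  show ?thesis
  proof (cases "\<theta> \<le> \<phi>")
    case True
    have "F \<alpha> 0 < F \<alpha> \<theta>"
    proof (rule DERIV_pos_imp_increasing_open[OF \<theta>(1)])
      fix t assume t: "0 < t" "t < \<theta>"
      then have "cos t > - \<gamma> \<alpha>" using cos_monotone_0_pi[of t \<phi>] True \<phi> by auto
      then have "\<delta> * (\<gamma> \<alpha> + cos t) * arcsine_density (\<alpha> - \<delta> * cos t) > 0"
        using \<delta> wp by (intro mult_pos_pos) auto
      then show "\<exists>y. (F \<alpha> has_real_derivative y) (at t) \<and> 0 < y" using DERIV_F_upper[OF \<alpha> t(1)] by blast
    qed (rule continuous_on_F_upper[OF \<alpha>])
    then show ?thesis by simp
  next
    case False
    have "F \<alpha> \<theta> > F \<alpha> pi"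
    proof (rule DERIV_neg_imp_decreasing_open[OF \<theta>(2)])
      fix t assume t: "\<theta> < t" "t < pi"
      then have "cos t < - \<gamma> \<alpha>" using cos_monotone_0_pi[of \<phi> t] False \<phi> by auto
      then have "\<delta> * (\<gamma> \<alpha> + cos t) * arcsine_density (\<alpha> - \<delta> * cos t) < 0"
        using \<delta> wp by (intro mult_neg_pos mult_pos_neg) auto
      then show "\<exists>y. (F \<alpha> has_real_derivative y) (at t) \<and> y < 0" using DERIV_F_upper[OF \<alpha>, of t] t \<theta> by auto
    qed (rule continuous_on_subset[OF continuous_on_F_upper[OF \<alpha>, of pi]], use \<theta> in auto)
    then show ?thesis using F_pi[OF \<alpha>] by simp
  qed
qed

section \<open>Asymptotics as the gap approaches the end point -1\<close>

lemma one_minus_square_ge: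
  assumes "\<delta> - 1 \<le> \<alpha>" "\<alpha> \<le> 0"
  shows "1 - (\<alpha> - \<delta> * cos \<phi>)\<^sup>2 \<ge> (1 - \<delta>) * \<delta> * (1 - cos \<phi>)"
proof -
  define t where "t = \<alpha> - \<delta> * cos \<phi>"
  have c: "\<delta> * cos \<phi> \<le> \<delta>" "- \<delta> \<le> \<delta> * cos \<phi>"
    using \<delta> mult_left_mono[OF cos_le_one, of \<delta> \<phi>] mult_left_mono[OF cos_ge_minus_one, of \<delta> \<phi>] by auto
  \<comment> \<open>The factor 1 - t is bounded below since \<alpha> <= 0; the factor 1 + t may
    vanish only at \<phi> = 0. Both bounds remain valid at \<alpha> = \<delta> - 1.\<close>
  have "1 - t \<ge> 1 - \<delta>" using assms c by (auto simp: t_def)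
  moreover have "1 + t \<ge> \<delta> * (1 - cos \<phi>)" using assms by (simp add: t_def algebra_simps)
  ultimately have "(1 - \<delta>) * (\<delta> * (1 - cos \<phi>)) \<le> (1 - t) * (1 + t)"
    using \<delta> by (intro mult_mono) auto
  then show ?thesis by (simp add: t_def[symmetric] power2_eq_square algebra_simps)
qed

text \<open>Let \<epsilon> = 1 + \<alpha> - \<delta>, the length of the left slit. For \<phi>
  between sqrt \<epsilon> and 1 one has 1 + t <= 2 \<phi>^2, hence a density of at least 1 / (2
  \<phi>). Integrating gives half of -ln (sqrt \<epsilon>), which explains the 1 / 4.\<close>

lemma J_one_ge:
  assumes \<alpha>: "\<alpha> \<in> centers" "1 + \<alpha> - \<delta> < 1"
  shows "J (\<lambda>_. 1) \<alpha> pi \<ge> - ln (1 + \<alpha> - \<delta>) / 4"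
proof -
  define \<epsilon> where "\<epsilon> = 1 + \<alpha> - \<delta>"
  have \<epsilon>: "0 < \<epsilon>" "\<epsilon> < 1" using \<alpha> by (auto simp: \<epsilon>_def)
  have s: "0 < sqrt \<epsilon>" "sqrt \<epsilon> < 1" using \<epsilon> by auto
  have "((\<lambda>\<phi>. 1 / (2 * \<phi>)) has_integral ln 1 / 2 - ln (sqrt \<epsilon>) / 2) {sqrt \<epsilon>..1}"
  proof (rule fundamental_theorem_of_calculus)
    fix x assume "x \<in> {sqrt \<epsilon>..1}"
    then have "x > 0" using less_le_trans[OF s(1)] by simp
    then show "((\<lambda>x. ln x / 2) has_vector_derivative 1 / (2 * x)) (at x within {sqrt \<epsilon>..1})"
      by (auto intro!: derivative_eq_intros simp: has_real_derivative_iff_has_vector_derivative[symmetric])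
  qed (use s in simp)
  then have I: "((\<lambda>\<phi>. 1 / (2 * \<phi>)) has_integral - ln \<epsilon> / 4) {sqrt \<epsilon>..1}"
    using \<epsilon> by (simp add: ln_sqrt)
  have wp: "arcsine_density (\<alpha> - \<delta> * cos t) > 0" for t using arcsine_density_pos[OF in_centers[OF \<alpha>(1)]] .
  have int: "(\<lambda>\<phi>. arcsine_density (\<alpha> - \<delta> * cos \<phi>)) integrable_on {a..b}" for a b
    using continuous_J_integrands(1)[OF continuous_on_one \<alpha>(1)] by (intro integrable_continuous_real) simp
  have "- ln \<epsilon> / 4 = integral {sqrt \<epsilon>..1} (\<lambda>\<phi>. 1 / (2 * \<phi>))" using I by (simp add: integral_unique)
  also have "\<dots> \<le> integral {sqrt \<epsilon>..1} (\<lambda>\<phi>. arcsine_density (\<alpha> - \<delta> * cos \<phi>))"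
  proof (rule integral_le)
    fix \<phi> assume "\<phi> \<in> {sqrt \<epsilon>..1}"
    then have \<phi>: "sqrt \<epsilon> \<le> \<phi>" "0 < \<phi>" using less_le_trans[OF s(1), of \<phi>] by simp_all
    then have \<epsilon>\<phi>: "\<epsilon> \<le> \<phi>\<^sup>2" using real_le_rsqrt[of] sqrt_le_D by blast
    define t where "t = \<alpha> - \<delta> * cos \<phi>"
    have t: "\<bar>t\<bar> < 1" using in_centers[OF \<alpha>(1)] by (simp add: t_def)
    have "1 + t = \<epsilon> + \<delta> * (1 - cos \<phi>)" by (simp add: t_def \<epsilon>_def algebra_simps)
    also have "\<dots> \<le> \<phi>\<^sup>2 + 1 * (\<phi>\<^sup>2 / 2)"
      using \<epsilon>\<phi> \<delta> one_minus_cos_le[of \<phi>] by (intro add_mono mult_mono) auto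
    finally have "(1 - t) * (1 + t) \<le> 2 * (2 * \<phi>\<^sup>2)" using t by (intro mult_mono) (auto simp: abs_if split: if_splits)
    then have "1 - t\<^sup>2 \<le> (2 * \<phi>)\<^sup>2" by (simp add: power2_eq_square algebra_simps)
    then have "sqrt (1 - t\<^sup>2) \<le> 2 * \<phi>" using \<phi> by (intro real_le_lsqrt) auto
    moreover have "sqrt (1 - t\<^sup>2) > 0" using t abs_square_less_1[of t] by simp
    ultimately show "1 / (2 * \<phi>) \<le> arcsine_density (\<alpha> - \<delta> * cos \<phi>)"
      unfolding t_def[symmetric] arcsine_density_def using \<phi> by (intro divide_left_mono) auto
  qed (use I int in auto)
  also have "\<dots> \<le> integral {0..pi} (\<lambda>\<phi>. arcsine_density (\<alpha> - \<delta> * cos \<phi>))"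
    using s pi_gt3 by (intro integral_subset_le int) (auto intro!: less_imp_le wp)
  finally show ?thesis by (simp add: J_def \<epsilon>_def)
qed

text \<open>The sum \<gamma> \<alpha> + 1 is the quotient of the integrals of (1 - cos) w and of w.
  The factor 1 - cos removes the singularity and keeps the numerator bounded, while the denominator
  diverges logarithmically.\<close>

lemma gamma_tendsto: "(\<gamma> \<longlongrightarrow> -1) (at_right (\<delta> - 1))"
proof -
  \<comment> \<open>By \<open>one_minus_square_ge\<close> the integrand of the numerator is at most
    sqrt (c / ((1 - \<delta>) \<delta>)) with c = 1 - cos \<phi>, and c <= 2.\<close>
  define C where "C = sqrt (2 / ((1 - \<delta>) * \<delta>))"
  have up: "\<gamma> \<alpha> + 1 \<le> pi * C / (- ln (1 + \<alpha> - \<delta>) / 4)" if \<alpha>: "\<delta> - 1 < \<alpha>" "\<alpha> < min 0 \<delta>" for \<alpha>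
  proof -
    have \<alpha>': "\<alpha> \<in> centers" using \<alpha> \<delta> by auto
    have "J (\<lambda>_. 1) \<alpha> pi - J cos \<alpha> pi = integral {0..pi} (\<lambda>\<phi>. (1 - cos \<phi>) * arcsine_density (\<alpha> - \<delta> * cos \<phi>))"
      unfolding J_def left_diff_distrib
      by (subst integral_diff)
        (auto intro!: integrable_continuous_real continuous_intros in_centers[OF \<alpha>'])
    also have "\<dots> \<le> integral {0..pi} (\<lambda>\<phi>. C)"
    proof (rule integral_le)
      fix \<phi> :: real
      show "(1 - cos \<phi>) * arcsine_density (\<alpha> - \<delta> * cos \<phi>) \<le> C"
      proof (cases "cos \<phi> = 1")
        case True
        then show ?thesis using \<delta> by (simp add: C_def)
      next
        case False
        define c where "c = 1 - cos \<phi>"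
        have c: "0 < c" "c \<le> 2" using False cos_le_one[of \<phi>] cos_ge_minus_one[of \<phi>] unfolding c_def by linarith+
        have k: "(1 - \<delta>) * \<delta> > 0" using \<delta> by simp
        have "arcsine_density (\<alpha> - \<delta> * cos \<phi>) \<le> 1 / sqrt ((1 - \<delta>) * \<delta> * c)"
          unfolding arcsine_density_def
        proof (intro divide_left_mono)
          have a: "0 < (1 - \<delta>) * \<delta> * c" by (rule mult_pos_pos[OF k c(1)])
          have b: "(1 - \<delta>) * \<delta> * c \<le> 1 - (\<alpha> - \<delta> * cos \<phi>)\<^sup>2"
            unfolding c_def using \<alpha> by (intro one_minus_square_ge) auto
          show "sqrt ((1 - \<delta>) * \<delta> * c) \<le> sqrt (1 - (\<alpha> - \<delta> * cos \<phi>)\<^sup>2)"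
            by (rule real_sqrt_le_mono[OF b])
          show "0 < sqrt (1 - (\<alpha> - \<delta> * cos \<phi>)\<^sup>2) * sqrt ((1 - \<delta>) * \<delta> * c)"
            by (intro mult_pos_pos real_sqrt_gt_zero a less_le_trans[OF a b])
        qed simp
        then have "c * arcsine_density (\<alpha> - \<delta> * cos \<phi>) \<le> c * (1 / sqrt ((1 - \<delta>) * \<delta> * c))"
          using c by (intro mult_left_mono) auto
        also have "\<dots> = sqrt (c / ((1 - \<delta>) * \<delta>))"
        proof -
          have "c / (K * sqrt c) = sqrt c / K" for K
          proof -
            have "c = sqrt c * sqrt c" "sqrt c \<noteq> 0" using c by simp_all
            then show ?thesis by (metis mult_divide_mult_cancel_right)
          qed
          then show ?thesis by (simp add: real_sqrt_mult[of _ c] real_sqrt_divide)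
        qed
        also have "\<dots> \<le> C"
          unfolding C_def by (intro real_sqrt_le_mono divide_right_mono c(2) less_imp_le[OF k])
        finally show ?thesis by (simp add: c_def)
      qed
    qed (auto intro!: integrable_continuous_real continuous_intros in_centers[OF \<alpha>'])
    also have "\<dots> = pi * C" by simp
    finally have num: "J (\<lambda>_. 1) \<alpha> pi - J cos \<alpha> pi \<le> pi * C" .
    have "\<gamma> \<alpha> + 1 = (J (\<lambda>_. 1) \<alpha> pi - J cos \<alpha> pi) / J (\<lambda>_. 1) \<alpha> pi"
      using J_one_pos[OF \<alpha>'] by (simp add: \<gamma>_def field_simps)
    also have "\<dots> \<le> pi * C / J (\<lambda>_. 1) \<alpha> pi"
      using num J_one_pos[OF \<alpha>'] by (intro divide_right_mono) auto
    also have "\<dots> \<le> pi * C / (- ln (1 + \<alpha> - \<delta>) / 4)"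
    proof (intro divide_left_mono)
      show "- ln (1 + \<alpha> - \<delta>) / 4 \<le> J (\<lambda>_. 1) \<alpha> pi" using J_one_ge[OF \<alpha>'] \<alpha> by auto
      have "ln (1 + \<alpha> - \<delta>) < 0" using \<alpha> by (subst ln_less_zero_iff) auto
      then show "0 < J (\<lambda>_. 1) \<alpha> pi * (- ln (1 + \<alpha> - \<delta>) / 4)" using J_one_pos[OF \<alpha>'] by (auto intro: mult_pos_neg)
      show "0 \<le> pi * C" using \<delta> by (simp add: C_def)
    qed
    finally show ?thesis .
  qed
  have ev: "eventually (\<lambda>\<alpha>. \<delta> - 1 < \<alpha> \<and> \<alpha> < min 0 \<delta>) (at_right (\<delta> - 1))"
    unfolding eventually_at_right_field using \<delta> by (intro exI[of _ "min 0 \<delta>"]) auto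
  have "((\<lambda>\<alpha>. \<gamma> \<alpha> + 1) \<longlongrightarrow> 0) (at_right (\<delta> - 1))"
  proof (rule tendsto_sandwich)
    show "eventually (\<lambda>\<alpha>. 0 \<le> \<gamma> \<alpha> + 1) (at_right (\<delta> - 1))"
      using ev by (rule eventually_mono) (use gamma_bounds \<delta> in \<open>force intro: less_imp_le\<close>)
    show "eventually (\<lambda>\<alpha>. \<gamma> \<alpha> + 1 \<le> pi * C / (- ln (1 + \<alpha> - \<delta>) / 4)) (at_right (\<delta> - 1))"
      using ev by (rule eventually_mono) (use up in blast)
    have "((\<lambda>\<alpha>. 1 + \<alpha> - \<delta>) \<longlongrightarrow> 1 + (\<delta> - 1) - \<delta>) (at_right (\<delta> - 1))" by (intro tendsto_intros)
    then have "filterlim (\<lambda>\<alpha>. 1 + \<alpha> - \<delta>) (at_right 0) (at_right (\<delta> - 1))"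
      unfolding filterlim_at using ev by (auto elim!: eventually_mono)
    from filterlim_compose[OF ln_at_0 this]
    have "filterlim (\<lambda>\<alpha>. - ln (1 + \<alpha> - \<delta>)) at_top (at_right (\<delta> - 1))"
      by (simp add: filterlim_uminus_at_top)
    then have "filterlim (\<lambda>\<alpha>. (1 / 4) * - ln (1 + \<alpha> - \<delta>)) at_top (at_right (\<delta> - 1))"
      by (intro filterlim_tendsto_pos_mult_at_top[OF tendsto_const]) auto
    from tendsto_divide_0[OF tendsto_const filterlim_at_top_imp_at_infinity[OF this], of "pi * C"]
    show "((\<lambda>\<alpha>. pi * C / (- ln (1 + \<alpha> - \<delta>) / 4)) \<longlongrightarrow> 0) (at_right (\<delta> - 1))" by simp
  qed auto
  then have "((\<lambda>\<alpha>. (\<gamma> \<alpha> + 1) - 1) \<longlongrightarrow> 0 - 1) (at_right (\<delta> - 1))" by (intro tendsto_intros)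
  then show ?thesis by simp
qed

text \<open>Clipping makes \<open>\<Theta> x \<alpha>\<close> an end point of \<open>[0, \<pi>]\<close>, where \<open>F\<close> vanishes, when \<open>x\<close> is off the gap.\<close>

definition \<Theta> :: "real \<Rightarrow> real \<Rightarrow> real" where
  "\<Theta> x \<alpha> = arccos (max (-1) (min 1 ((\<alpha> - x) / \<delta>)))"

lemma Theta_bounds: "\<Theta> x \<alpha> \<in> {0..pi}"
  unfolding \<Theta>_def by (auto intro!: arccos_lbound arccos_ubound)

lemma Theta_gap:
  assumes "\<bar>\<alpha> - x\<bar> < \<delta>"
  shows "\<Theta> x \<alpha> = arccos ((\<alpha> - x) / \<delta>)" "0 < \<Theta> x \<alpha>" "\<Theta> x \<alpha> < pi" "x = \<alpha> - \<delta> * cos (\<Theta> x \<alpha>)"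
proof -
  have y: "-1 < (\<alpha> - x) / \<delta>" "(\<alpha> - x) / \<delta> < 1" using assms \<delta> by (auto simp: field_simps)
  then show 1: "\<Theta> x \<alpha> = arccos ((\<alpha> - x) / \<delta>)" by (simp add: \<Theta>_def)
  show "0 < \<Theta> x \<alpha>" "\<Theta> x \<alpha> < pi" unfolding 1 using arccos_lt_bounded[OF y] by auto
  show "x = \<alpha> - \<delta> * cos (\<Theta> x \<alpha>)" unfolding 1 using y \<delta> by simp
qed

lemma Theta_off_gap:
  shows "\<delta> \<le> \<alpha> - x \<Longrightarrow> \<Theta> x \<alpha> = 0" and "\<alpha> - x \<le> - \<delta> \<Longrightarrow> \<Theta> x \<alpha> = pi"
proof -
  assume "\<delta> \<le> \<alpha> - x"
  then have "1 \<le> (\<alpha> - x) / \<delta>" using \<delta> by (simp add: field_simps)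
  then show "\<Theta> x \<alpha> = 0" by (simp add: \<Theta>_def)
next
  assume "\<alpha> - x \<le> - \<delta>"
  then have "(\<alpha> - x) / \<delta> \<le> -1" using \<delta> by (simp add: field_simps)
  then show "\<Theta> x \<alpha> = pi" by (simp add: \<Theta>_def)
qed

lemma continuous_on_Theta: "continuous_on S (\<Theta> x)"
  unfolding \<Theta>_def[abs_def] using \<delta>
  by (intro continuous_on_arccos continuous_intros) auto

lemma params_in_centers: "\<alpha> \<in> {\<delta> - 1<..0} \<Longrightarrow> \<alpha> \<in> centers"
  using \<delta> by auto

lemma green_gap_eq:
  assumes \<alpha>: "\<alpha> \<in> {\<delta> - 1<..0}" and x: "x \<in> {-1..1}"
  shows "green_gap \<alpha> \<delta> (of_real x) = F \<alpha> (\<Theta> x \<alpha>)"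
proof -
  note c = params_in_centers[OF \<alpha>]
  have K: "remez_set \<alpha> \<delta> = {-1..\<alpha> - \<delta>} \<union> {\<alpha> + \<delta>..1}"
    using \<alpha> \<delta> by (auto simp: remez_set_def)
  have ab: "-1 < \<alpha> - \<delta>" "\<alpha> + \<delta> < 1" using \<alpha> \<delta> by auto
  have dF: "(F \<alpha> has_real_derivative \<delta> * (\<gamma> \<alpha> + cos \<theta>) * arcsine_density (\<alpha> - \<delta> * cos \<theta>)) (at \<theta>)"
    if "0 < \<theta>" "\<theta> < pi" for \<theta>
    using DERIV_F_upper[OF c that(1)] .
  note G = green_fun_two_slits[OF \<delta>(1) ab continuous_on_F_upper[OF c] F_0 F_pi[OF c],
      folded K, folded green_gap_def]
  have G1: "green_gap \<alpha> \<delta> (of_real (\<alpha> - \<delta> * cos \<theta>)) = F \<alpha> \<theta>" if "0 < \<theta>" "\<theta> < pi" for \<theta>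
    by (rule G(1)[OF _ that]) (rule dF)
  have G2: "green_gap \<alpha> \<delta> z = 0" if "z \<in> of_real ` remez_set \<alpha> \<delta>" for z
    by (rule G(2)[OF _ that]) (rule dF)
  show ?thesis
  proof (cases "\<bar>\<alpha> - x\<bar> < \<delta>")
    case True
    show ?thesis using G1[OF Theta_gap(2,3)[OF True]] Theta_gap(4)[OF True] by simp
  next
    case False
    then have "x \<in> remez_set \<alpha> \<delta>" using x \<delta> by (auto simp: K)
    then have "green_gap \<alpha> \<delta> (of_real x) = 0" using G2 by blast
    moreover have "F \<alpha> (\<Theta> x \<alpha>) = 0"
      using False Theta_off_gap[where x = x and \<alpha> = \<alpha>] F_pi[OF c] by (cases "\<delta> \<le> \<alpha> - x") auto
    ultimately show ?thesis by simp
  qed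
qed

lemma DERIV_green_gap:
  assumes \<alpha>: "\<alpha> \<in> {\<delta> - 1<..0}" and x: "\<bar>\<alpha> - x\<bar> < \<delta>"
  shows "((\<lambda>a. green_gap a \<delta> (of_real x)) has_real_derivative D \<alpha> (\<Theta> x \<alpha>)) (at \<alpha> within {\<delta> - 1<..0})"
proof -
  have x1: "x \<in> {-1..1}" using \<alpha> x \<delta> by (auto simp: abs_if split: if_splits)
  have "((\<lambda>a. F a (arccos ((a - x) / \<delta>))) has_real_derivative D \<alpha> (\<Theta> x \<alpha>)) (at \<alpha> within {\<delta> - 1<..0})"
    using DERIV_F_center[OF params_in_centers[OF \<alpha>] x] Theta_gap(1)[OF x]
    by (simp add: has_field_derivative_at_within)
  then show ?thesis
  proof (rule has_field_derivative_transform_within[of _ _ _ _ "\<delta> - \<bar>\<alpha> - x\<bar>"])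
    fix a assume a: "a \<in> {\<delta> - 1<..0}" "dist a \<alpha> < \<delta> - \<bar>\<alpha> - x\<bar>"
    then have "\<bar>a - x\<bar> < \<delta>" by (auto simp: dist_real_def abs_if split: if_splits)
    then show "F a (arccos ((a - x) / \<delta>)) = green_gap a \<delta> (of_real x)"
      using green_gap_eq[OF a(1) x1] Theta_gap(1) by simp
  qed (use x \<alpha> in auto)
qed

text \<open>Complement of J in [0, pi]. Unlike J it avoids \<phi> = 0, the point where the density
  becomes singular as \<alpha> -> \<delta> - 1.\<close>

definition tail :: "(real \<Rightarrow> real) \<Rightarrow> real \<Rightarrow> real \<Rightarrow> real" where
  "tail \<psi> \<alpha> \<theta> = integral {\<theta>..pi} (\<lambda>\<phi>. \<psi> \<phi> * arcsine_density (\<alpha> - \<delta> * cos \<phi>))"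

lemma F_eq_tail:
  assumes \<alpha>: "\<alpha> \<in> centers" and \<theta>: "\<theta> \<in> {0..pi}"
  shows "F \<alpha> \<theta> = - \<delta> * (\<gamma> \<alpha> * tail (\<lambda>_. 1) \<alpha> \<theta> + tail cos \<alpha> \<theta>)"
proof -
  have "J \<psi> \<alpha> \<theta> + tail \<psi> \<alpha> \<theta> = J \<psi> \<alpha> pi" if "continuous_on UNIV \<psi>" for \<psi>
    unfolding J_def tail_def using \<theta>
    by (intro Henstock_Kurzweil_Integration.integral_combine integrable_continuous_real continuous_J_integrands(1)[OF that \<alpha>]) auto
  from this[OF continuous_on_one] this[OF continuous_on_cosine]
  have J: "J (\<lambda>_. 1) \<alpha> \<theta> = J (\<lambda>_. 1) \<alpha> pi - tail (\<lambda>_. 1) \<alpha> \<theta>" "J cos \<alpha> \<theta> = J cos \<alpha> pi - tail cos \<alpha> \<theta>" by auto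
  have "F \<alpha> \<theta> = F \<alpha> pi - \<delta> * (\<gamma> \<alpha> * tail (\<lambda>_. 1) \<alpha> \<theta> + tail cos \<alpha> \<theta>)"
    unfolding F_def J by (simp add: algebra_simps)
  then show ?thesis using F_pi[OF \<alpha>] by simp
qed

lemma continuous_on_tail:
  assumes \<psi>: "continuous_on UNIV \<psi>"
    and X: "\<And>\<alpha> \<phi>. \<alpha> \<in> X \<Longrightarrow> \<phi> \<in> {c..pi} \<Longrightarrow> \<bar>\<alpha> - \<delta> * cos \<phi>\<bar> < 1"
    and \<theta>: "continuous_on X \<theta>" "\<And>\<alpha>. \<alpha> \<in> X \<Longrightarrow> \<theta> \<alpha> \<in> {c..pi}"
  shows "continuous_on X (\<lambda>\<alpha>. tail \<psi> \<alpha> (\<theta> \<alpha>))"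
  unfolding tail_def
proof (rule continuous_on_integral_lower[OF _ \<theta>])
  show "continuous_on (X \<times> {c..pi}) (\<lambda>(\<alpha>, \<phi>). \<psi> \<phi> * arcsine_density (\<alpha> - \<delta> * cos \<phi>))"
    unfolding split_beta
    by (intro continuous_intros continuous_on_compose2[OF \<psi>]) (use X in auto)
qed

text \<open>Continuity has to include those \<alpha> at which x enters or leaves the gap; there the
  clipped angle \<Theta> reaches 0 or pi continuously.\<close>

lemma continuous_on_green_gap:
  assumes "x \<in> {-1..1}"
  shows "continuous_on {\<delta> - 1<..0} (\<lambda>\<alpha>. green_gap \<alpha> \<delta> (of_real x))"
proof -
  have "continuous_on {\<delta> - 1<..0} \<gamma>"
    using DERIV_gamma params_in_centers by (intro DERIV_continuous_on) (blast intro: has_field_derivative_at_within)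
  moreover have "continuous_on {\<delta> - 1<..0} (\<lambda>\<alpha>. tail \<psi> \<alpha> (\<Theta> x \<alpha>))" if "continuous_on UNIV \<psi>" for \<psi>
    by (rule continuous_on_tail[OF that _ continuous_on_Theta Theta_bounds])
      (intro in_centers params_in_centers)
  ultimately have "continuous_on {\<delta> - 1<..0} (\<lambda>\<alpha>. - \<delta> * (\<gamma> \<alpha> * tail (\<lambda>_. 1) \<alpha> (\<Theta> x \<alpha>) + tail cos \<alpha> (\<Theta> x \<alpha>)))"
    using continuous_on_one continuous_on_cosine by (intro continuous_intros) auto
  then show ?thesis
  proof (rule continuous_on_eq)
    fix \<alpha> assume "\<alpha> \<in> {\<delta> - 1<..0}"
    then show "- \<delta> * (\<gamma> \<alpha> * tail (\<lambda>_. 1) \<alpha> (\<Theta> x \<alpha>) + tail cos \<alpha> (\<Theta> x \<alpha>)) = green_gap \<alpha> \<delta> (of_real x)"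
      using green_gap_eq[of \<alpha> x] F_eq_tail[OF params_in_centers Theta_bounds, of \<alpha> x] assms by simp
  qed
qed

lemma end_density_domain:
  assumes "\<delta> - 1 \<le> \<alpha>" "\<alpha> \<le> 0" "0 < \<phi>" "\<phi> \<le> pi"
  shows "\<bar>\<alpha> - \<delta> * cos \<phi>\<bar> < 1"
proof -
  have "cos \<phi> < 1" using cos_monotone_0_pi[of 0 \<phi>] assms by simp
  then have "(1 - \<delta>) * \<delta> * (1 - cos \<phi>) > 0" using \<delta> by simp
  then show ?thesis using one_minus_square_ge[OF assms(1,2), of \<phi>] abs_square_less_1[of "\<alpha> - \<delta> * cos \<phi>"] by simp
qed

text \<open>The limit of \<open>F \<alpha>\<close> as \<open>\<alpha> \<rightarrow> \<delta> - 1\<close>, where \<open>\<gamma> \<alpha> \<rightarrow> -1\<close>.\<close>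

definition F_end :: "real \<Rightarrow> real" where
  "F_end \<theta> = - \<delta> * (- tail (\<lambda>_. 1) (\<delta> - 1) \<theta> + tail cos (\<delta> - 1) \<theta>)"

lemma green_gap_tendsto:
  assumes x: "-1 < x" "x \<le> 1"
  shows "((\<lambda>\<alpha>. green_gap \<alpha> \<delta> (of_real x)) \<longlongrightarrow> F_end (\<Theta> x (\<delta> - 1))) (at_right (\<delta> - 1))"
proof -
  \<comment> \<open>As x > -1, the limiting angle is positive. Near the limit all angles exceed half
    of it, so the tails are integrals over subsets of a fixed interval [\<eta>, pi] on which the
    density is jointly continuous, the end value \<delta> - 1 included.\<close>
  define \<eta> where "\<eta> = \<Theta> x (\<delta> - 1) / 2"
  have "\<Theta> x (\<delta> - 1) > 0"
  proof (cases "\<bar>\<delta> - 1 - x\<bar> < \<delta>")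
    case False
    then have "\<delta> - 1 - x \<le> - \<delta>" using x by (auto simp: abs_if split: if_splits)
    then show ?thesis using Theta_off_gap(2) by simp
  qed (rule Theta_gap)
  then have \<eta>: "0 < \<eta>" "\<eta> < \<Theta> x (\<delta> - 1)" by (auto simp: \<eta>_def)
  define T where "T = {\<alpha> \<in> {\<delta> - 1..0}. \<eta> \<le> \<Theta> x \<alpha>}"
  have T: "\<delta> - 1 \<in> T" using \<delta> \<eta> by (auto simp: T_def)
  have evC: "eventually (\<lambda>\<alpha>. \<alpha> \<in> {\<delta> - 1<..0}) (at_right (\<delta> - 1))"
    unfolding eventually_at_right_field using \<delta> by (intro exI[of _ 0]) auto
  have "(\<Theta> x \<longlongrightarrow> \<Theta> x (\<delta> - 1)) (at_right (\<delta> - 1))"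
    using continuous_on_Theta[of UNIV x] by (auto simp: continuous_on_def intro: tendsto_within_subset)
  then have ev\<eta>: "eventually (\<lambda>\<alpha>. \<eta> < \<Theta> x \<alpha>) (at_right (\<delta> - 1))"
    using \<eta> by (intro order_tendstoD(1)) auto
  have "filterlim (\<lambda>\<alpha>. \<alpha>) (at (\<delta> - 1) within T) (at_right (\<delta> - 1))"
    unfolding filterlim_at
    by (intro conjI tendsto_ident_at eventually_mono[OF eventually_conj[OF evC ev\<eta>]]) (auto simp: T_def)
  moreover have "((\<lambda>\<alpha>. tail \<psi> \<alpha> (\<Theta> x \<alpha>)) \<longlongrightarrow> tail \<psi> (\<delta> - 1) (\<Theta> x (\<delta> - 1))) (at (\<delta> - 1) within T)"
    if "continuous_on UNIV \<psi>" for \<psi>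
  proof -
    have "continuous_on T (\<lambda>\<alpha>. tail \<psi> \<alpha> (\<Theta> x \<alpha>))"
    proof (rule continuous_on_tail[OF that _ continuous_on_Theta])
      show "\<bar>\<alpha> - \<delta> * cos \<phi>\<bar> < 1" if "\<alpha> \<in> T" "\<phi> \<in> {\<eta>..pi}" for \<alpha> \<phi>
        using that \<eta> by (intro end_density_domain) (auto simp: T_def)
      show "\<Theta> x \<alpha> \<in> {\<eta>..pi}" if "\<alpha> \<in> T" for \<alpha> using that Theta_bounds[of x \<alpha>] by (auto simp: T_def)
    qed
    then show ?thesis using T by (auto simp: continuous_on_def)
  qed
  ultimately have tl: "((\<lambda>\<alpha>. tail \<psi> \<alpha> (\<Theta> x \<alpha>)) \<longlongrightarrow> tail \<psi> (\<delta> - 1) (\<Theta> x (\<delta> - 1))) (at_right (\<delta> - 1))"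
    if "continuous_on UNIV \<psi>" for \<psi>
    using filterlim_compose that by blast
  have "((\<lambda>\<alpha>. - \<delta> * (\<gamma> \<alpha> * tail (\<lambda>_. 1) \<alpha> (\<Theta> x \<alpha>) + tail cos \<alpha> (\<Theta> x \<alpha>))) \<longlongrightarrow>
     - \<delta> * (-1 * tail (\<lambda>_. 1) (\<delta> - 1) (\<Theta> x (\<delta> - 1)) + tail cos (\<delta> - 1) (\<Theta> x (\<delta> - 1)))) (at_right (\<delta> - 1))"
    by (intro tendsto_intros gamma_tendsto tl continuous_on_one continuous_on_cosine)
  moreover have "eventually (\<lambda>\<alpha>. - \<delta> * (\<gamma> \<alpha> * tail (\<lambda>_. 1) \<alpha> (\<Theta> x \<alpha>) + tail cos \<alpha> (\<Theta> x \<alpha>))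
      = green_gap \<alpha> \<delta> (of_real x)) (at_right (\<delta> - 1))"
    using evC
  proof (rule eventually_mono)
    fix \<alpha> assume "\<alpha> \<in> {\<delta> - 1<..0}"
    then show "- \<delta> * (\<gamma> \<alpha> * tail (\<lambda>_. 1) \<alpha> (\<Theta> x \<alpha>) + tail cos \<alpha> (\<Theta> x \<alpha>)) = green_gap \<alpha> \<delta> (of_real x)"
      using green_gap_eq[of \<alpha> x] F_eq_tail[OF params_in_centers Theta_bounds, of \<alpha> x] x by simp
  qed
  ultimately show ?thesis
    unfolding F_end_def using Lim_transform_eventually by fastforce
qed

lemma F_end_eq_green_end:
  assumes x: "-1 < x" "x \<le> 1"
  shows "F_end (\<Theta> x (\<delta> - 1)) = green_end \<delta> (of_real x)"
proof -
  have dt: "(tail \<psi> (\<delta> - 1) has_real_derivative - (\<psi> \<theta> * arcsine_density (\<delta> - 1 - \<delta> * cos \<theta>))) (at \<theta>)"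
    if \<psi>: "continuous_on UNIV \<psi>" and \<theta>: "0 < \<theta>" "\<theta> < pi" for \<psi> \<theta>
  proof -
    have "continuous_on {\<theta> / 2..pi} (\<lambda>\<phi>. \<psi> \<phi> * arcsine_density (\<delta> - 1 - \<delta> * cos \<phi>))"
      using \<theta> \<delta> by (intro continuous_intros continuous_on_subset[OF \<psi>] end_density_domain) auto
    from integral_has_real_derivative'[OF this, of \<theta>] \<theta>
    have "(tail \<psi> (\<delta> - 1) has_real_derivative - (\<psi> \<theta> * arcsine_density (\<delta> - 1 - \<delta> * cos \<theta>))) (at \<theta> within {\<theta> / 2..pi})"
      unfolding tail_def[abs_def] by auto
    then show ?thesis using \<theta> by (simp add: at_within_Icc_at)
  qed
  have dF: "(F_end has_real_derivative \<delta> * (- 1 + cos \<theta>) * arcsine_density (\<delta> - 1 - \<delta> * cos \<theta>)) (at \<theta>)"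
    if "0 < \<theta>" "\<theta> < pi" for \<theta>
    using DERIV_cmult[OF DERIV_add[OF DERIV_minus[OF dt[OF continuous_on_one that]] dt[OF continuous_on_cosine that]], of "- \<delta>"]
    unfolding F_end_def[abs_def] by (simp add: algebra_simps)
  have "continuous_on {pi / 2..pi} (\<lambda>\<theta>. tail \<psi> (\<delta> - 1) \<theta>)" if "continuous_on UNIV \<psi>" for \<psi>
    unfolding tail_def
  proof (rule continuous_on_integral_lower[where c = "pi / 2"])
    show "continuous_on ({pi / 2..pi} \<times> {pi / 2..pi}) (\<lambda>(x, \<phi>). \<psi> \<phi> * arcsine_density (\<delta> - 1 - \<delta> * cos \<phi>))"
      unfolding split_beta using \<delta> pi_gt_zero
      by (intro continuous_intros continuous_on_compose2[OF that] end_density_domain) (auto simp del: pi_gt_zero)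
  qed (auto intro: continuous_intros)
  then have cF: "continuous_on {pi / 2..pi} F_end"
    unfolding F_end_def[abs_def] using continuous_on_one continuous_on_cosine by (intro continuous_intros) auto
  have F_end_pi: "F_end pi = 0" by (simp add: F_end_def tail_def)
  note G = green_fun_one_slit[OF \<delta> cF F_end_pi, folded green_end_def]
  have G1: "green_end \<delta> (of_real (\<delta> - 1 - \<delta> * cos \<theta>)) = F_end \<theta>" if "0 < \<theta>" "\<theta> < pi" for \<theta>
    by (rule G(1)[OF _ that]) (rule dF)
  have G2: "green_end \<delta> z = 0" if "z \<in> of_real ` {-1 + 2 * \<delta>..1}" for z
    by (rule G(2)[OF _ that]) (rule dF)
  show ?thesis
  proof (cases "\<bar>\<delta> - 1 - x\<bar> < \<delta>")
    case True
    show ?thesis using G1[OF Theta_gap(2,3)[OF True]] Theta_gap(4)[OF True] by simp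
  next
    case False
    then have "\<delta> - 1 - x \<le> - \<delta>" using x by (auto simp: abs_if split: if_splits)
    then have "F_end (\<Theta> x (\<delta> - 1)) = 0" "x \<in> {-1 + 2 * \<delta>..1}"
      using F_end_pi Theta_off_gap(2)[of "\<delta> - 1" x] x by auto
    then show ?thesis using G2 by auto
  qed
qed

end

section \<open>Maximization over the centre and the final dichotomy\<close>

lemma attains_max_or_le_limit:
  fixes f :: "real \<Rightarrow> real"
  assumes f: "continuous_on {a<..b} f" and l: "(f \<longlongrightarrow> l) (at_right a)"
  obtains m where "m \<in> {a<..b}" "\<And>x. x \<in> {a<..b} \<Longrightarrow> f x \<le> f m" | "\<And>x. x \<in> {a<..b} \<Longrightarrow> f x \<le> l"
proof (cases "\<exists>x\<in>{a<..b}. f x > l")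
  case True
  then obtain x1 where x1: "x1 \<in> {a<..b}" "f x1 > l" by auto
  \<comment> \<open>Near a the values stay below f x1, so the maximum over the compact rest of the
    interval is global.\<close>
  from order_tendstoD(2)[OF l x1(2)] obtain c where c: "c > a" "\<And>x. a < x \<Longrightarrow> x < c \<Longrightarrow> f x < f x1"
    unfolding eventually_at_right_field by auto
  have "c \<le> x1" using c(2)[of x1] x1 by force
  have "continuous_on {c..b} f" using c(1) by (intro continuous_on_subset[OF f]) auto
  then obtain m where m: "m \<in> {c..b}" "\<And>x. x \<in> {c..b} \<Longrightarrow> f x \<le> f m"
    using continuous_attains_sup[of "{c..b}" f] \<open>c \<le> x1\<close> x1(1) by force
  have "f x \<le> f m" if "x \<in> {a<..b}" for x
    using c(2)[of x] m(2)[of x] m(2)[of x1] \<open>c \<le> x1\<close> x1(1) that by (cases "x < c") auto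
  then show ?thesis using that(1)[of m] m(1) c(1) by auto
next
  case False
  then show ?thesis using that(2) by force
qed

text \<open>Every point of the interval is approached from the left within it, so the filter is not
  trivial. This includes the closed end b, where the derivative is one-sided.\<close>

lemma has_real_derivative_unique_within_Ioc:
  fixes x :: real
  assumes "(f has_real_derivative A) (at x within {a<..b})" "(f has_real_derivative B) (at x within {a<..b})"
    and "x \<in> {a<..b}"
  shows "A = B"
proof -
  have "at_left x \<le> at x within {a<..b}"
  proof -
    have "at x within {(a + x) / 2..x} = at_left x" using assms(3) by (intro at_within_Icc_at_left) auto
    moreover have "at x within {(a + x) / 2..x} \<le> at x within {a<..b}" using assms(3) by (intro at_le) auto
    ultimately show ?thesis by simp
  qed
  then have "at x within {a<..b} \<noteq> bot" using trivial_limit_at_left_real[of x] by (metis bot.extremum_uniqueI)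
  then show ?thesis using assms(1,2) unfolding has_field_derivative_iff by (rule tendsto_unique)
qed

text \<open>The point -1 is excluded because it belongs to every
  \<open>remez_set \<alpha> \<delta>\<close> in the range: the envelope there is 0 and is attained
  at every \<alpha>, although -1 lies in no gap. That the supremum is attained as \<alpha> ->
  \<delta> - 1 is expressed by convergence of the values to the envelope.\<close>

theorem lemma1p4:
  fixes \<delta> x0 :: real
  assumes "0 < \<delta>" and "\<delta> < 1"
    and "-1 < x0" and "x0 \<le> 0"
  shows "(\<forall>\<alpha>\<in>{\<delta> - 1<..0}.
            green_gap \<alpha> \<delta> (complex_of_real x0) = upper_envelope \<delta> x0 \<longrightarrow>
              critical_points \<alpha> \<delta> = {x0}) \<and>
         ((\<nexists>\<alpha>. \<alpha> \<in> {\<delta> - 1<..0} \<and>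
                green_gap \<alpha> \<delta> (complex_of_real x0) = upper_envelope \<delta> x0) \<longrightarrow>
            ((\<lambda>\<alpha>. green_gap \<alpha> \<delta> (complex_of_real x0)) \<longlongrightarrow> upper_envelope \<delta> x0)
              (at_right (\<delta> - 1)) \<and>
            upper_envelope \<delta> x0 = green_end \<delta> (complex_of_real x0))"
proof -
  interpret remez_gap \<delta> by unfold_locales (use assms in auto)
  define f where "f \<alpha> = green_gap \<alpha> \<delta> (complex_of_real x0)" for \<alpha>
  define S where "S = upper_envelope \<delta> x0"
  have S: "S = (SUP \<alpha>\<in>{\<delta> - 1<..0}. f \<alpha>)" by (simp add: S_def upper_envelope_def f_def)
  have x0: "x0 \<in> {-1..1}" "x0 \<le> 1" using assms by auto
  have ne: "{\<delta> - 1<..0} \<noteq> {}" using assms by auto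
  have f: "f \<alpha> = F \<alpha> (\<Theta> x0 \<alpha>)" if "\<alpha> \<in> {\<delta> - 1<..0}" for \<alpha>
    using green_gap_eq[OF that x0(1)] by (simp add: f_def)
  have lim: "(f \<longlongrightarrow> green_end \<delta> (of_real x0)) (at_right (\<delta> - 1))"
    using green_gap_tendsto[OF assms(3) x0(2)] F_end_eq_green_end[OF assms(3) x0(2)]
    unfolding f_def by simp
  have cont: "continuous_on {\<delta> - 1<..0} f" unfolding f_def by (rule continuous_on_green_gap[OF x0(1)])
  note max_or_limit = attains_max_or_le_limit[OF cont lim]
  have bdd: "bdd_above (f ` {\<delta> - 1<..0})" 
  proof (rule max_or_limit)
    fix m assume "\<And>x. x \<in> {\<delta> - 1<..0} \<Longrightarrow> f x \<le> f m"
    then show ?thesis by (rule bdd_aboveI2)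
  next
    assume "\<And>x. x \<in> {\<delta> - 1<..0} \<Longrightarrow> f x \<le> green_end \<delta> (of_real x0)"
    then show ?thesis by (rule bdd_aboveI2)
  qed
  have fS: "f \<alpha> \<le> S" if "\<alpha> \<in> {\<delta> - 1<..0}" for \<alpha>
    unfolding S by (rule cSUP_upper[OF that bdd])
  \<comment> \<open>Positivity is needed to place the point in the gap of a maximizing \<alpha>,
    since the Green function vanishes on the slits.\<close>
  have Spos: "S > 0"
  proof -
    obtain \<alpha> where \<alpha>: "\<alpha> \<in> {\<delta> - 1<..0}" "\<bar>\<alpha> - x0\<bar> < \<delta>"
    proof (cases "x0 > \<delta> - 1")
      case True
      then show ?thesis using assms by (intro that[of x0]) auto
    next
      case False
      \<comment> \<open>The centre \<delta> - 1 + e has its gap starting at -1 + e, which lies to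
        the left of \<open>x0\<close> because e < \<open>x0\<close> + 1.\<close>
      define e where "e = min (1 - \<delta>) (x0 + 1) / 2"
      have "0 < e" "e < 1 - \<delta>" "e < x0 + 1" using assms by (auto simp: e_def min_def)
      then show ?thesis using False assms by (intro that[of "\<delta> - 1 + e"]) auto
    qed
    have "0 < f \<alpha>" unfolding f[OF \<alpha>(1)]
      using Theta_gap[OF \<alpha>(2)] by (intro F_pos params_in_centers \<alpha>) auto
    then show ?thesis using fS[OF \<alpha>(1)] by simp
  qed
  have "critical_points \<alpha> \<delta> = {x0}" if \<alpha>: "\<alpha> \<in> {\<delta> - 1<..0}" and max: "f \<alpha> = S" for \<alpha>
  proof -
    note c = params_in_centers[OF \<alpha>]
    have gap: "\<bar>\<alpha> - x0\<bar> < \<delta>"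
    proof (rule ccontr)
      assume "\<not> \<bar>\<alpha> - x0\<bar> < \<delta>"
      then have "\<Theta> x0 \<alpha> = 0 \<or> \<Theta> x0 \<alpha> = pi"
        using Theta_off_gap[of \<alpha> x0] by (cases "\<delta> \<le> \<alpha> - x0") auto
      then have "f \<alpha> = 0" using f[OF \<alpha>] F_pi[OF c] by auto
      then show False using Spos max by simp
    qed
    define d where "d = D \<alpha> (\<Theta> x0 \<alpha>)"
    have df: "(f has_real_derivative d) (at \<alpha> within {\<delta> - 1<..0})"
      unfolding f_def d_def by (rule DERIV_green_gap[OF \<alpha> gap])
    \<comment> \<open>Comparison with slightly smaller parameters, which are available at every
      \<alpha> because the range is open on the left. For \<alpha> < 0 the reverse inequality comes
      in the same way from larger ones.\<close>
    have "d \<ge> 0"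
    proof (rule ccontr)
      assume "\<not> d \<ge> 0"
      then obtain r where r: "r > 0" "\<And>h. h > 0 \<Longrightarrow> \<alpha> - h \<in> {\<delta> - 1<..0} \<Longrightarrow> h < r \<Longrightarrow> f \<alpha> < f (\<alpha> - h)"
        using has_real_derivative_neg_dec_left[OF df] by force
      define h where "h = min r (\<alpha> - (\<delta> - 1)) / 2"
      have h: "h > 0" "h < r" "\<alpha> - h \<in> {\<delta> - 1<..0}" using r(1) \<alpha> by (auto simp: h_def min_def field_simps)
      show False using r(2)[OF h(1,3,2)] fS[OF h(3)] max by simp
    qed
    moreover have "d \<le> 0"
    proof (cases "\<alpha> = 0")
      case True
      have "\<Theta> x0 0 \<le> pi / 2"
        using gap assms arccos_le_pi2[of "- x0 / \<delta>"] Theta_gap(1)[of 0 x0] True by (auto simp: field_simps)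
      then consider "\<Theta> x0 0 < pi / 2" | "\<Theta> x0 0 = pi / 2" by linarith
      then show ?thesis
      proof cases
        case 1
        then have "D 0 (\<Theta> x0 0) < D 0 (pi / 2)"
          using c Theta_gap(2)[OF gap] unfolding True by (intro D_strict_mono) auto
        then show ?thesis unfolding d_def True D_0_pi_half by simp
      next
        case 2
        show ?thesis unfolding d_def True 2 D_0_pi_half by simp
      qed
    next
      case False
      show ?thesis
      proof (rule ccontr)
        assume "\<not> d \<le> 0"
        then obtain r where r: "r > 0" "\<And>h. h > 0 \<Longrightarrow> \<alpha> + h \<in> {\<delta> - 1<..0} \<Longrightarrow> h < r \<Longrightarrow> f \<alpha> < f (\<alpha> + h)"
          using has_real_derivative_pos_inc_right[OF df] by force
        define h where "h = min r (- \<alpha>) / 2"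
        have h: "h > 0" "h < r" "\<alpha> + h \<in> {\<delta> - 1<..0}" using r(1) \<alpha> False by (auto simp: h_def min_def field_simps)
        show False using r(2)[OF h(1,3,2)] fS[OF h(3)] max by simp
      qed
    qed
    ultimately have d0: "D \<alpha> (\<Theta> x0 \<alpha>) = 0" by (simp add: d_def)
    have "x = x0" if x: "x \<in> critical_points \<alpha> \<delta>" for x
    proof -
      have xg: "\<bar>\<alpha> - x\<bar> < \<delta>" using x by (auto simp: critical_points_def)
      have "((\<lambda>a. green_gap a \<delta> (of_real x)) has_real_derivative 0) (at \<alpha> within {\<delta> - 1<..0})"
        using x by (simp add: critical_points_def)
      then have "D \<alpha> (\<Theta> x \<alpha>) = 0"
        using has_real_derivative_unique_within_Ioc[OF DERIV_green_gap[OF \<alpha> xg] _ \<alpha>] by blast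
      then have "\<Theta> x \<alpha> = \<Theta> x0 \<alpha>"
        using D_strict_mono[OF c, of "\<Theta> x \<alpha>" "\<Theta> x0 \<alpha>"] D_strict_mono[OF c, of "\<Theta> x0 \<alpha>" "\<Theta> x \<alpha>"]
          d0 Theta_gap(2,3)[OF xg] Theta_gap(2,3)[OF gap] by linarith
      then show "x = x0" using Theta_gap(4)[OF xg] Theta_gap(4)[OF gap] by simp
    qed
    moreover have "x0 \<in> critical_points \<alpha> \<delta>"
      using gap DERIV_green_gap[OF \<alpha> gap] unfolding d0 by (auto simp: critical_points_def)
    ultimately show ?thesis by blast
  qed
  moreover have "(f \<longlongrightarrow> S) (at_right (\<delta> - 1)) \<and> S = green_end \<delta> (of_real x0)"
    if un: "\<nexists>\<alpha>. \<alpha> \<in> {\<delta> - 1<..0} \<and> f \<alpha> = S"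
  proof -
    have "S = green_end \<delta> (of_real x0)"
    \<comment> \<open>A maximum over the range would attain the supremum, contrary to the
      assumption; so all values are bounded by the limit at \<delta> - 1, and this limit is itself
      at most the supremum.\<close>
    proof (rule max_or_limit)
      fix m assume m: "m \<in> {\<delta> - 1<..0}" "\<And>x. x \<in> {\<delta> - 1<..0} \<Longrightarrow> f x \<le> f m"
      then have "S \<le> f m" unfolding S by (intro cSUP_least[OF ne])
      then show ?thesis using un fS[OF m(1)] m(1) by force
    next
      assume "\<And>x. x \<in> {\<delta> - 1<..0} \<Longrightarrow> f x \<le> green_end \<delta> (of_real x0)"
      then have "S \<le> green_end \<delta> (of_real x0)" unfolding S by (intro cSUP_least[OF ne])
      moreover have "green_end \<delta> (of_real x0) \<le> S"
      proof (rule tendsto_upperbound[OF lim])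
        show "eventually (\<lambda>\<alpha>. f \<alpha> \<le> S) (at_right (\<delta> - 1))"
          unfolding eventually_at_right_field using fS assms by (intro exI[of _ 0]) auto
      qed simp
      ultimately show ?thesis by simp
    qed
    then show ?thesis using lim by simp
  qed
  ultimately show ?thesis unfolding f_def S_def by blast
qed

end
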